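(* Let $T\in(0,\infty)$, $\alpha\in(\frac13,\frac12]$, $\beta\in(0,\infty)$, $q\in(0,\infty]$, $m,n\in\mathbb N$, let $\mathbf X=(X,\mathbb X)\in\mathscr B^{\alpha}_{\Phi_\beta,q}([0,T];\mathbb R^n)$ be an exponential Besov-Orlicz rough path and let $f\in C^3_b(\mathbb R^m;\mathbb R^{m\times n})$. Then for every $y\in\mathbb R^m$ there exists a unique solution $(Y,Y')\in\mathscr D^{2\alpha;X}_{\Phi_{\beta/2},q/2}([0,T];\mathbb R^m)$ to the rough differential equation $$\mathrm dY_t=f(Y_t)\,\mathrm d\mathbf X_t,\qquad Y_0=y.$$ Here $(Y,Y')\in\mathscr D^{2\alpha;X}_{\Phi_{\beta/2},q/2}([0,T];\mathbb R^m)$ is called a solution if $$Y_t=y+\int_0^t f(Y_s)\,\mathrm d\mathbf X_s\qquad\text{for all }t\in[0,T],$$ where the integral is the rough integral of the controlled rough path $(f(Y),f(Y)')$ with $f(Y)'=Df(Y)Y'$.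
   Context: **Orlicz norm.** For $\beta\in(0,\infty)$ put $x_\beta=((1-\beta)/\beta)^{1/\beta}$ if $\beta<1$, $x_\beta=0$ if $\beta\ge1$; $\Psi_\beta(x)=e^{x^\beta}-1$; $E_\beta(x)=\Psi_\beta(x)$ for $x\ge x_\beta$, $E_\beta(x)=\Psi_\beta(x_\beta)+\Psi_\beta'(x_\beta)(x-x_\beta)$ for $0\le x<x_\beta$; $\Phi_\beta(x)=E_\beta(x)-E_\beta(0)$. For a bounded interval $D$ and measurable $g$ on $D$ with values in a normed space, $\|g\|_{L^{\Phi_\beta}(D)}=\inf\{\lambda>0:\int_D\Phi_\beta(|g_r|/\lambda)\,\mathrm dr\le1\}$ (with $\inf\emptyset=\infty$). **Besov-Orlicz spaces.** $\triangle^d[0,T]=\{(u_1,\dots,u_d)\in[0,T]^d: u_1\le\dots\le u_d\}$; for $f$ on $[0,T]$, $\delta f_{s,t}=f_t-f_s$. For $\mathbb V$ a finite-dimensional normed space and $\alpha\in(0,1)$, $B^\alpha_{\Phi_\beta,q}([0,T];\mathbb V)$ is the space of $f$ with $\|f\|_{L^{\Phi_\beta}([0,T])}<\infty$ and $[f]_{B^\alpha_{\Phi_\beta,q}}=\big\|\tau^{-\alpha}\sup_{h\in[0,\tau]}\|f_{\cdot+h}-f_\cdot\|_{L^{\Phi_\beta}([0,T-h])}\big\|_{L^q([0,T],\mathrm d\tau/\tau)}<\infty$. Its elements have continuous representatives and are identified with them. For $\alpha\in(0,\infty)$, $B^{\alpha;2}_{\Phi_\beta,q}([0,T];\mathbb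 V)$ is the space of measurable $\varXi:\triangle^2[0,T]\to\mathbb V$ (two maps being identified if for all $h\in[0,T]$ they agree at $(r,r+h)$ for a.a. $r\in[0,T-h]$) with $\|\varXi\|_{B^{\alpha;2}_{\Phi_\beta,q}}=\big\|\tau^{-\alpha}\sup_{h\in[0,\tau]}\|\varXi_{\cdot,\cdot+h}\|_{L^{\Phi_\beta}([0,T-h])}\big\|_{L^q([0,T],\mathrm d\tau/\tau)}<\infty$. Convention: $\infty/2=\infty/3=\infty$. **Rough paths.** $\mathscr B^\alpha_{\Phi_\beta,q}([0,T];\mathbb R^n)$ is the set of pairs $(X,\mathbb X)$ with $X\in B^\alpha_{\Phi_\beta,q}([0,T];\mathbb R^n)$ and $\mathbb X\in B^{2\alpha;2}_{\Phi_{\beta/2},q/2}([0,T];\mathbb R^{n\times n})$ satisfying Chen's relations $\mathbb X_{s,t}-\mathbb X_{s,u}-\mathbb X_{u,t}=(\delta X_{s,u})(\delta X_{u,t})^\top$ for all $(s,u,t)\in\triangle^3[0,T]$ ($\mathbb X$ has a continuous version, which is used). **Controlled rough paths.** For a finite-dimensional $\mathbb V$ (here $\mathbb R^m$ or $\mathbb R^{m\times n}$), $\mathscr D^{2\alpha;X}_{\Phi_{\beta/2},q/2}([0,T];\mathbb V)$ is the set of pairs $(Y,Y')$ with $Y\in B^\alpha_{\Phi_\beta,q}([0,T];\mathbb V)$, $Y'\in B^\alpha_{\Phi_\beta,q}([0,T];\mathcal L(\mathbb R^n;\mathbb V))$ and remainder $R^Y_{s,t}=\delta Y_{s,t}-Y'_s\delta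 X_{s,t}$ in $B^{2\alpha;2}_{\Phi_{\beta/2},q/2}([0,T];\mathbb V)$. **Composition.** If $(Y,Y')\in\mathscr D^{2\alpha;X}_{\Phi_{\beta/2},q/2}([0,T];\mathbb R^m)$ and $f\in C^2_b$, then $(f(Y),Df(Y)Y')\in\mathscr D^{2\alpha;X}_{\Phi_{\beta/2},q/2}([0,T];\mathbb R^{m\times n})$. $C_b^k$ denotes maps bounded and continuous together with their Fréchet derivatives up to order $k$. **Rough integral.** For $(Z,Z')\in\mathscr D^{2\alpha;X}_{\Phi_{\beta/2},q/2}([0,T];\mathbb R^{m\times n})$ set $\varXi_{s,t}=Z_s\,\delta X_{s,t}+Z'_s\mathbb X_{s,t}\in\mathbb R^m$, where $A\in\mathcal L(\mathbb R^n;\mathbb R^{m\times n})$ acts linearly on $\mathbb R^{n\times n}$ by $A(bc^\top)=(Ab)c$. The rough integral $\int_0^\cdot Z_s\,\mathrm d\mathbf X_s$ is the unique continuous $\mathcal I:[0,T]\to\mathbb R^m$ with $\mathcal I_0=0$ and $\delta\mathcal I-\varXi\in B^{3\alpha;2}_{\Phi_{\beta/3},q/3}([0,T];\mathbb R^m)$.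
   Formalization: The notion of solution additionally requires Y' = f(Y) on [0,T]; without it uniqueness of (Y,Y') fails, e.g. for X = 0, 𝕏 = 0 the constant path Y = y with any Y' in the Besov-Orlicz space would be a solution. *)

theory Defs
  imports "HOL-Analysis.Analysis" "HOL-Probability.Essential_Supremum"
begin

section \<open>Orlicz norm\<close>

definition orlicz_x :: "real \<Rightarrow> real" where
  "orlicz_x \<beta> = (if \<beta> < 1 then ((1 - \<beta>) / \<beta>) powr (1 / \<beta>) else 0)"

definition orlicz_Psi :: "real \<Rightarrow> real \<Rightarrow> real" where
  "orlicz_Psi \<beta> x = exp (x powr \<beta>) - 1"

definition orlicz_E :: "real \<Rightarrow> real \<Rightarrow> real" where
  "orlicz_E \<beta> x =
     (if orlicz_x \<beta> \<le> x then orlicz_Psi \<beta> x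
      else orlicz_Psi \<beta> (orlicz_x \<beta>)
             + deriv (orlicz_Psi \<beta>) (orlicz_x \<beta>) * (x - orlicz_x \<beta>))"

definition orlicz_Phi :: "real \<Rightarrow> real \<Rightarrow> real" where
  "orlicz_Phi \<beta> x = orlicz_E \<beta> x - orlicz_E \<beta> 0"

text \<open>Norms take values in \<^typ>\<open>ennreal\<close>, where the infimum of the empty set is infinite.\<close>

definition orlicz_norm :: "real \<Rightarrow> real set \<Rightarrow> (real \<Rightarrow> 'v::real_normed_vector) \<Rightarrow> ennreal" where
  "orlicz_norm \<beta> D g =
     Inf {ennreal c | c. c > 0 \<and>
       (\<integral>\<^sup>+ r \<in> D. ennreal (orlicz_Phi \<beta> (norm (g r) / c)) \<partial>lborel) \<le> 1}"


section \<open>Besov-Orlicz spaces\<close>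

text \<open>The measure \<open>d\<tau>/\<tau>\<close> on \<open>[0,T]\<close>; the point \<open>0\<close> is a null set.\<close>

definition dtau_over_tau :: "real \<Rightarrow> real measure" where
  "dtau_over_tau T = density (restrict_space lborel {0..T}) (\<lambda>\<tau>. ennreal (1 / \<tau>))"

text \<open>Intended for exponents \<open>p > 0\<close>.\<close>

definition ennreal_powr :: "ennreal \<Rightarrow> real \<Rightarrow> ennreal" where
  "ennreal_powr x p = (if x = \<infinity> then \<infinity> else ennreal (enn2real x powr p))"

text \<open>The (quasi-)norm of \<open>L\<^sup>q\<close> for \<open>q \<in> (0,\<infinity>]\<close>. In \<^typ>\<open>ennreal\<close> one has \<open>\<infinity>/2 = \<infinity>/3 = \<infinity>\<close>.\<close>

definition Lq_norm :: "ennreal \<Rightarrow> 'a measure \<Rightarrow> ('a \<Rightarrow> ennreal) \<Rightarrow> ennreal" where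
  "Lq_norm q M F =
     (if q = \<infinity> then esssup M F
      else ennreal_powr (\<integral>\<^sup>+ x. ennreal_powr (F x) (enn2real q) \<partial>M) (1 / enn2real q))"

definition triangle2 :: "real \<Rightarrow> (real \<times> real) set" where
  "triangle2 T = {(s, t). 0 \<le> s \<and> s \<le> t \<and> t \<le> T}"

definition besov2_norm ::
  "real \<Rightarrow> real \<Rightarrow> ennreal \<Rightarrow> real \<Rightarrow> (real \<Rightarrow> real \<Rightarrow> 'v::real_normed_vector) \<Rightarrow> ennreal" where
  "besov2_norm \<alpha> \<beta> q T \<Xi> =
     Lq_norm q (dtau_over_tau T)
       (\<lambda>\<tau>. ennreal (\<tau> powr (- \<alpha>)) *
             (SUP h \<in> {0..\<tau>}. orlicz_norm \<beta> {0..T - h} (\<lambda>r. \<Xi> r (r + h))))"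

text \<open>The space \<open>B\<^sup>\<alpha>\<^sup>;\<^sup>2\<close>. Its elements are represented by maps
  \<open>real \<Rightarrow> real \<Rightarrow> 'v\<close>, of which only the values on the triangle matter.\<close>

definition besov2_space ::
  "real \<Rightarrow> real \<Rightarrow> ennreal \<Rightarrow> real \<Rightarrow> (real \<Rightarrow> real \<Rightarrow> 'v::real_normed_vector) set" where
  "besov2_space \<alpha> \<beta> q T =
     {\<Xi>. (\<lambda>(s, t). \<Xi> s t) \<in> borel_measurable (restrict_space borel (triangle2 T)) \<and>
          besov2_norm \<alpha> \<beta> q T \<Xi> < \<infinity>}"

definition besov_seminorm ::
  "real \<Rightarrow> real \<Rightarrow> ennreal \<Rightarrow> real \<Rightarrow> (real \<Rightarrow> 'v::real_normed_vector) \<Rightarrow> ennreal" where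
  "besov_seminorm \<alpha> \<beta> q T g =
     Lq_norm q (dtau_over_tau T)
       (\<lambda>\<tau>. ennreal (\<tau> powr (- \<alpha>)) *
             (SUP h \<in> {0..\<tau>}. orlicz_norm \<beta> {0..T - h} (\<lambda>r. g (r + h) - g r)))"

text \<open>Elements of \<open>B\<^sup>\<alpha>\<close> are identified with their continuous representatives, hence the
  continuity requirement.\<close>

definition besov_space ::
  "real \<Rightarrow> real \<Rightarrow> ennreal \<Rightarrow> real \<Rightarrow> (real \<Rightarrow> 'v::real_normed_vector) set" where
  "besov_space \<alpha> \<beta> q T =
     {g. continuous_on {0..T} g \<and> orlicz_norm \<beta> {0..T} g < \<infinity> \<and> besov_seminorm \<alpha> \<beta> q T g < \<infinity>}"


section \<open>Rough paths and controlled rough paths\<close>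

text \<open>The matrix \<open>b c\<^sup>T\<close>.\<close>

definition outer_product :: "real ^ 'a \<Rightarrow> real ^ 'b \<Rightarrow> real ^ 'b ^ 'a" where
  "outer_product b c = (\<chi> i j. b $ i * c $ j)"

text \<open>The second level is taken to be its continuous version.\<close>

definition rough_paths ::
  "real \<Rightarrow> real \<Rightarrow> ennreal \<Rightarrow> real \<Rightarrow>
    ((real \<Rightarrow> real ^ 'n) \<times> (real \<Rightarrow> real \<Rightarrow> real ^ 'n ^ 'n)) set" where
  "rough_paths \<alpha> \<beta> q T =
     {(X, XX). X \<in> besov_space \<alpha> \<beta> q T \<and>
        XX \<in> besov2_space (2 * \<alpha>) (\<beta> / 2) (q / 2) T \<and>
        continuous_on (triangle2 T) (\<lambda>(s, t). XX s t) \<and>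
        (\<forall>s u t. 0 \<le> s \<and> s \<le> u \<and> u \<le> t \<and> t \<le> T \<longrightarrow>
           XX s t - XX s u - XX u t = outer_product (X u - X s) (X t - X u))}"

definition controlled_paths ::
  "real \<Rightarrow> real \<Rightarrow> ennreal \<Rightarrow> real \<Rightarrow> (real \<Rightarrow> real ^ 'n) \<Rightarrow>
    ((real \<Rightarrow> 'v::real_normed_vector) \<times> (real \<Rightarrow> (real ^ 'n) \<Rightarrow>\<^sub>L 'v)) set" where
  "controlled_paths \<alpha> \<beta> q T X =
     {(Y, Y'). Y \<in> besov_space \<alpha> \<beta> q T \<and> Y' \<in> besov_space \<alpha> \<beta> q T \<and>
        (\<lambda>s t. Y t - Y s - blinfun_apply (Y' s) (X t - X s))
          \<in> besov2_space (2 * \<alpha>) (\<beta> / 2) (q / 2) T}"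

text \<open>The action of \<open>A \<in> L(\<real>\<^sup>n; \<real>\<^sup>m\<^sup>\<times>\<^sup>n)\<close> on \<open>n \<times> n\<close> matrices. It is the linear map characterised
  by \<open>A (b c\<^sup>T) = (A b) c\<close>, see the two lemmas below.\<close>

definition blinfun_matrix_act ::
  "((real ^ 'n) \<Rightarrow>\<^sub>L (real ^ 'n ^ 'm)) \<Rightarrow> real ^ 'n ^ 'n \<Rightarrow> real ^ 'm" where
  "blinfun_matrix_act A M = (\<Sum>i\<in>UNIV. blinfun_apply A (axis i 1) *v (M $ i))"

lemma linear_blinfun_matrix_act: "linear (blinfun_matrix_act A)"
  by (rule linearI)
     (simp_all add: blinfun_matrix_act_def matrix_vector_right_distrib sum.distrib
        matrix_vector_mult_scaleR scaleR_sum_right)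

lemma blinfun_matrix_act_outer_product:
  "blinfun_matrix_act A (outer_product b c) = blinfun_apply A b *v c"
proof -
  have row: "outer_product b c $ i = b $ i *\<^sub>R c" for i
    by (simp add: outer_product_def vec_eq_iff)
  have lin: "linear (\<lambda>M. M *v c)" for c :: "real ^ 'n"
    by (rule linearI)
       (simp_all add: matrix_vector_mult_add_rdistrib scaleR_matrix_vector_assoc)
  have "blinfun_apply A b = blinfun_apply A (\<Sum>i\<in>UNIV. b $ i *\<^sub>R axis i 1)"
    by (simp add: basis_expansion flip: scalar_mult_eq_scaleR)
  also have "\<dots> = (\<Sum>i\<in>UNIV. b $ i *\<^sub>R blinfun_apply A (axis i 1))"
    by (simp add: blinfun.sum_right blinfun.scaleR_right)
  finally show ?thesis
    by (simp add: blinfun_matrix_act_def row linear_sum[OF lin] linear_cmul[OF lin]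
        matrix_vector_mult_scaleR)
qed

text \<open>\<open>I\<close> is (on \<open>[0,T]\<close>) the rough integral of the controlled rough path \<open>(Z, Z')\<close> against
  \<open>(X, XX)\<close>.\<close>

definition has_rough_integral ::
  "real \<Rightarrow> real \<Rightarrow> ennreal \<Rightarrow> real \<Rightarrow> (real \<Rightarrow> real ^ 'n) \<Rightarrow> (real \<Rightarrow> real \<Rightarrow> real ^ 'n ^ 'n) \<Rightarrow>
    (real \<Rightarrow> real ^ 'n ^ 'm) \<Rightarrow> (real \<Rightarrow> (real ^ 'n) \<Rightarrow>\<^sub>L (real ^ 'n ^ 'm)) \<Rightarrow> (real \<Rightarrow> real ^ 'm) \<Rightarrow> bool" where
  "has_rough_integral \<alpha> \<beta> q T X XX Z Z' I \<longleftrightarrow>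
     (Z, Z') \<in> controlled_paths \<alpha> \<beta> q T X \<and>
     continuous_on {0..T} I \<and> I 0 = 0 \<and>
     (\<lambda>s t. (I t - I s) - (Z s *v (X t - X s) + blinfun_matrix_act (Z' s) (XX s t)))
       \<in> besov2_space (3 * \<alpha>) (\<beta> / 3) (q / 3) T"


section \<open>Smooth bounded maps and rough differential equations\<close>

text \<open>The Frechet derivative as a map into the bounded linear operators; it can be iterated.
  Meaningful for differentiable maps.\<close>

definition frechet_D ::
  "('a::real_normed_vector \<Rightarrow> 'b::real_normed_vector) \<Rightarrow> 'a \<Rightarrow> 'a \<Rightarrow>\<^sub>L 'b" where
  "frechet_D f x = Blinfun (frechet_derivative f (at x))"

definition C3_b :: "('a::real_normed_vector \<Rightarrow> 'b::real_normed_vector) \<Rightarrow> bool" where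
  "C3_b f \<longleftrightarrow>
     (\<forall>x. f differentiable (at x)) \<and>
     (\<forall>x. frechet_D f differentiable (at x)) \<and>
     (\<forall>x. frechet_D (frechet_D f) differentiable (at x)) \<and>
     f \<in> bcontfun \<and> frechet_D f \<in> bcontfun \<and>
     frechet_D (frechet_D f) \<in> bcontfun \<and>
     frechet_D (frechet_D (frechet_D f)) \<in> bcontfun"

text \<open>Solutions \<open>(Y, Y')\<close> of \<open>dY = f(Y) dX\<close>, \<open>Y\<^sub>0 = y\<close>. The equation is one between controlled
  rough paths: as such, the right-hand side \<open>y + \<integral> f(Y) dX\<close> carries the Gubinelli derivative
  \<open>f(Y)\<close>, so \<open>Y' = f(Y)\<close> is part of the notion of solution. Without it there is no uniqueness
  in general: if \<open>X = 0\<close> and \<open>XX = 0\<close>, any \<open>Y'\<close> in the Besov-Orlicz space goes with the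
  constant path \<open>Y = y\<close>.\<close>

definition rde_solution ::
  "real \<Rightarrow> real \<Rightarrow> ennreal \<Rightarrow> real \<Rightarrow> (real \<Rightarrow> real ^ 'n) \<Rightarrow> (real \<Rightarrow> real \<Rightarrow> real ^ 'n ^ 'n) \<Rightarrow>
    (real ^ 'm \<Rightarrow> real ^ 'n ^ 'm) \<Rightarrow> real ^ 'm \<Rightarrow>
    (real \<Rightarrow> real ^ 'm) \<Rightarrow> (real \<Rightarrow> (real ^ 'n) \<Rightarrow>\<^sub>L (real ^ 'm)) \<Rightarrow> bool" where
  "rde_solution \<alpha> \<beta> q T X XX f y Y Y' \<longleftrightarrow>
     (Y, Y') \<in> controlled_paths \<alpha> \<beta> q T X \<and>
     (\<forall>t\<in>{0..T}. \<forall>v. blinfun_apply (Y' t) v = f (Y t) *v v) \<and>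
     (\<exists>I. has_rough_integral \<alpha> \<beta> q T X XX
            (\<lambda>t. f (Y t)) (\<lambda>t. frechet_D f (Y t) o\<^sub>L Y' t) I \<and>
          (\<forall>t\<in>{0..T}. Y t = y + I t))"

end

theory Submission
  imports Defs
begin

text \<open>Fix \<open>a \<in> (1/3, \<alpha>)\<close>. Averaging over dyadic intervals turns the Besov-Orlicz bounds on \<open>X\<close>,
  \<open>XX\<close>, \<open>Y\<close>, the remainder of \<open>Y\<close> and the remainder of the rough integral into pointwise bounds with
  exponents \<open>a\<close>, \<open>2a\<close> and \<open>3a > 1\<close>. Hence every solution satisfies Davie's expansion
  \<open>Y\<^sub>t = Y\<^sub>s + f(Y\<^sub>s) X\<^sub>s\<^sub>,\<^sub>t + Df(Y\<^sub>s) f(Y\<^sub>s) XX\<^sub>s\<^sub>,\<^sub>t + O(|t - s|\<^sup>3\<^sup>a)\<close>. The second order Euler step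
  is an almost flow; a path with this expansion exists as a cluster point of Euler schemes, and it is
  unique by a contraction argument for the difference of two remainders. Conversely, such a path has
  the required Besov-Orlicz regularity: only the remainder of order three needs sewing in the Orlicz
  norm, since the lower order ones are dominated by \<open>X\<close>, \<open>XX\<close> and small powers of \<open>|t - s|\<close>.\<close>


section \<open>The Young function\<close>

text \<open>Passing from Orlicz averages to values costs a small power of t - s, so pointwise bounds
  only reach exponents below \<alpha>, 2\<alpha> and 3\<alpha>. This loss is harmless for existence
  and uniqueness, where only the threshold 3a > 1 counts; both are therefore carried out for an
  abstract almost flow in which neither the Young function nor \<open>q\<close> leaves a trace.
  Recovering the exact regularity afterwards meets two difficulties. First, \<open>q\<close> and
  \<open>q / 3\<close> may be below one, where the L^q functional is only a quasi-norm; dyadic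
  sequences are therefore compared through maxima and a recursion instead of a triangle inequality.
  Second, 3\<alpha> may be arbitrarily close to one, where sewing tolerates no constant in the
  triangle inequality of the Orlicz gauge. The tangent line below the inflection point makes
  \<open>orlicz_Phi\<close> convex for every positive exponent, and convexity supplies the constant
  one.\<close>

definition dPsi :: "real \<Rightarrow> real \<Rightarrow> real" where
  "dPsi b x = b * exp (x powr b + (b - 1) * ln x)"

lemma orlicz_Psi_deriv:
  assumes "x > 0"
  shows "(orlicz_Psi b has_real_derivative dPsi b x) (at x)"
proof -
  have "((\<lambda>x. exp (x powr b) - 1) has_real_derivative exp (x powr b) * (b * x powr (b - 1))) (at x)"
    using assms by (auto intro!: derivative_eq_intros simp: powr_diff field_simps)
  moreover have "exp (x powr b) * (b * x powr (b - 1)) = dPsi b x"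
    using assms by (simp add: dPsi_def exp_add powr_def)
  ultimately show ?thesis unfolding orlicz_Psi_def by simp
qed

lemma orlicz_x_nonneg: "0 < b \<Longrightarrow> 0 \<le> orlicz_x b"
  by (simp add: orlicz_x_def)

lemma orlicz_x_pos: "0 < b \<Longrightarrow> b < 1 \<Longrightarrow> 0 < orlicz_x b"
  by (simp add: orlicz_x_def)

text \<open>For b < 1, \<open>orlicz_x b\<close> solves b x^b = 1 - b: it is the inflection point of
  exp(x^b). To its right the second derivative is nonnegative.\<close>

lemma orlicz_x_powr:
  assumes "0 < b" "orlicz_x b \<le> x" "0 < x" shows "1 - b \<le> b * x powr b"
proof (cases "b < 1")
  case True
  have "(1 - b) / b = orlicz_x b powr b"
    using assms True by (simp add: orlicz_x_def powr_powr)
  also have "\<dots> \<le> x powr b"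
    using assms orlicz_x_nonneg by (intro powr_mono2) auto
  finally show ?thesis using assms by (simp add: field_simps)
next
  case False
  then show ?thesis using assms by (smt (verit) mult_nonneg_nonneg powr_ge_zero)
qed

lemma dPsi_nonneg: "0 < b \<Longrightarrow> 0 \<le> dPsi b x"
  by (simp add: dPsi_def)

text \<open>\<open>dPsi\<close> carries the factor x^(b-1) inside the exponential, so only the
  exponent has to increase. Its derivative (b x^b + b - 1) / x is nonnegative from the inflection
  point on.\<close>

lemma dPsi_mono:
  assumes "0 < b" "0 < x" "orlicz_x b \<le> x" "x \<le> y" shows "dPsi b x \<le> dPsi b y"
proof -
  have "x powr b + (b - 1) * ln x \<le> y powr b + (b - 1) * ln y"
  proof (rule DERIV_nonneg_imp_nondecreasing[OF assms(4)])
    fix z assume z: "x \<le> z" "z \<le> y"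
    then have "z > 0" using assms by auto
    moreover have "1 - b \<le> b * z powr b"
      using orlicz_x_powr[of b z] assms z by auto
    moreover have "((\<lambda>z. z powr b + (b - 1) * ln z) has_real_derivative (b * z powr b + b - 1) / z) (at z)"
      using \<open>z > 0\<close> by (auto intro!: derivative_eq_intros simp: powr_diff field_simps)
    ultimately show "\<exists>d. ((\<lambda>z. z powr b + (b - 1) * ln z) has_real_derivative d) (at z) \<and> 0 \<le> d"
      by (intro exI[of _ "(b * z powr b + b - 1) / z"]) auto
  qed
  then show ?thesis using assms by (simp add: dPsi_def)
qed

text \<open>Left of the inflection point E is the tangent taken there, so its slope is frozen;
  \<open>max\<close> expresses this. At the junction the two one-sided derivatives agree and are
  glued.\<close>

lemma orlicz_E_deriv:
  assumes b: "0 < b" and x: "0 < x"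
  shows "(orlicz_E b has_real_derivative dPsi b (max x (orlicz_x b))) (at x)"
proof -
  let ?a = "orlicz_x b"
  let ?L = "\<lambda>x. orlicz_Psi b ?a + deriv (orlicz_Psi b) ?a * (x - ?a)"
  have L: "(?L has_real_derivative deriv (orlicz_Psi b) ?a) (at x)" for x
    by (auto intro!: derivative_eq_intros)
  consider "x < ?a" | "x > ?a" | "x = ?a" by linarith
  then show ?thesis
  proof cases
    case 1
    then have "deriv (orlicz_Psi b) ?a = dPsi b ?a"
      using orlicz_Psi_deriv[of ?a b] x by (intro DERIV_imp_deriv) auto
    then have "(?L has_real_derivative dPsi b (max x ?a)) (at x)" using L[of x] 1 by simp
    then show ?thesis
      by (rule has_field_derivative_transform_within_open[of _ _ _ "{..<?a}"])
         (use 1 in \<open>auto simp: orlicz_E_def\<close>)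
  next
    case 2
    have "(orlicz_Psi b has_real_derivative dPsi b (max x ?a)) (at x)"
      using orlicz_Psi_deriv[OF x] 2 by simp
    then show ?thesis
      by (rule has_field_derivative_transform_within_open[of _ _ _ "{?a<..}"])
         (use 2 in \<open>auto simp: orlicz_E_def\<close>)
  next
    case 3
    then have d: "deriv (orlicz_Psi b) ?a = dPsi b ?a"
      using orlicz_Psi_deriv[of ?a b] x by (intro DERIV_imp_deriv) auto
    have "(orlicz_E b has_real_derivative dPsi b x) (at x within {x..})"
      by (rule has_field_derivative_transform_within[OF has_field_derivative_at_within[OF orlicz_Psi_deriv[OF x]], of 1])
         (auto simp: orlicz_E_def 3)
    moreover have "(orlicz_E b has_real_derivative dPsi b x) (at x within {..x})"
      by (rule has_field_derivative_transform_within[of ?L _ _ _ 1])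
         (use has_field_derivative_at_within[OF L[of x]] in \<open>auto simp: orlicz_E_def 3 d\<close>)
    ultimately have "(orlicz_E b has_real_derivative dPsi b x) (at x within ({x..} \<union> {..x}))"
      unfolding has_field_derivative_iff unfolding at_within_union by (rule filterlim_sup)
    moreover have "{x..} \<union> {..x} = UNIV" by auto
    ultimately show ?thesis using 3 by simp
  qed
qed

text \<open>Only the origin needs an argument. If b < 1, E is affine near it; if b >= 1 there is no
  tangent piece on the half-line.\<close>

lemma orlicz_E_continuous:
  assumes b: "0 < b" shows "continuous_on {0..} (orlicz_E b)"
proof (cases "b < 1")
  case False
  then have "continuous_on {0..} (\<lambda>x. exp (x powr b) - 1)"
    using b by (intro continuous_intros continuous_on_powr') auto
  then show ?thesis
    by (rule continuous_on_eq) (use False in \<open>auto simp: orlicz_E_def orlicz_x_def orlicz_Psi_def\<close>)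
next
  case True
  let ?a = "orlicz_x b"
  note a = orlicz_x_pos[OF b True]
  have "continuous_on {0..?a / 2} (\<lambda>x. orlicz_Psi b ?a + deriv (orlicz_Psi b) ?a * (x - ?a))"
    by (intro continuous_intros)
  then have "continuous_on {0..?a / 2} (orlicz_E b)"
    by (rule continuous_on_eq) (use a in \<open>auto simp: orlicz_E_def\<close>)
  moreover have "continuous_on {?a / 2..} (orlicz_E b)"
    by (intro DERIV_continuous_on[of _ _ "\<lambda>x. dPsi b (max x ?a)"])
       (use a in \<open>auto intro!: has_field_derivative_at_within orlicz_E_deriv[OF b]\<close>)
  ultimately have "continuous_on ({0..?a / 2} \<union> {?a / 2..}) (orlicz_E b)"
    by (intro continuous_on_closed_Un) auto
  moreover have "{0..?a / 2} \<union> {?a / 2..} = {0..}" using a by auto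
  ultimately show ?thesis by simp
qed

lemma orlicz_Phi_continuous: "0 < b \<Longrightarrow> continuous_on {0..} (orlicz_Phi b)"
  unfolding orlicz_Phi_def[abs_def] by (intro continuous_intros orlicz_E_continuous)

lemma orlicz_Phi_0 [simp]: "orlicz_Phi b 0 = 0"
  by (simp add: orlicz_Phi_def)

lemma orlicz_Phi_convex_pos:
  assumes b: "0 < b" shows "convex_on {0<..} (orlicz_Phi b)"
proof (rule convex_on_realI[where f' = "\<lambda>x. dPsi b (max x (orlicz_x b))"])
  fix x :: real assume "x \<in> {0<..}"
  then show "(orlicz_Phi b has_real_derivative dPsi b (max x (orlicz_x b))) (at x)"
    unfolding orlicz_Phi_def[abs_def]
    by (auto intro!: derivative_eq_intros orlicz_E_deriv b)
qed (use b in \<open>auto intro!: dPsi_mono\<close>)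

lemma orlicz_Phi_mono:
  assumes b: "0 < b" and xy: "0 \<le> x" "x \<le> y" shows "orlicz_Phi b x \<le> orlicz_Phi b y"
proof (cases "x = y")
  case False
  show ?thesis
  proof (rule DERIV_nonneg_imp_increasing_open[OF xy(2)])
    fix z assume "x < z" "z < y"
    then have "z > 0" using xy by auto
    then have "(orlicz_Phi b has_real_derivative dPsi b (max z (orlicz_x b))) (at z)"
      unfolding orlicz_Phi_def[abs_def]
      by (auto intro!: derivative_eq_intros orlicz_E_deriv b)
    then show "\<exists>d. (orlicz_Phi b has_real_derivative d) (at z) \<and> 0 \<le> d"
      using dPsi_nonneg[OF b] by auto
  next
    show "continuous_on {x..y} (orlicz_Phi b)"
      by (rule continuous_on_subset[OF orlicz_Phi_continuous[OF b]]) (use xy in auto)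
  qed
qed auto

lemma orlicz_Phi_nonneg: "0 < b \<Longrightarrow> 0 \<le> x \<Longrightarrow> 0 \<le> orlicz_Phi b x"
  using orlicz_Phi_mono[of b 0 x] by simp

text \<open>Adds the endpoint 0, where no derivative is at hand: both arguments are shifted by e >
  0, and e tends to 0 by continuity.\<close>

lemma orlicz_Phi_convex:
  assumes b: "0 < b" and xy: "0 \<le> x" "0 \<le> y" and t: "0 \<le> t" "t \<le> 1"
  shows "orlicz_Phi b ((1 - t) * x + t * y) \<le> (1 - t) * orlicz_Phi b x + t * orlicz_Phi b y"
proof (rule tendsto_le)
  have lim: "((\<lambda>e. orlicz_Phi b (z + e)) \<longlongrightarrow> orlicz_Phi b z) (at_right 0)" if "0 \<le> z" for z
  proof -
    have "(orlicz_Phi b \<longlongrightarrow> orlicz_Phi b z) (at z within {0..})"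
      using orlicz_Phi_continuous[OF b] that by (auto simp: continuous_on_def)
    moreover have "filterlim (\<lambda>e. z + e) (at z within {0..}) (at_right 0)"
      unfolding filterlim_at using that
      by (auto intro!: tendsto_eq_intros eventually_at_rightI[of 0 1])
    ultimately show ?thesis by (rule filterlim_compose)
  qed
  show "((\<lambda>e. orlicz_Phi b (((1 - t) * x + t * y) + e)) \<longlongrightarrow> orlicz_Phi b ((1 - t) * x + t * y)) (at_right 0)"
    using xy t by (intro lim) auto
  show "((\<lambda>e. (1 - t) * orlicz_Phi b (x + e) + t * orlicz_Phi b (y + e)) \<longlongrightarrow>
      (1 - t) * orlicz_Phi b x + t * orlicz_Phi b y) (at_right 0)"
    using xy by (intro tendsto_intros lim) auto
  show "\<forall>\<^sub>F e in at_right 0. orlicz_Phi b (((1 - t) * x + t * y) + e)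
      \<le> (1 - t) * orlicz_Phi b (x + e) + t * orlicz_Phi b (y + e)"
  proof (rule eventually_at_rightI[of 0 1])
    fix e :: real assume "e \<in> {0<..<1}"
    then have "orlicz_Phi b ((1 - t) *\<^sub>R (x + e) + t *\<^sub>R (y + e))
      \<le> (1 - t) * orlicz_Phi b (x + e) + t * orlicz_Phi b (y + e)"
      using convex_onD[OF orlicz_Phi_convex_pos[OF b] t(1) t(2), of "x + e" "y + e"] xy by auto
    then show "orlicz_Phi b (((1 - t) * x + t * y) + e)
      \<le> (1 - t) * orlicz_Phi b (x + e) + t * orlicz_Phi b (y + e)"
      by (simp add: algebra_simps)
  qed auto
qed auto

text \<open>Convexity together with the value 0 at 0. It trades a factor in front of Phi for a
  factor in the argument.\<close>

lemma orlicz_Phi_star: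
  assumes b: "0 < b" and "0 \<le> x" "1 \<le> M" shows "orlicz_Phi b (x / M) \<le> orlicz_Phi b x / M"
  using orlicz_Phi_convex[OF b, of 0 x "1 / M"] assms by simp

text \<open>Lets products and powers be estimated for exp(x^b) alone, without regard to the tangent
  piece: the two differ by a bounded amount.\<close>

lemma orlicz_Phi_exp_compare:
  assumes b: "0 < b"
  obtains C where "0 < C" "\<And>x. 0 \<le> x \<Longrightarrow> orlicz_Phi b x \<le> exp (x powr b) + C"
    "\<And>x. 0 \<le> x \<Longrightarrow> exp (x powr b) \<le> orlicz_Phi b x + C"
proof -
  let ?a = "orlicz_x b"
  define C where "C = 1 + \<bar>orlicz_E b 0\<bar> + orlicz_Phi b ?a + exp (?a powr b)"
  note a = orlicz_x_nonneg[OF b]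
  show ?thesis
  proof (rule that[of C])
    show "C > 0" using orlicz_Phi_nonneg[OF b a] by (simp add: C_def add_nonneg_pos)
    fix x :: real assume x: "0 \<le> x"
    have n: "0 \<le> orlicz_Phi b x" "0 \<le> orlicz_Phi b ?a" using b x a orlicz_Phi_nonneg by auto
    have "orlicz_Phi b x \<le> exp (x powr b) + C \<and> exp (x powr b) \<le> orlicz_Phi b x + C"
    proof (cases "?a \<le> x")
      case True
      then have "orlicz_Phi b x = exp (x powr b) - 1 - orlicz_E b 0"
        by (simp add: orlicz_Phi_def orlicz_E_def orlicz_Psi_def)
      then show ?thesis using n by (simp add: C_def) (smt (verit) exp_gt_zero)
    next
      case False
      then have "orlicz_Phi b x \<le> orlicz_Phi b ?a" using b x by (intro orlicz_Phi_mono) auto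
      moreover have "x powr b \<le> ?a powr b" using False x b by (intro powr_mono2) auto
      ultimately show ?thesis using n by (auto simp: C_def add_increasing2 add_increasing intro: order_trans[of _ "exp (?a powr b)"])
    qed
    then show "orlicz_Phi b x \<le> exp (x powr b) + C" "exp (x powr b) \<le> orlicz_Phi b x + C" by auto
  qed
qed

text \<open>For x > 1 and n >= p / b one has x^p <= (x^b)^n <= n! exp(x^b).\<close>

lemma power_le_orlicz_Phi:
  assumes b: "0 < b"
  obtains C where "0 < C" "\<And>x. 0 \<le> x \<Longrightarrow> x ^ p \<le> C * (orlicz_Phi b x + 1)"
proof -
  obtain C0 where C0: "0 < C0" "\<And>x. 0 \<le> x \<Longrightarrow> exp (x powr b) \<le> orlicz_Phi b x + C0"
    using orlicz_Phi_exp_compare[OF b] by metis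
  obtain n :: nat where n: "real p / b \<le> real n" using real_arch_simple by blast
  define C where "C = 1 + fact n * (1 + C0)"
  show ?thesis
  proof (rule that[of C])
    show "C > 0" using C0 by (simp add: C_def add_pos_nonneg)
    fix x :: real assume x: "0 \<le> x"
    note P = orlicz_Phi_nonneg[OF b x]
    have "x ^ p \<le> 1 + fact n * exp (x powr b)"
    proof (cases "x \<le> 1")
      case True
      then have "x ^ p \<le> 1" using x by (simp add: power_le_one)
      then show ?thesis by (smt (verit) exp_ge_zero fact_ge_zero mult_nonneg_nonneg)
    next
      case False
      have "x ^ p = x powr real p" using False by (simp add: powr_realpow)
      also have "\<dots> \<le> x powr (b * real n)" using False n b by (intro powr_mono) (auto simp: field_simps)
      also have "\<dots> = (x powr b) ^ n" using False by (simp add: powr_powr flip: powr_realpow)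
      also have "\<dots> \<le> fact n * exp (x powr b)"
        using exp_ge_zero powr_ge_zero[of x b] sum_le_suminf[OF summable_exp_generic[of "x powr b"], of "{n}"]
        by (simp add: exp_def field_simps)
      finally show ?thesis by simp
    qed
    also have "\<dots> \<le> 1 + fact n * (orlicz_Phi b x + C0)" using C0(2)[OF x] by simp
    also have "\<dots> \<le> C * (orlicz_Phi b x + 1)"
      using P C0(1) by (simp add: C_def algebra_simps add_increasing)
    finally show "x ^ p \<le> C * (orlicz_Phi b x + 1)" .
  qed
qed

text \<open>(xy)^c = (x^a)^(c/a) (y^b)^(c/b) with c/a + c/b = 1 is a weighted geometric mean, hence
  at most the maximum of x^a and y^b. The exponential of a maximum is at most the sum of the
  exponentials.\<close>

lemma exp_powr_mult_le:
  fixes a b c :: real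
  assumes "0 < a" "0 < b" "1 / c = 1 / a + 1 / b" "0 \<le> x" "0 \<le> y"
  shows "exp ((x * y) powr c) \<le> exp (x powr a) + exp (y powr b)"
proof -
  have "0 < 1 / a + 1 / b" using assms(1,2) by (intro add_pos_pos) simp_all
  then have c: "0 < c" using assms(3) by (metis zero_less_divide_1_iff)
  have ca: "c * (1 + a / b) = a" "c * (1 + b / a) = b"
    using assms c by (auto simp: field_simps)
  have "(x * y) powr c \<le> max (x powr a) (y powr b)"
  proof (cases "y powr b \<le> x powr a")
    case True
    have "y = (y powr b) powr (1 / b)" using assms by (simp add: powr_powr)
    also have "\<dots> \<le> (x powr a) powr (1 / b)" using True assms by (intro powr_mono2) auto
    finally have "y \<le> x powr (a / b)" by (simp add: powr_powr)
    then have "(x * y) powr c \<le> (x * x powr (a / b)) powr c"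
      using assms c by (intro powr_mono2 mult_left_mono) auto
    also have "x * x powr (a / b) = x powr (1 + a / b)" using assms by (cases "x = 0") (auto simp: powr_add)
    also have "\<dots> powr c = x powr a" by (simp add: powr_powr mult.commute ca)
    finally show ?thesis by simp
  next
    case False
    have "x = (x powr a) powr (1 / a)" using assms by (simp add: powr_powr)
    also have "\<dots> \<le> (y powr b) powr (1 / a)" using False assms by (intro powr_mono2) auto
    finally have "x \<le> y powr (b / a)" by (simp add: powr_powr)
    then have "(x * y) powr c \<le> (y powr (b / a) * y) powr c"
      using assms c by (intro powr_mono2 mult_right_mono) auto
    also have "y powr (b / a) * y = y powr (1 + b / a)" using assms by (cases "y = 0") (auto simp: powr_add)
    also have "\<dots> powr c = y powr b" by (simp add: powr_powr mult.commute ca)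
    finally show ?thesis by simp
  qed
  then have "exp ((x * y) powr c) \<le> exp (max (x powr a) (y powr b))" by simp
  also have "\<dots> \<le> exp (x powr a) + exp (y powr b)" by (simp add: max_def)
  finally show ?thesis .
qed

lemma orlicz_Phi_mult_le:
  fixes a b c :: real
  assumes "0 < a" "0 < b" "1 / c = 1 / a + 1 / b"
  obtains C where "0 < C"
    "\<And>x y. 0 \<le> x \<Longrightarrow> 0 \<le> y \<Longrightarrow> orlicz_Phi c (x * y) \<le> orlicz_Phi a x + orlicz_Phi b y + C"
proof -
  have "0 < 1 / a + 1 / b" using assms(1,2) by (intro add_pos_pos) simp_all
  then have c: "0 < c" using assms(3) by (metis zero_less_divide_1_iff)
  obtain Ca where Ca: "0 < Ca" "\<And>x. 0 \<le> x \<Longrightarrow> exp (x powr a) \<le> orlicz_Phi a x + Ca"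
    using orlicz_Phi_exp_compare[OF assms(1)] by metis
  obtain Cb where Cb: "0 < Cb" "\<And>x. 0 \<le> x \<Longrightarrow> exp (x powr b) \<le> orlicz_Phi b x + Cb"
    using orlicz_Phi_exp_compare[OF assms(2)] by metis
  obtain Cc where Cc: "0 < Cc" "\<And>x. 0 \<le> x \<Longrightarrow> orlicz_Phi c x \<le> exp (x powr c) + Cc"
    using orlicz_Phi_exp_compare[OF c] by metis
  show ?thesis
  proof (rule that[of "Ca + Cb + Cc"])
    fix x y :: real assume xy: "0 \<le> x" "0 \<le> y"
    then show "orlicz_Phi c (x * y) \<le> orlicz_Phi a x + orlicz_Phi b y + (Ca + Cb + Cc)"
      using Ca(2)[of x] Cb(2)[of y] Cc(2)[of "x * y"] exp_powr_mult_le[OF assms xy] by simp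
  qed (use Ca Cb Cc in auto)
qed

section \<open>Gauges\<close>

text \<open>Stands in for the inequality \<open>\<parallel>u\<parallel> \<le> c\<close>: carrying an admissible \<open>c\<close> avoids the infimum.\<close>

definition gauge_le :: "real \<Rightarrow> real set \<Rightarrow> (real \<Rightarrow> real) \<Rightarrow> real \<Rightarrow> bool" where
  "gauge_le b D u c \<longleftrightarrow> 0 < c \<and> continuous_on D u \<and> (\<forall>r\<in>D. 0 \<le> u r) \<and>
     (\<integral>\<^sup>+ r \<in> D. ennreal (orlicz_Phi b (u r / c)) \<partial>lborel) \<le> 1"

lemma orlicz_Phi_measurable:
  assumes "0 < b" "D \<in> sets borel" "continuous_on D u" "\<And>r. r \<in> D \<Longrightarrow> 0 \<le> u r" "0 < c"
  shows "(\<lambda>r. ennreal (orlicz_Phi b (u r / c)) * indicator D r) \<in> borel_measurable borel"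
proof -
  have "continuous_on D (\<lambda>r. orlicz_Phi b (u r / c))"
    using assms by (intro continuous_on_compose2[OF orlicz_Phi_continuous] continuous_intros) auto
  then have [measurable]: "(\<lambda>r. indicator D r *\<^sub>R orlicz_Phi b (u r / c)) \<in> borel_measurable borel"
    using assms(2) by (intro borel_measurable_continuous_on_indicator)
  have "(\<lambda>r. ennreal (indicator D r *\<^sub>R orlicz_Phi b (u r / c))) \<in> borel_measurable borel"
    by measurable
  also have "(\<lambda>r. ennreal (indicator D r *\<^sub>R orlicz_Phi b (u r / c))) =
      (\<lambda>r. ennreal (orlicz_Phi b (u r / c)) * indicator D r)"
    by (auto simp: indicator_def)
  finally show ?thesis .
qed

text \<open>By \<open>orlicz_Phi_star\<close>, an integral bounded by \<open>M\<close> instead of 1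
  costs a factor \<open>M\<close> in the gauge.\<close>

lemma gauge_leI:
  assumes b: "0 < b" and D: "D \<in> sets borel" and u: "continuous_on D u" "\<And>r. r \<in> D \<Longrightarrow> 0 \<le> u r"
    and c: "0 < c" and M: "1 \<le> M"
    and le: "(\<integral>\<^sup>+ r \<in> D. ennreal (orlicz_Phi b (u r / c)) \<partial>lborel) \<le> ennreal M"
  shows "gauge_le b D u (M * c)"
proof -
  have "(\<integral>\<^sup>+ r \<in> D. ennreal (orlicz_Phi b (u r / (M * c))) \<partial>lborel) \<le>
      (\<integral>\<^sup>+ r. ennreal (1 / M) * (ennreal (orlicz_Phi b (u r / c)) * indicator D r) \<partial>lborel)"
  proof (intro nn_integral_mono)
    fix r
    show "ennreal (orlicz_Phi b (u r / (M * c))) * indicator D r \<le>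
        ennreal (1 / M) * (ennreal (orlicz_Phi b (u r / c)) * indicator D r)"
    proof (cases "r \<in> D")
      case True
      have "orlicz_Phi b (u r / c / M) \<le> orlicz_Phi b (u r / c) / M"
        using u(2)[OF True] c M by (intro orlicz_Phi_star[OF b]) auto
      then have "ennreal (orlicz_Phi b (u r / (M * c))) \<le> ennreal (1 / M * orlicz_Phi b (u r / c))"
        by (intro ennreal_leI) (simp add: mult.commute)
      also have "\<dots> = ennreal (1 / M) * ennreal (orlicz_Phi b (u r / c))"
        using M by (intro ennreal_mult') simp
      finally show ?thesis using True by simp
    qed simp
  qed
  also have "\<dots> = ennreal (1 / M) * (\<integral>\<^sup>+ r \<in> D. ennreal (orlicz_Phi b (u r / c)) \<partial>lborel)"
    using orlicz_Phi_measurable[OF b D u(1) _ c] u(2) by (intro nn_integral_cmult) simp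
  also have "\<dots> \<le> ennreal (1 / M) * ennreal M" by (intro mult_left_mono le) simp
  also have "\<dots> = 1" using M by (simp flip: ennreal_mult)
  finally show ?thesis using c M u by (auto simp: gauge_le_def)
qed

lemma gauge_le_mono:
  assumes b: "0 < b" and g: "gauge_le b D u c" and D': "D' \<subseteq> D" and c: "c \<le> c'"
    and v: "continuous_on D' v" "\<And>r. r \<in> D' \<Longrightarrow> 0 \<le> v r" "\<And>r. r \<in> D' \<Longrightarrow> v r \<le> u r"
  shows "gauge_le b D' v c'"
proof -
  have c0: "0 < c" using g by (simp add: gauge_le_def)
  have "(\<integral>\<^sup>+ r \<in> D'. ennreal (orlicz_Phi b (v r / c')) \<partial>lborel) \<le>
      (\<integral>\<^sup>+ r \<in> D. ennreal (orlicz_Phi b (u r / c)) \<partial>lborel)"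
  proof (intro nn_integral_mono)
    fix r
    show "ennreal (orlicz_Phi b (v r / c')) * indicator D' r \<le>
        ennreal (orlicz_Phi b (u r / c)) * indicator D r"
    proof (cases "r \<in> D'")
      case True
      have "v r / c' \<le> u r / c" using v(2,3)[of r] True c c0 by (intro frac_le) auto
      then have "orlicz_Phi b (v r / c') \<le> orlicz_Phi b (u r / c)"
        using v(2,3)[of r] True c c0 by (intro orlicz_Phi_mono[OF b]) auto
      moreover have "r \<in> D" using True D' by auto
      ultimately show ?thesis using True by (auto intro: ennreal_leI)
    qed simp
  qed
  also have "\<dots> \<le> 1" using g by (simp add: gauge_le_def)
  finally show ?thesis using v c c0 by (auto simp: gauge_le_def)
qed

text \<open>(u + v) / (c + d) is the convex combination of u / c and v / d with weights c / (c + d)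
  and d / (c + d), so convexity of Phi bounds its integral by 1 again.\<close>

lemma gauge_le_add:
  assumes b: "0 < b" and D: "D \<in> sets borel" and g: "gauge_le b D u c" "gauge_le b D v d"
  shows "gauge_le b D (\<lambda>r. u r + v r) (c + d)"
proof -
  have c: "0 < c" "0 < d" and u: "continuous_on D u" "\<And>r. r \<in> D \<Longrightarrow> 0 \<le> u r"
    and v: "continuous_on D v" "\<And>r. r \<in> D \<Longrightarrow> 0 \<le> v r"
    using g by (auto simp: gauge_le_def)
  define t where "t = d / (c + d)"
  have t: "0 \<le> t" "t \<le> 1" "1 - t = c / (c + d)" using c by (auto simp: t_def field_simps)
  have "(\<integral>\<^sup>+ r \<in> D. ennreal (orlicz_Phi b ((u r + v r) / (c + d))) \<partial>lborel) \<le>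
      (\<integral>\<^sup>+ r. ennreal (1 - t) * (ennreal (orlicz_Phi b (u r / c)) * indicator D r) +
         ennreal t * (ennreal (orlicz_Phi b (v r / d)) * indicator D r) \<partial>lborel)"
  proof (intro nn_integral_mono)
    fix r
    show "ennreal (orlicz_Phi b ((u r + v r) / (c + d))) * indicator D r \<le>
        ennreal (1 - t) * (ennreal (orlicz_Phi b (u r / c)) * indicator D r) +
         ennreal t * (ennreal (orlicz_Phi b (v r / d)) * indicator D r)"
    proof (cases "r \<in> D")
      case True
      note uv = u(2)[OF True] v(2)[OF True]
      have "(u r + v r) / (c + d) = (1 - t) * (u r / c) + t * (v r / d)"
        using c unfolding t(3) by (simp add: t_def add_divide_distrib)
      then have "orlicz_Phi b ((u r + v r) / (c + d)) \<le>
          (1 - t) * orlicz_Phi b (u r / c) + t * orlicz_Phi b (v r / d)"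
        using orlicz_Phi_convex[OF b, of "u r / c" "v r / d" t] uv c t(1,2) by auto
      then have "ennreal (orlicz_Phi b ((u r + v r) / (c + d))) \<le>
          ennreal ((1 - t) * orlicz_Phi b (u r / c) + t * orlicz_Phi b (v r / d))"
        by (rule ennreal_leI)
      also have "\<dots> = ennreal (1 - t) * ennreal (orlicz_Phi b (u r / c)) + ennreal t * ennreal (orlicz_Phi b (v r / d))"
        using t(1,2) uv c b orlicz_Phi_nonneg[OF b, of "u r / c"] orlicz_Phi_nonneg[OF b, of "v r / d"]
        by (subst ennreal_plus) (auto simp: ennreal_mult)
      finally show ?thesis using True by simp
    qed simp
  qed
  also have "\<dots> = ennreal (1 - t) * (\<integral>\<^sup>+ r \<in> D. ennreal (orlicz_Phi b (u r / c)) \<partial>lborel) +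
      ennreal t * (\<integral>\<^sup>+ r \<in> D. ennreal (orlicz_Phi b (v r / d)) \<partial>lborel)"
    using orlicz_Phi_measurable[OF b D u(1) _ c(1)] orlicz_Phi_measurable[OF b D v(1) _ c(2)] u(2) v(2)
    by (subst nn_integral_add) (auto intro!: arg_cong2[where f = "(+)"] nn_integral_cmult)
  also have "\<dots> \<le> ennreal (1 - t) * 1 + ennreal t * 1"
    using g by (intro add_mono mult_left_mono) (auto simp: gauge_le_def)
  also have "\<dots> = 1" using t(1,2) by (simp flip: ennreal_plus)
  finally show ?thesis using c u v by (auto simp: gauge_le_def intro!: continuous_intros add_nonneg_nonneg)
qed

lemma gauge_le_scale:
  assumes "gauge_le b D u c" "0 < l" shows "gauge_le b D (\<lambda>r. l * u r) (l * c)"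
  using assms by (auto simp: gauge_le_def intro!: continuous_intros)

lemma gauge_le_shift:
  assumes b: "0 < b" and g: "gauge_le b {p..q} u c"
  shows "gauge_le b {p - s..q - s} (\<lambda>r. u (r + s)) c"
proof -
  have c: "0 < c" and u: "continuous_on {p..q} u" "\<And>r. r \<in> {p..q} \<Longrightarrow> 0 \<le> u r"
    using g by (auto simp: gauge_le_def)
  have "(\<integral>\<^sup>+ r \<in> {p..q}. ennreal (orlicz_Phi b (u r / c)) \<partial>lborel) =
      (\<integral>\<^sup>+ r. ennreal (orlicz_Phi b (u (s + 1 * r) / c)) * indicator {p..q} (s + 1 * r) \<partial>lborel)"
    using nn_integral_real_affine[of _ 1 s, OF orlicz_Phi_measurable[OF b _ u(1) _ c]] u(2) by simp
  also have "\<dots> = (\<integral>\<^sup>+ r \<in> {p - s..q - s}. ennreal (orlicz_Phi b (u (r + s) / c)) \<partial>lborel)"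
    by (intro nn_integral_cong) (auto simp: indicator_def add.commute)
  finally show ?thesis
    using g u by (auto simp: gauge_le_def intro!: continuous_on_compose2[OF u(1)] continuous_intros)
qed

lemma gauge_le_const:
  assumes b: "0 < b" and T: "0 < T"
  obtains K where "0 < K"
    "\<And>D u v. D \<in> sets borel \<Longrightarrow> D \<subseteq> {0..T} \<Longrightarrow> 0 < v \<Longrightarrow> continuous_on D u \<Longrightarrow>
      (\<And>r. r \<in> D \<Longrightarrow> 0 \<le> u r \<and> u r \<le> v) \<Longrightarrow> gauge_le b D u (K * v)"
proof (rule that[of "1 + T * orlicz_Phi b 1"])
  \<comment> \<open>With u <= v the integral of Phi (u / v) over \<open>D\<close> is at most T * Phi
    1, uniformly in \<open>D\<close>; adding 1 ensures 1 <= \<open>M\<close>.\<close>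
  define M where "M = 1 + T * orlicz_Phi b 1"
  have M: "1 \<le> M" using T orlicz_Phi_nonneg[OF b, of 1] by (simp add: M_def)
  then show "0 < 1 + T * orlicz_Phi b 1" by (simp add: M_def)
  fix D u and v :: real
  assume D: "D \<in> sets borel" "D \<subseteq> {0..T}" and v: "0 < v" and u: "continuous_on D u"
    "\<And>r. r \<in> D \<Longrightarrow> 0 \<le> u r \<and> u r \<le> v"
  have "(\<integral>\<^sup>+ r \<in> D. ennreal (orlicz_Phi b (u r / v)) \<partial>lborel) \<le> (\<integral>\<^sup>+ r \<in> {0..T}. ennreal (orlicz_Phi b 1) \<partial>lborel)"
  proof (intro nn_integral_mono)
    fix r show "ennreal (orlicz_Phi b (u r / v)) * indicator D r \<le> ennreal (orlicz_Phi b 1) * indicator {0..T} r"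
    proof (cases "r \<in> D")
      case True
      then have "orlicz_Phi b (u r / v) \<le> orlicz_Phi b 1"
        using u(2)[OF True] v by (intro orlicz_Phi_mono[OF b]) auto
      then have "ennreal (orlicz_Phi b (u r / v)) \<le> ennreal (orlicz_Phi b 1)" by (rule ennreal_leI)
      moreover have "r \<in> {0..T}" using True D by auto
      ultimately show ?thesis using True by simp
    qed simp
  qed
  also have "\<dots> = ennreal (orlicz_Phi b 1) * ennreal T"
    using T by (simp add: nn_integral_cmult)
  also have "\<dots> = ennreal (T * orlicz_Phi b 1)"
    using T orlicz_Phi_nonneg[OF b, of 1] by (simp add: ennreal_mult mult.commute)
  also have "\<dots> \<le> ennreal M" by (intro ennreal_leI) (simp add: M_def)
  finally show "gauge_le b D u ((1 + T * orlicz_Phi b 1) * v)"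
    using u v M D by (fold M_def) (intro gauge_leI[OF b], auto)
qed

text \<open>Hoelder's inequality for gauges. In the constant 2 + C T, the 2 stands for the two
  integrals bounded by one, and C T for the additive constant of \<open>orlicz_Phi_mult_le\<close>
  integrated over [0,T]; so it does not depend on \<open>D\<close>.\<close>

lemma gauge_le_mult:
  fixes a b c T :: real
  assumes ab: "0 < a" "0 < b" "1 / c = 1 / a + 1 / b" and T: "0 < T"
  obtains K where "0 < K"
    "\<And>D u v k l. D \<in> sets borel \<Longrightarrow> D \<subseteq> {0..T} \<Longrightarrow> gauge_le a D u k \<Longrightarrow> gauge_le b D v l \<Longrightarrow>
       gauge_le c D (\<lambda>r. u r * v r) (K * (k * l))"
proof -
  have "0 < 1 / a + 1 / b" using ab(1,2) by (intro add_pos_pos) simp_all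
  then have c: "0 < c" using ab(3) by (metis zero_less_divide_1_iff)
  obtain C where C: "0 < C"
    "\<And>x y. 0 \<le> x \<Longrightarrow> 0 \<le> y \<Longrightarrow> orlicz_Phi c (x * y) \<le> orlicz_Phi a x + orlicz_Phi b y + C"
    using orlicz_Phi_mult_le[OF ab] by metis
  show ?thesis
  proof (rule that[of "2 + C * T"])
    show "0 < 2 + C * T" using C T by (simp add: add_pos_pos)
    fix D u v k l
    assume D: "D \<in> sets borel" "D \<subseteq> {0..T}" and g: "gauge_le a D u k" "gauge_le b D v l"
    have kl: "0 < k" "0 < l" and u: "continuous_on D u" "\<And>r. r \<in> D \<Longrightarrow> 0 \<le> u r"
      and v: "continuous_on D v" "\<And>r. r \<in> D \<Longrightarrow> 0 \<le> v r"
      using g by (auto simp: gauge_le_def)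
    have "(\<integral>\<^sup>+ r \<in> D. ennreal (orlicz_Phi c ((u r * v r) / (k * l))) \<partial>lborel) \<le>
        (\<integral>\<^sup>+ r. (ennreal (orlicz_Phi a (u r / k)) * indicator D r +
           ennreal (orlicz_Phi b (v r / l)) * indicator D r) + ennreal C * indicator {0..T} r \<partial>lborel)"
    proof (intro nn_integral_mono)
      fix r
      show "ennreal (orlicz_Phi c ((u r * v r) / (k * l))) * indicator D r \<le>
        (ennreal (orlicz_Phi a (u r / k)) * indicator D r +
           ennreal (orlicz_Phi b (v r / l)) * indicator D r) + ennreal C * indicator {0..T} r"
      proof (cases "r \<in> D")
        case True
        note uv = u(2)[OF True] v(2)[OF True]
        have "orlicz_Phi c ((u r / k) * (v r / l)) \<le> orlicz_Phi a (u r / k) + orlicz_Phi b (v r / l) + C"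
          using uv kl by (intro C(2)) auto
        then have "ennreal (orlicz_Phi c ((u r * v r) / (k * l))) \<le>
            ennreal (orlicz_Phi a (u r / k) + orlicz_Phi b (v r / l) + C)"
          by (intro ennreal_leI) simp
        also have "\<dots> = ennreal (orlicz_Phi a (u r / k)) + ennreal (orlicz_Phi b (v r / l)) + ennreal C"
          using uv kl ab C by (simp add: ennreal_plus orlicz_Phi_nonneg)
        finally show ?thesis using True D by auto
      qed simp
    qed
    also have "\<dots> = (\<integral>\<^sup>+ r \<in> D. ennreal (orlicz_Phi a (u r / k)) \<partial>lborel) +
        (\<integral>\<^sup>+ r \<in> D. ennreal (orlicz_Phi b (v r / l)) \<partial>lborel) + ennreal C * ennreal T"
      using orlicz_Phi_measurable[OF ab(1) D(1) u(1) _ kl(1)] orlicz_Phi_measurable[OF ab(2) D(1) v(1) _ kl(2)] u(2) v(2) T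
      by (simp add: nn_integral_add nn_integral_cmult)
    also have "\<dots> \<le> 1 + 1 + ennreal C * ennreal T"
      using g by (intro add_mono) (auto simp: gauge_le_def)
    also have "\<dots> = ennreal (2 + C * T)"
      using C T by (simp add: ennreal_mult ennreal_plus flip: ennreal_numeral)
    finally show "gauge_le c D (\<lambda>r. u r * v r) ((2 + C * T) * (k * l))"
      using kl u v C T D by (intro gauge_leI[OF c]) (auto intro!: continuous_intros)
  qed
qed

section \<open>Gauges and the Orlicz norm\<close>

lemma orlicz_norm_le_gauge:
  assumes "gauge_le b D (\<lambda>r. norm (g r)) c" shows "orlicz_norm b D g \<le> ennreal c"
  unfolding orlicz_norm_def by (rule Inf_lower) (use assms in \<open>auto simp: gauge_le_def\<close>)

text \<open>Strict inequality provides an admissible constant below \<open>c\<close>, whether or not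
  the infimum is attained.\<close>

lemma gauge_le_orlicz_norm:
  assumes b: "0 < b" and g: "continuous_on D g" and lt: "orlicz_norm b D g < ennreal c"
  shows "gauge_le b D (\<lambda>r. norm (g r)) c"
proof -
  obtain d where d: "d > 0" "ennreal d < ennreal c"
    "(\<integral>\<^sup>+ r \<in> D. ennreal (orlicz_Phi b (norm (g r) / d)) \<partial>lborel) \<le> 1"
    using lt unfolding orlicz_norm_def Inf_less_iff by auto
  have "gauge_le b D (\<lambda>r. norm (g r)) d"
    using d g by (auto simp: gauge_le_def intro!: continuous_intros)
  then show ?thesis
    by (rule gauge_le_mono[OF b]) (use d g in \<open>auto simp: ennreal_less_iff intro!: continuous_intros\<close>)
qed

text \<open>The average of \<open>u\<close> over an interval of length \<open>h\<close> loses an arbitrarily small power of \<open>h\<close>: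
  pointwise, \<open>x \<le> h\<^sup>-\<^sup>\<epsilon> + h x\<^sup>p\<close> with \<open>\<epsilon> (p - 1) = 1\<close>.\<close>

lemma gauge_le_average:
  assumes b: "0 < b" and T: "0 < T" and e: "0 < e"
  obtains K where "0 < K"
    "\<And>D u c s h. gauge_le b D u c \<Longrightarrow> 0 < h \<Longrightarrow> h \<le> T \<Longrightarrow> {s..s + h} \<subseteq> D \<Longrightarrow>
      integral {s..s + h} u \<le> K * c * h * h powr (- e)"
proof -
  obtain n :: nat where n: "1 / e \<le> real n" using real_arch_simple by blast
  have n0: "0 < n" using n e by (cases n) (auto simp: field_simps)
  obtain C where C: "0 < C" "\<And>x. 0 \<le> x \<Longrightarrow> x ^ Suc n \<le> C * (orlicz_Phi b x + 1)"
    using power_le_orlicz_Phi[OF b, of "Suc n"] by metis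
  \<comment> \<open>The power in the pointwise inequality is the integer \<open>Suc n\<close>, so
    the loss is first exactly 1 / n, which is at most \<open>e\<close>, and is relaxed to
    \<open>e\<close> at the end.\<close>
  define e' where "e' = 1 / real n"
  have e': "0 < e'" "e' \<le> e" using n0 n e by (auto simp: e'_def field_simps)
  define M where "M = 1 + C * (1 + T)"
  have M: "0 < M" using C T by (simp add: M_def add_pos_pos)
  \<comment> \<open>The two powers of \<open>T\<close> convert h^(-e') and 1 into multiples of
    h^(-e) for h <= T.\<close>
  define K where "K = M * (T powr (e - e') + T powr e)"
  show ?thesis
  proof (rule that[of K])
    show "0 < K" using M T by (simp add: K_def add_pos_pos)
    fix D u c s h
    assume g: "gauge_le b D u c" and h: "0 < h" "h \<le> T" and D: "{s..s + h} \<subseteq> D"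
    have g': "gauge_le b {s..s + h} u c"
      by (rule gauge_le_mono[OF b g D]) (use g D in \<open>auto simp: gauge_le_def intro: continuous_on_subset\<close>)
    have c: "0 < c" and u: "continuous_on {s..s + h} u" "\<And>r. r \<in> {s..s + h} \<Longrightarrow> 0 \<le> u r"
      using g' by (auto simp: gauge_le_def)
    define F where "F r = orlicz_Phi b (u r / c)" for r
    have F: "continuous_on {s..s + h} F" "\<And>r. r \<in> {s..s + h} \<Longrightarrow> 0 \<le> F r"
      unfolding F_def using u c orlicz_Phi_nonneg[OF b]
      by (auto intro!: continuous_on_compose2[OF orlicz_Phi_continuous[OF b]] continuous_intros)
    have iF: "integral {s..s + h} F \<le> 1"
    proof -
      have "((\<lambda>r. F r) has_integral integral {s..s + h} F) {s..s + h}"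
        using F(1) by (intro integrable_integral integrable_continuous_real)
      from nn_integral_has_integral_lebesgue[OF _ this] F(2)
      have "(\<integral>\<^sup>+ r. indicator {s..s + h} r * F r \<partial>lborel) = ennreal (integral {s..s + h} F)" by simp
      moreover have "(\<integral>\<^sup>+ r. indicator {s..s + h} r * F r \<partial>lborel) = (\<integral>\<^sup>+ r \<in> {s..s+h}. ennreal (F r) \<partial>lborel)"
        by (intro nn_integral_cong) (auto simp: indicator_def)
      ultimately have "ennreal (integral {s..s + h} F) \<le> 1" using g' by (simp add: gauge_le_def F_def)
      then show ?thesis by simp
    qed
    have pt: "u r \<le> c * (h powr (- e') + h * (C * (F r + 1)))" if r: "r \<in> {s..s + h}" for r
    proof -
      define x where "x = u r / c"
      have x: "0 \<le> x" using u(2)[OF r] c by (simp add: x_def)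
      have "x \<le> h powr (- e') + h * x ^ Suc n"
      proof (cases "x \<le> h powr (- e')")
        case True then show ?thesis using x h by (simp add: add_increasing2)
      next
        case False
        have "1 / h = h powr (- e' * real n)" using h n0 by (simp add: e'_def powr_minus_divide)
        also have "\<dots> = (h powr (- e')) ^ n" using h by (simp add: powr_powr flip: powr_realpow)
        also have "\<dots> \<le> x ^ n" using False by (intro power_mono) auto
        finally have "1 \<le> h * x ^ n" using h by (simp add: field_simps)
        then have "x * 1 \<le> x * (h * x ^ n)" using x by (intro mult_left_mono)
        then show ?thesis using h by (simp add: algebra_simps) (smt (verit) powr_ge_zero)
      qed
      also have "\<dots> \<le> h powr (- e') + h * (C * (F r + 1))"
        using mult_left_mono[OF C(2)[OF x], of h] h unfolding F_def x_def by simp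
      finally show ?thesis using c by (simp add: x_def field_simps)
    qed
    have "integral {s..s + h} u \<le> integral {s..s + h} (\<lambda>r. c * (h powr (- e') + h * (C * (F r + 1))))"
      by (intro integral_le integrable_continuous_real continuous_intros u F pt)
    also have "\<dots> = c * (h * h powr (- e') + h * (C * (integral {s..s + h} F + h)))"
      using F(1) h by (simp add: integral_add integrable_continuous_real continuous_intros integral_mult_right algebra_simps)
    also have "\<dots> \<le> c * (h * h powr (- e') + h * (C * (1 + T)))"
      using iF h c C by (intro mult_left_mono add_left_mono) auto
    also have "\<dots> = c * h * (h powr (- e') + C * (1 + T))" by (simp add: algebra_simps)
    also have "\<dots> \<le> c * h * (M * (h powr (- e') + 1))"
      using c h C T by (intro mult_left_mono) (auto simp: M_def algebra_simps add_increasing)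
    also have "\<dots> \<le> c * h * (K * h powr (- e))"
    proof -
      have "h powr (- e') = h powr (e - e') * h powr (- e)" using h by (simp flip: powr_add)
      moreover have "h powr (e - e') \<le> T powr (e - e')" using h e' by (intro powr_mono2) auto
      moreover have "1 = h powr e * h powr (- e)" using h by (simp flip: powr_add)
      moreover have "h powr e \<le> T powr e" using h e by (intro powr_mono2) auto
      ultimately have "h powr (- e') + 1 \<le> (T powr (e - e') + T powr e) * h powr (- e)"
        by (metis (no_types, lifting) add_mono distrib_right mult_right_mono powr_ge_zero)
      then have "M * (h powr (- e') + 1) \<le> K * h powr (- e)"
        using M by (simp add: K_def mult.assoc)
      then show ?thesis using c h by (intro mult_left_mono) auto
    qed
    finally show "integral {s..s + h} u \<le> K * c * h * h powr (- e)" by (simp add: algebra_simps)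
  qed
qed

section \<open>Dyadic sequences in \<open>l\<^sup>q\<^sup>/\<^sup>k\<close>\<close>

text \<open>Membership in l^(q/k), expressed by the powers themselves: for exponents below one there
  is no norm to work with. The upper bound in the case \<open>q = \<infinity>\<close> suffices
  because all sequences considered are nonnegative.\<close>

definition lq_seq :: "ennreal \<Rightarrow> real \<Rightarrow> (nat \<Rightarrow> real) \<Rightarrow> bool" where
  "lq_seq q k w \<longleftrightarrow>
     (if q = \<infinity> then \<exists>C. \<forall>j. w j \<le> C else summable (\<lambda>j. w j powr (enn2real q / k)))"

lemma enn2real_pos: "0 < q \<Longrightarrow> q \<noteq> \<infinity> \<Longrightarrow> 0 < enn2real q"
  by (metis enn2real_positive_iff infinity_ennreal_def less_top)

lemma lq_seq_le:
  assumes q: "0 < q" and k: "0 < k" and w: "lq_seq q k w" and v: "\<And>j. 0 \<le> v j" "\<And>j. v j \<le> w j"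
  shows "lq_seq q k v"
proof (cases "q = \<infinity>")
  case True
  then show ?thesis using w v(2) by (auto simp: lq_seq_def) (meson order_trans)
next
  case False
  have "summable (\<lambda>j. v j powr (enn2real q / k))"
    by (rule summable_comparison_test'[where N = 0 and g = "\<lambda>j. w j powr (enn2real q / k)"])
       (use w v enn2real_pos[OF q False] k False in \<open>auto simp: lq_seq_def intro!: powr_mono2\<close>)
  then show ?thesis using False by (simp add: lq_seq_def)
qed

lemma lq_seq_bounded:
  assumes q: "0 < q" and k: "0 < k" and w: "lq_seq q k w" "\<And>j. 0 \<le> w j"
  obtains C where "0 < C" "\<And>j. w j \<le> C"
proof (cases "q = \<infinity>")
  case True
  then obtain C where "\<And>j. w j \<le> C" using w by (auto simp: lq_seq_def)
  then show ?thesis using that[of "max C 1"] by (metis less_max_iff_disj max.coboundedI1 zero_less_one)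
next
  case False
  define p where "p = enn2real q / k"
  have p: "0 < p" using enn2real_pos[OF q False] k by (simp add: p_def)
  have "summable (\<lambda>j. w j powr p)" using w False by (simp add: lq_seq_def p_def)
  then have "(\<lambda>j. w j powr p) \<longlonglongrightarrow> 0" by (rule summable_LIMSEQ_zero)
  then have "Bseq (\<lambda>j. w j powr p)" by (intro convergent_imp_Bseq convergentI)
  then obtain B where B: "0 < B" "\<And>j. w j powr p \<le> B" by (auto elim!: BseqE)
  show ?thesis
  proof (rule that[of "B powr (1 / p)"])
    fix j
    have "w j = (w j powr p) powr (1 / p)" using w(2)[of j] p by (simp add: powr_powr)
    also have "\<dots> \<le> B powr (1 / p)" using B p by (intro powr_mono2) auto
    finally show "w j \<le> B powr (1 / p)" .
  qed (use B in simp)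
qed

lemma lq_seq_scale:
  assumes "lq_seq q k w" "\<And>j. 0 \<le> w j" "0 \<le> c" shows "lq_seq q k (\<lambda>j. c * w j)"
proof (cases "q = \<infinity>")
  case True
  then obtain C where "\<And>j. w j \<le> C" using assms by (auto simp: lq_seq_def)
  then show ?thesis using True assms(3) by (auto simp: lq_seq_def intro!: exI[of _ "c * C"] mult_left_mono)
next
  case False
  then show ?thesis using assms by (auto simp: lq_seq_def powr_mult intro: summable_mult)
qed

text \<open>The sum is at most twice the maximum, and a power of the maximum is at most the sum of
  the powers for every positive exponent. This avoids a case distinction at exponent one.\<close>

lemma lq_seq_add:
  assumes q: "0 < q" and k: "0 < k"
    and w: "lq_seq q k w" "\<And>j. 0 \<le> w j" and v: "lq_seq q k v" "\<And>j. 0 \<le> v j"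
  shows "lq_seq q k (\<lambda>j. w j + v j)"
proof -
  have m: "lq_seq q k (\<lambda>j. max (w j) (v j))"
  proof (cases "q = \<infinity>")
    case True
    then obtain C D where "\<And>j. w j \<le> C" "\<And>j. v j \<le> D" using w v by (auto simp: lq_seq_def)
    then have "\<And>j. max (w j) (v j) \<le> max C D" by (meson max.mono)
    then show ?thesis using True by (auto simp: lq_seq_def intro: exI[of _ "max C D"])
  next
    case False
    let ?p = "enn2real q / k"
    have "summable (\<lambda>j. w j powr ?p + v j powr ?p)"
      using w v False by (intro summable_add) (auto simp: lq_seq_def)
    then have "summable (\<lambda>j. max (w j) (v j) powr ?p)"
      by (rule summable_comparison_test'[where N = 0]) (auto simp: max_def)
    then show ?thesis using False by (simp add: lq_seq_def)
  qed
  have "lq_seq q k (\<lambda>j. 2 * max (w j) (v j))"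
    using w v by (intro lq_seq_scale m) (auto simp: le_max_iff_disj)
  then show ?thesis by (rule lq_seq_le[OF q k]) (use w v in \<open>auto simp: max_def\<close>)
qed

text \<open>The left side is a geometric mean of x^(p/a) and y^(p/b) with weights a / (a + b) and b
  / (a + b), hence bounded by the larger one. This is Hoelder's inequality term by term.\<close>

lemma powr_mult_le_max:
  fixes x y p a b :: real
  assumes "0 \<le> x" "0 \<le> y" "0 < p" "0 < a" "0 < b"
  shows "(x * y) powr (p / (a + b)) \<le> x powr (p / a) + y powr (p / b)"
proof -
  have wlog: "(x * y) powr (p / (a + b)) \<le> x powr (p / a)"
    if "0 \<le> x" "0 \<le> y" "0 < a" "0 < b" "y powr (p / b) \<le> x powr (p / a)" for x y a b :: real
  proof -
    have "y = (y powr (p / b)) powr (b / p)" using that assms by (simp add: powr_powr)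
    also have "\<dots> \<le> (x powr (p / a)) powr (b / p)" using that assms by (intro powr_mono2) auto
    finally have y: "y \<le> x powr (b / a)" using assms by (simp add: powr_powr)
    have "(x * y) powr (p / (a + b)) \<le> (x * x powr (b / a)) powr (p / (a + b))"
      using that assms y by (intro powr_mono2 mult_left_mono) auto
    also have "x * x powr (b / a) = x powr (1 + b / a)" using that by (cases "x = 0") (auto simp: powr_add)
    also have "\<dots> powr (p / (a + b)) = x powr (p / a)"
    proof -
      have "(1 + b / a) * (p / (a + b)) = p / a" using that by (simp add: divide_simps)
      then show ?thesis by (simp add: powr_powr)
    qed
    finally show ?thesis .
  qed
  show ?thesis
  proof (cases "y powr (p / b) \<le> x powr (p / a)")
    case True then show ?thesis using wlog[of x y a b] assms by (smt (verit) powr_ge_zero)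
  next
    case False
    then have "(y * x) powr (p / (b + a)) \<le> y powr (p / b)" using assms by (intro wlog) auto
    then show ?thesis by (simp add: mult.commute add.commute add_increasing)
  qed
qed

lemma lq_seq_mult:
  assumes q: "0 < q" and k: "0 < a" "0 < b"
    and w: "lq_seq q a w" "\<And>j. 0 \<le> w j" and v: "lq_seq q b v" "\<And>j. 0 \<le> v j"
  shows "lq_seq q (a + b) (\<lambda>j. w j * v j)"
proof (cases "q = \<infinity>")
  case True
  then obtain C D where "\<And>j. w j \<le> C" "\<And>j. v j \<le> D" using w v by (auto simp: lq_seq_def)
  then have "\<And>j. w j * v j \<le> C * D" using w(2) v(2) by (meson mult_mono order_trans)
  then show ?thesis using True by (auto simp: lq_seq_def)
next
  case False
  have "summable (\<lambda>j. w j powr (enn2real q / a) + v j powr (enn2real q / b))"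
    using w v False by (intro summable_add) (auto simp: lq_seq_def)
  then have "summable (\<lambda>j. (w j * v j) powr (enn2real q / (a + b)))"
    by (rule summable_comparison_test'[where N = 0])
       (use powr_mult_le_max[OF w(2) v(2) enn2real_pos[OF q False] k] in auto)
  then show ?thesis using False by (simp add: lq_seq_def)
qed

lemma lq_seq_geometric:
  assumes q: "0 < q" and k: "0 < k" and c: "0 \<le> c" "c < 1"
  shows "lq_seq q k (\<lambda>j. c ^ j)"
proof (cases "q = \<infinity>")
  case True
  then show ?thesis using c by (auto simp: lq_seq_def intro!: exI[of _ 1] power_le_one)
next
  case False
  let ?p = "enn2real q / k"
  have p: "0 < ?p" using enn2real_pos[OF q False] k by simp
  have "c powr ?p < 1" using c p powr01_less_one[of c ?p] by (cases "c = 0") auto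
  then have "summable (\<lambda>j. (c powr ?p) ^ j)" by (intro summable_geometric) auto
  moreover have "(c ^ j) powr ?p = (c powr ?p) ^ j" for j
    using c by (induction j) (auto simp: powr_mult)
  ultimately show ?thesis using False by (simp add: lq_seq_def)
qed

text \<open>For \<open>s\<^sup>2 = c\<close>, either \<open>w + c g \<le> s g\<close> or \<open>w + c g \<le> w / (1 - s)\<close>, which lets the
  recursion pass to powers with an exponent possibly below one.\<close>

lemma lq_seq_recursion:
  assumes q: "0 < q" and k: "0 < k" and w: "lq_seq q k w" "\<And>j. 0 \<le> w j"
    and g: "\<And>j. 0 \<le> g j" "\<And>j. g j \<le> B" and c: "0 < c" "c < 1"
    and rec: "\<And>j. g j \<le> w j + c * g (Suc j)"
  shows "lq_seq q k g"
proof (cases "q = \<infinity>")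
  case True then show ?thesis using g by (auto simp: lq_seq_def)
next
  case False
  define p where "p = enn2real q / k"
  have p: "0 < p" using enn2real_pos[OF q False] k by (simp add: p_def)
  define s where "s = sqrt c"
  have s: "0 < s" "s < 1" "s * s = c" using c by (auto simp: s_def real_sqrt_lt_1_iff)
  define t where "t = s powr p"
  have t: "0 < t" "t < 1" using s p by (auto simp: t_def powr01_less_one)
  define D where "D = (1 / (1 - s)) powr p"
  have sw: "summable (\<lambda>j. w j powr p)" using w False by (simp add: lq_seq_def p_def)
  define W where "W = (\<Sum>j. w j powr p)"
  have step: "g j powr p \<le> t * g (Suc j) powr p + D * w j powr p" for j
  proof -
    have "g j \<le> s * g (Suc j) \<or> g j \<le> 1 / (1 - s) * w j"
    proof (cases "w j \<le> (1 - s) * s * g (Suc j)")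
      case True
      then have "w j + c * g (Suc j) \<le> (1 - s) * s * g (Suc j) + s * s * g (Suc j)" using s by simp
      also have "\<dots> = s * g (Suc j)" by (simp add: algebra_simps)
      finally show ?thesis using rec[of j] by simp
    next
      case False
      then have "s * g (Suc j) \<le> w j / (1 - s)" using s(1,2) by (simp add: field_simps)
      then have "s * (s * g (Suc j)) \<le> s * (w j / (1 - s))" using s by (intro mult_left_mono) auto
      moreover have "c * g (Suc j) = s * (s * g (Suc j))" using s(3) by (simp flip: mult.assoc)
      ultimately have "w j + c * g (Suc j) \<le> w j + s * (w j / (1 - s))" by linarith
      also have "\<dots> = 1 / (1 - s) * w j" using s by (simp add: field_simps)
      finally show ?thesis using rec[of j] by simp
    qed
    then have "g j powr p \<le> (s * g (Suc j)) powr p \<or> g j powr p \<le> (1 / (1 - s) * w j) powr p"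
      using p g(1)[of j] by (metis powr_mono2 less_imp_le)
    moreover have "(s * g (Suc j)) powr p = t * g (Suc j) powr p"
      using s g by (simp add: powr_mult t_def)
    moreover have "(1 / (1 - s) * w j) powr p = D * w j powr p"
      using s w(2)[of j] unfolding D_def by (intro powr_mult)
    moreover have "0 \<le> t * g (Suc j) powr p" "0 \<le> D * w j powr p" using t by (auto simp: D_def)
    ultimately show ?thesis by linarith
  qed
  have "summable (\<lambda>j. g j powr p)"
  proof (rule bounded_imp_summable)
    fix n
    let ?S = "\<Sum>j\<le>n. g j powr p"
    have "?S \<le> (\<Sum>j\<le>n. t * g (Suc j) powr p + D * w j powr p)" by (intro sum_mono step)
    also have "\<dots> = t * (\<Sum>j\<le>n. g (Suc j) powr p) + D * (\<Sum>j\<le>n. w j powr p)"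
      by (simp add: sum.distrib sum_distrib_left)
    \<comment> \<open>The shifted sum exceeds \<open>?S\<close> at most by its new last term, which
      the a priori bound \<open>B\<close> controls. As t < 1, the sum is then absorbed on the left,
      uniformly in \<open>n\<close>.\<close>
    also have "(\<Sum>j\<le>n. g (Suc j) powr p) \<le> ?S + g (Suc n) powr p"
      using sum.atMost_Suc_shift[of "\<lambda>j. g j powr p" n] sum.atMost_Suc[of "\<lambda>j. g j powr p" n] by simp
    also have "g (Suc n) powr p \<le> B powr p" using g p by (intro powr_mono2) auto
    also have "(\<Sum>j\<le>n. w j powr p) \<le> W" unfolding W_def by (intro sum_le_suminf sw) auto
    finally have "?S \<le> t * (?S + B powr p) + D * W" using t by (auto simp: D_def mult_left_mono)
    then have "(1 - t) * ?S \<le> t * B powr p + D * W" by (simp add: algebra_simps)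
    then show "?S \<le> (t * B powr p + D * W) / (1 - t)" using t by (simp add: field_simps)
  qed auto
  then show ?thesis using False by (simp add: lq_seq_def p_def)
qed

section \<open>The weighted Lebesgue norm of a monotone function\<close>

lemma dyadic_interval_ex:
  assumes "0 < t" "t \<le> (T::real)"
  obtains j where "T / 2 ^ Suc j < t" "t \<le> T / 2 ^ j"
proof -
  obtain n :: nat where n: "T / t < 2 ^ n" using real_arch_pow[of 2] by auto
  then have ex: "\<exists>n. T / 2 ^ n < t" using assms by (intro exI[of _ n]) (simp add: field_simps)
  define m where "m = (LEAST n. T / 2 ^ n < t)"
  have m: "T / 2 ^ m < t" unfolding m_def using ex by (rule LeastI_ex)
  then have "m \<noteq> 0" using assms by (intro notI) auto
  then obtain j where j: "m = Suc j" by (cases m) auto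
  have "\<not> T / 2 ^ j < t" using not_less_Least[of j "\<lambda>n. T / 2 ^ n < t"] j by (simp add: m_def)
  then show ?thesis using that[of j] m j by simp
qed

lemma dyadic_bounds: "0 < T \<Longrightarrow> 0 < T / 2 ^ j" "0 < T \<Longrightarrow> T / 2 ^ j \<le> (T::real)"
  by (auto simp: field_simps)

lemma dtau_space [simp]: "space (dtau_over_tau T) = {0..T}"
  by (simp add: dtau_over_tau_def space_restrict_space)

lemma dtau_sets: "sets (dtau_over_tau T) = sets (restrict_space borel {0..T})"
  by (simp add: dtau_over_tau_def sets_restrict_space)

lemma dtau_measurable: "f \<in> borel_measurable borel \<Longrightarrow> f \<in> borel_measurable (dtau_over_tau T)"
  by (subst measurable_cong_sets[OF dtau_sets refl]) (rule measurable_restrict_space1)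

lemma dtau_dyadic_sets: "0 < T \<Longrightarrow> {T / 2 ^ Suc j<..T / 2 ^ j} \<in> sets (dtau_over_tau T)"
  unfolding dtau_sets
proof (subst sets_restrict_space_iff)
  assume T: "0 < T"
  have "x \<in> {0..T}" if "x \<in> {T / 2 ^ Suc j<..T / 2 ^ j}" for x
    using dyadic_bounds[OF T, of j] dyadic_bounds[OF T, of "Suc j"] that by auto
  then show "{T / 2 ^ Suc j<..T / 2 ^ j} \<subseteq> {0..T} \<and> {T / 2 ^ Suc j<..T / 2 ^ j} \<in> sets borel"
    by auto
qed simp

text \<open>The mass is ln 2 for every j. Bounding 1 / t by its endpoint values gives bounds that
  are good enough.\<close>

lemma dtau_dyadic_emeasure:
  assumes T: "0 < T"
  shows "1 / 2 \<le> emeasure (dtau_over_tau T) {T / 2 ^ Suc j<..T / 2 ^ j}"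
    "emeasure (dtau_over_tau T) {T / 2 ^ Suc j<..T / 2 ^ j} \<le> 1"
proof -
  define a where "a = T / 2 ^ Suc j"
  have a: "0 < a" "T / 2 ^ j = 2 * a" using T by (auto simp: a_def)
  have aT: "2 * a \<le> T" using dyadic_bounds(2)[OF T, of j] a by simp
  have "emeasure (dtau_over_tau T) {a<..2 * a} =
      (\<integral>\<^sup>+ t. ennreal (1 / t) * indicator {a<..2 * a} t \<partial>restrict_space lborel {0..T})"
    unfolding dtau_over_tau_def
  proof (rule emeasure_density)
    show "(\<lambda>t. ennreal (1 / t)) \<in> borel_measurable (restrict_space lborel {0..T})"
      by (rule measurable_restrict_space1) measurable
    show "{a<..2 * a} \<in> sets (restrict_space lborel {0..T})"
      using a aT by (subst sets_restrict_space_iff) auto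
  qed
  also have "\<dots> = (\<integral>\<^sup>+ t. ennreal (1 / t) * indicator {a<..2 * a} t * indicator {0..T} t \<partial>lborel)"
    by (subst nn_integral_restrict_space) auto
  also have "\<dots> = (\<integral>\<^sup>+ t. ennreal (1 / t) * indicator {a<..2 * a} t \<partial>lborel)"
    using a aT by (intro nn_integral_cong) (auto simp: indicator_def)
  finally have e: "emeasure (dtau_over_tau T) {a<..2 * a} = \<dots>" .
  have "(\<integral>\<^sup>+ t. ennreal (1 / t) * indicator {a<..2 * a} t \<partial>lborel) \<le>
      (\<integral>\<^sup>+ t. ennreal (1 / a) * indicator {a<..2 * a} t \<partial>lborel)"
  proof (intro nn_integral_mono)
    fix t show "ennreal (1 / t) * indicator {a<..2 * a} t \<le> ennreal (1 / a) * indicator {a<..2 * a} t"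
      using a by (cases "t \<in> {a<..2 * a}") (auto intro!: ennreal_leI divide_left_mono)
  qed
  also have "\<dots> = ennreal (1 / a) * ennreal a"
    using a by (simp add: nn_integral_cmult)
  also have "\<dots> = 1" using a by (simp flip: ennreal_mult)
  finally show "emeasure (dtau_over_tau T) {T / 2 ^ Suc j<..T / 2 ^ j} \<le> 1"
    using e unfolding a(2) a_def[symmetric] by simp
  have "1 / 2 = ennreal (1 / 2)" using divide_ennreal[of 1 2] by simp
  also have "\<dots> = ennreal (1 / (2 * a)) * ennreal a"
    using a by (simp add: ennreal_mult'[symmetric])
  also have "\<dots> = (\<integral>\<^sup>+ t. ennreal (1 / (2 * a)) * indicator {a<..2 * a} t \<partial>lborel)"
    using a by (simp add: nn_integral_cmult)
  also have "\<dots> \<le> (\<integral>\<^sup>+ t. ennreal (1 / t) * indicator {a<..2 * a} t \<partial>lborel)"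
  proof (intro nn_integral_mono)
    fix t show "ennreal (1 / (2 * a)) * indicator {a<..2 * a} t \<le> ennreal (1 / t) * indicator {a<..2 * a} t"
      using a by (cases "t \<in> {a<..2 * a}") (auto intro!: ennreal_leI simp: frac_le)
  qed
  finally show "1 / 2 \<le> emeasure (dtau_over_tau T) {T / 2 ^ Suc j<..T / 2 ^ j}"
    using e unfolding a(2) a_def[symmetric] by simp
qed

lemma ennreal_powr_mono: "x \<le> y \<Longrightarrow> 0 < p \<Longrightarrow> ennreal_powr x p \<le> ennreal_powr y p"
  unfolding ennreal_powr_def
  by (auto simp: top_unique less_top intro!: ennreal_leI powr_mono2 enn2real_mono)

lemma ennreal_powr_ennreal [simp]: "0 \<le> x \<Longrightarrow> ennreal_powr (ennreal x) p = ennreal (x powr p)"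
  by (simp add: ennreal_powr_def)

lemma ennreal_powr_less_top_iff [simp]: "ennreal_powr x p < top \<longleftrightarrow> x < top"
  by (auto simp: ennreal_powr_def less_top)

lemma mono_ennreal_borel_measurable:
  fixes S :: "real \<Rightarrow> ennreal"
  assumes "mono S" shows "S \<in> borel_measurable borel"
proof (rule borel_measurableI_greater)
  fix y
  have "is_interval {x. y < S x}"
    using assms by (auto simp: is_interval_1 mono_def intro: less_le_trans)
  then show "{x \<in> space borel. y < S x} \<in> sets borel"
    by (simp add: real_interval_borel_measurable)
qed

text \<open>On a dyadic block the weight varies by a bounded factor, \<open>w\<close> is at most its
  value at the right end, and the block has bounded mass. The norm is thus dominated by an l^(q/k)
  sum. \<open>Q\<close> is tied to \<open>q\<close> by two equations only, so as to cover
  \<open>q\<close>, \<open>q / 2\<close> and \<open>q / 3\<close> alike.\<close>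

lemma Lq_norm_less_topI:
  assumes T: "0 < T" and g: "0 < \<gamma>" and q: "0 < q" and k: "0 < k"
    and Q: "Q = \<infinity> \<longleftrightarrow> q = \<infinity>" "enn2real Q = enn2real q / k"
    and S: "mono S" "\<And>t. 0 < t \<Longrightarrow> t \<le> T \<Longrightarrow> S t \<le> ennreal (w t)"
    and w: "mono_on {0<..T} w" "\<And>t. 0 < t \<Longrightarrow> t \<le> T \<Longrightarrow> 0 \<le> w t"
    and lq: "lq_seq q k (\<lambda>j. (2 ^ j) powr \<gamma> * w (T / 2 ^ j))"
  shows "Lq_norm Q (dtau_over_tau T) (\<lambda>t. ennreal (t powr (- \<gamma>)) * S t) < \<infinity>"
proof -
  define v where "v j = (2 ^ j) powr \<gamma> * w (T / 2 ^ j)" for j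
  \<comment> \<open>T^(-\<gamma>) comes from rescaling to [0,T], and 2^\<gamma> from evaluating the
    weight at the left end of the block.\<close>
  define A where "A = T powr (- \<gamma>) * 2 powr \<gamma>"
  have A: "0 < A" using T by (simp add: A_def)
  have Tj: "0 < T / 2 ^ j" "T / 2 ^ j \<le> T" for j using T by (auto simp: field_simps)
  have v0: "0 \<le> v j" for j using w(2)[OF Tj] by (simp add: v_def)
  have le: "ennreal (t powr (- \<gamma>)) * S t \<le> ennreal (A * v j)"
    if t: "T / 2 ^ Suc j < t" "t \<le> T / 2 ^ j" for t j
  proof -
    have t0: "0 < t" "t \<le> T" using t Tj[of "Suc j"] Tj[of j] by auto
    have "w t \<le> w (T / 2 ^ j)" using t t0 Tj[of j] by (intro mono_onD[OF w(1)]) auto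
    moreover have "t powr (- \<gamma>) \<le> (T / 2 ^ Suc j) powr (- \<gamma>)"
      using t g Tj[of "Suc j"] by (intro powr_mono2') auto
    moreover have "(T / 2 ^ Suc j) powr (- \<gamma>) = A * (2 ^ j) powr \<gamma>"
      using T by (simp add: A_def powr_divide powr_mult powr_minus_divide)
    ultimately have "t powr (- \<gamma>) * w t \<le> A * v j"
      using w(2)[OF t0] A by (simp add: v_def mult.assoc[symmetric] mult_mono)
    moreover have "ennreal (t powr (- \<gamma>)) * S t \<le> ennreal (t powr (- \<gamma>)) * ennreal (w t)"
      by (intro mult_left_mono S(2) t0) auto
    ultimately show ?thesis using w(2)[OF t0] by (simp flip: ennreal_mult) (meson ennreal_leI order_trans)
  qed
  show ?thesis
  proof (cases "q = \<infinity>")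
    case True
    obtain C where C: "\<And>j. v j \<le> C" using lq True by (auto simp: lq_seq_def v_def)
    have "AE t in dtau_over_tau T. ennreal (t powr (- \<gamma>)) * S t \<le> ennreal (A * C)"
    proof (rule AE_I2)
      fix t assume "t \<in> space (dtau_over_tau T)"
      then consider "t = 0" | "0 < t" "t \<le> T" by (auto simp: less_le)
      then show "ennreal (t powr (- \<gamma>)) * S t \<le> ennreal (A * C)"
      proof cases
        case 2
        obtain j where j: "T / 2 ^ Suc j < t" "t \<le> T / 2 ^ j" using dyadic_interval_ex[OF 2] by metis
        have "ennreal (A * v j) \<le> ennreal (A * C)" using C[of j] A by (intro ennreal_leI) simp
        then show ?thesis using le[OF j] by order
      qed simp
    qed
    moreover have "(\<lambda>t. ennreal (t powr (- \<gamma>)) * S t) \<in> borel_measurable (dtau_over_tau T)"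
      using mono_ennreal_borel_measurable[OF S(1)] by (intro dtau_measurable) measurable
    ultimately have "esssup (dtau_over_tau T) (\<lambda>t. ennreal (t powr (- \<gamma>)) * S t) \<le> ennreal (A * C)"
      by (intro esssup_I)
    also have "\<dots> < top" by simp
    finally show ?thesis using True Q by (simp add: Lq_norm_def)
  next
    case False
    define p where "p = enn2real Q"
    have p: "0 < p" "p = enn2real q / k" using enn2real_pos[OF q False] k Q by (auto simp: p_def)
    define I where "I j = {T / 2 ^ Suc j<..T / 2 ^ j}" for j
    have I [measurable]: "I j \<in> sets (dtau_over_tau T)" for j unfolding I_def by (rule dtau_dyadic_sets[OF T])
    have sv: "summable (\<lambda>j. v j powr p)" using lq False p by (simp add: lq_seq_def v_def)
    have "(\<integral>\<^sup>+ t. ennreal_powr (ennreal (t powr (- \<gamma>)) * S t) p \<partial>dtau_over_tau T) \<le>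
        (\<integral>\<^sup>+ t. (\<Sum>j. ennreal (A powr p * v j powr p) * indicator (I j) t) \<partial>dtau_over_tau T)"
    proof (intro nn_integral_mono)
      fix t assume "t \<in> space (dtau_over_tau T)"
      then consider "t = 0" | "0 < t" "t \<le> T" by (auto simp: less_le)
      then show "ennreal_powr (ennreal (t powr (- \<gamma>)) * S t) p \<le> (\<Sum>j. ennreal (A powr p * v j powr p) * indicator (I j) t)"
      proof cases
        case 1
        then show ?thesis using p by (simp add: ennreal_powr_def)
      next
        case 2
        obtain j where j: "T / 2 ^ Suc j < t" "t \<le> T / 2 ^ j" using dyadic_interval_ex[OF 2] by metis
        have "ennreal_powr (ennreal (t powr (- \<gamma>)) * S t) p \<le> ennreal_powr (ennreal (A * v j)) p"
          by (intro ennreal_powr_mono le j p)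
        also have "\<dots> = ennreal (A powr p * v j powr p) * indicator (I j) t"
          using A v0[of j] j by (simp add: powr_mult I_def)
        also have "\<dots> \<le> (\<Sum>j. ennreal (A powr p * v j powr p) * indicator (I j) t)"
          using sum_le_suminf[of "\<lambda>j. ennreal (A powr p * v j powr p) * indicator (I j) t" "{j}"]
          by (simp del: sum_mult_indicator)
        finally show ?thesis .
      qed
    qed
    also have "\<dots> = (\<Sum>j. ennreal (A powr p * v j powr p) * emeasure (dtau_over_tau T) (I j))"
      by (subst nn_integral_suminf) (auto simp: nn_integral_cmult_indicator)
    also have "\<dots> \<le> (\<Sum>j. ennreal (A powr p * v j powr p) * 1)"
      unfolding I_def by (intro suminf_le mult_left_mono dtau_dyadic_emeasure T) auto
    also have "\<dots> < top" using sv by (simp add: ennreal_suminf_neq_top less_top summable_mult)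
    finally show ?thesis using False Q p by (simp add: Lq_norm_def p_def)
  qed
qed

lemma Lq_norm_less_topD:
  assumes T: "0 < T" and g: "0 < \<gamma>" and q: "0 < q" and k: "0 < k"
    and Q: "Q = \<infinity> \<longleftrightarrow> q = \<infinity>" "enn2real Q = enn2real q / k"
    and S: "\<And>t. 0 < t \<Longrightarrow> t \<le> T \<Longrightarrow> S t = ennreal (w t)"
    and w: "mono_on {0<..T} w" "\<And>t. 0 < t \<Longrightarrow> t \<le> T \<Longrightarrow> 0 \<le> w t"
    and fin: "Lq_norm Q (dtau_over_tau T) (\<lambda>t. ennreal (t powr (- \<gamma>)) * S t) < \<infinity>"
  shows "lq_seq q k (\<lambda>j. (2 ^ j) powr \<gamma> * w (T / 2 ^ j))"
proof -
  define v where "v j = (2 ^ j) powr \<gamma> * w (T / 2 ^ j)" for j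
  define A where "A = T powr (- \<gamma>) * 2 powr (- \<gamma>)"
  have A: "0 < A" using T by (simp add: A_def)
  have Tj: "0 < T / 2 ^ j" "T / 2 ^ j \<le> T" for j using T by (auto simp: field_simps)
  have v0: "0 \<le> v j" for j using w(2)[OF Tj] by (simp add: v_def)
  \<comment> \<open>For a lower bound \<open>w\<close> is evaluated at the left end T / 2^(j+1) and
    the weight at the right end; hence the index \<open>Suc j\<close>. The missing term v 0 is added
    afterwards.\<close>
  have le: "ennreal (A * v (Suc j)) \<le> ennreal (t powr (- \<gamma>)) * S t"
    if t: "T / 2 ^ Suc j < t" "t \<le> T / 2 ^ j" for t j
  proof -
    have t0: "0 < t" "t \<le> T" using t Tj[of "Suc j"] Tj[of j] by auto
    have "w (T / 2 ^ Suc j) \<le> w t" using t t0 Tj[of "Suc j"] by (intro mono_onD[OF w(1)]) auto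
    moreover have "(T / 2 ^ j) powr (- \<gamma>) \<le> t powr (- \<gamma>)"
      using t g t0 by (intro powr_mono2') auto
    moreover have "(T / 2 ^ j) powr (- \<gamma>) = A * (2 ^ Suc j) powr \<gamma>"
      using T by (simp add: A_def powr_divide powr_mult powr_minus_divide)
    ultimately have "A * v (Suc j) \<le> t powr (- \<gamma>) * w t"
      using w(2)[OF Tj, of "Suc j"] A unfolding v_def mult.assoc[symmetric]
      by (intro mult_mono) (auto simp: zero_le_mult_iff)
    then show ?thesis using w(2)[OF t0] by (simp add: S[OF t0] ennreal_leI flip: ennreal_mult)
  qed
  define I where "I j = {T / 2 ^ Suc j<..T / 2 ^ j}" for j
  have I [measurable]: "I j \<in> sets (dtau_over_tau T)" for j unfolding I_def by (rule dtau_dyadic_sets[OF T])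
  have half: "1 / 2 \<le> emeasure (dtau_over_tau T) (I j)" for j
    unfolding I_def by (rule dtau_dyadic_emeasure[OF T])
  show ?thesis
  proof (cases "q = \<infinity>")
    case True
    define C where "C = esssup (dtau_over_tau T) (\<lambda>t. ennreal (t powr (- \<gamma>)) * S t)"
    have C: "C < top" using fin True Q by (simp add: Lq_norm_def C_def)
    have "ennreal (A * v (Suc j)) \<le> C" for j
    proof (rule ccontr)
      \<comment> \<open>Otherwise the essential bound would fail on the whole block
        \<open>I j\<close>, whose mass is at least 1/2.\<close>
      assume n: "\<not> ?thesis"
      have "AE t in dtau_over_tau T. ennreal (t powr (- \<gamma>)) * S t \<le> C"
        unfolding C_def by (rule esssup_AE)
      then have "AE t in dtau_over_tau T. t \<notin> I j"
        by (rule AE_mp) (use le[of j] n in \<open>auto intro!: AE_I2 simp: I_def dest: order_trans\<close>)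
      then have "emeasure (dtau_over_tau T) (I j) = 0" using AE_iff_null_sets[OF I] by auto
      then show False using half[of j] by (simp add: divide_eq_0_iff)
    qed
    then have 1: "v (Suc j) \<le> enn2real C / A" for j
      using C A v0[of "Suc j"] enn2real_mono[of "ennreal (A * v (Suc j))" C] by (simp add: field_simps)
    have "v j \<le> max (v 0) (enn2real C / A)" for j using 1 by (cases j) (auto simp: le_max_iff_disj)
    then show ?thesis using True by (auto simp: lq_seq_def v_def)
  next
    case False
    define p where "p = enn2real Q"
    have p: "0 < p" "p = enn2real q / k" using enn2real_pos[OF q False] k Q by (auto simp: p_def)
    have ff: "(\<integral>\<^sup>+ t. ennreal_powr (ennreal (t powr (- \<gamma>)) * S t) p \<partial>dtau_over_tau T) < top"
      using fin False Q by (simp add: Lq_norm_def p_def)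
    have "(\<Sum>j. ennreal ((A * v (Suc j)) powr p) * (1 / 2)) \<le>
        (\<Sum>j. ennreal ((A * v (Suc j)) powr p) * emeasure (dtau_over_tau T) (I j))"
      by (intro suminf_le mult_left_mono half) auto
    also have "\<dots> = (\<integral>\<^sup>+ t. (\<Sum>j. ennreal ((A * v (Suc j)) powr p) * indicator (I j) t) \<partial>dtau_over_tau T)"
      by (subst nn_integral_suminf) (auto simp: nn_integral_cmult_indicator)
    also have "\<dots> \<le> (\<integral>\<^sup>+ t. ennreal_powr (ennreal (t powr (- \<gamma>)) * S t) p \<partial>dtau_over_tau T)"
    proof (intro nn_integral_mono)
      fix t assume "t \<in> space (dtau_over_tau T)"
      then consider "t = 0" | "0 < t" "t \<le> T" by (auto simp: less_le)
      then show "(\<Sum>j. ennreal ((A * v (Suc j)) powr p) * indicator (I j) t) \<le> ennreal_powr (ennreal (t powr (- \<gamma>)) * S t) p"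
      proof cases
        case 1
        then have "indicator (I j) t = (0::ennreal)" for j using Tj[of "Suc j"] by (auto simp: I_def)
        then show ?thesis by simp
      next
        case 2
        obtain j where j: "T / 2 ^ Suc j < t" "t \<le> T / 2 ^ j" using dyadic_interval_ex[OF 2] by metis
        have "indicator (I i) t = (0::ennreal)" if "i \<noteq> j" for i
        proof -
          have "T / 2 ^ i \<le> T / 2 ^ Suc j" if "Suc j \<le> i" for i j
            using that T by (intro divide_left_mono power_increasing) auto
          then have "t \<notin> I i" using j that by (cases i j rule: linorder_cases) (force simp: I_def Suc_le_eq)+
          then show ?thesis by simp
        qed
        then have "(\<Sum>j. ennreal ((A * v (Suc j)) powr p) * indicator (I j) t) =
            ennreal ((A * v (Suc j)) powr p) * indicator (I j) t"
          by (subst suminf_finite[of "{j}"]) (auto simp del: sum_mult_indicator)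
        also have "\<dots> = ennreal_powr (ennreal (A * v (Suc j))) p" using j A v0[of "Suc j"] by (simp add: I_def)
        also have "\<dots> \<le> ennreal_powr (ennreal (t powr (- \<gamma>)) * S t) p"
          by (intro ennreal_powr_mono le j p)
        finally show ?thesis .
      qed
    qed
    finally have "(\<Sum>j. ennreal ((A * v (Suc j)) powr p) * (1 / 2)) < top" using ff by order
    also have "(\<Sum>j. ennreal ((A * v (Suc j)) powr p) * (1 / 2)) = (\<Sum>j. ennreal ((A * v (Suc j)) powr p / 2))"
      by (intro suminf_cong) (simp add: ennreal_divide_numeral ennreal_times_divide)
    finally have "summable (\<lambda>j. (A * v (Suc j)) powr p / 2)"
      by (intro summable_suminf_not_top) auto
    then have "summable (\<lambda>j. 2 / A powr p * ((A * v (Suc j)) powr p / 2))" by (rule summable_mult)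
    then have "summable (\<lambda>j. v (Suc j) powr p)" using A v0 by (simp add: powr_mult)
    then have "summable (\<lambda>j. v j powr p)" by (subst (asm) summable_Suc_iff)
    then show ?thesis using False p by (simp add: lq_seq_def v_def)
  qed
qed

section \<open>Graded Besov-Orlicz classes\<close>

lemma continuous_on_triangle2_compose:
  fixes A :: "real \<Rightarrow> real \<Rightarrow> 'b::topological_space"
  assumes "continuous_on (triangle2 T) (\<lambda>(s, t). A s t)" "continuous_on D f" "continuous_on D g"
    "\<And>r. r \<in> D \<Longrightarrow> 0 \<le> f r \<and> f r \<le> g r \<and> g r \<le> T"
  shows "continuous_on D (\<lambda>r. A (f r) (g r))"
proof -
  have "continuous_on D (\<lambda>r. (\<lambda>(s, t). A s t) (f r, g r))"
    by (rule continuous_on_compose2[OF assms(1)])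
       (use assms in \<open>auto simp: triangle2_def intro!: continuous_intros\<close>)
  then show ?thesis by simp
qed

lemma continuous_on_triangle2_fst:
  "continuous_on {0..T} g \<Longrightarrow> continuous_on (triangle2 T) (\<lambda>x. g (fst x))"
  by (rule continuous_on_compose2[where f = fst]) (auto simp: triangle2_def intro!: continuous_intros)

lemma continuous_on_triangle2_snd:
  "continuous_on {0..T} g \<Longrightarrow> continuous_on (triangle2 T) (\<lambda>x. g (snd x))"
  by (rule continuous_on_compose2[where f = snd]) (auto simp: triangle2_def intro!: continuous_intros)

lemma compact_triangle2: "compact (triangle2 T)"
proof (rule compact_eq_bounded_closed[THEN iffD2, OF conjI])
  have "triangle2 T \<subseteq> {0..T} \<times> {0..T}" by (auto simp: triangle2_def)
  then show "bounded (triangle2 T)" by (rule bounded_subset[rotated]) (intro bounded_Times bounded_closed_interval)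
  have "triangle2 T = {x. 0 \<le> fst x} \<inter> {x. fst x \<le> snd x} \<inter> {x. snd x \<le> T}"
    by (auto simp: triangle2_def)
  moreover have "closed \<dots>" by (intro closed_Int closed_Collect_le continuous_intros)
  ultimately show "closed (triangle2 T)" by simp
qed

locale besov_orlicz =
  fixes T \<alpha> \<beta> :: real and q :: ennreal
  assumes T: "0 < T" and alpha: "0 < \<alpha>" and beta: "0 < \<beta>" and q: "0 < q"
begin

text \<open>Grade \<open>k\<close> stands for the parameters \<open>(k\<alpha>, \<beta>/k, q/k)\<close>: products add grades.\<close>

definition BO_modulus :: "real \<Rightarrow> (real \<Rightarrow> real \<Rightarrow> real) \<Rightarrow> (real \<Rightarrow> real) \<Rightarrow> bool" where
  "BO_modulus k A w \<longleftrightarrow> mono_on {0<..T} w \<and>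
     (\<forall>h\<in>{0<..T}. gauge_le (\<beta> / k) {0..T - h} (\<lambda>r. A r (r + h)) (w h)) \<and>
     lq_seq q k (\<lambda>j. (2 ^ j) powr (k * \<alpha>) * w (T / 2 ^ j))"

text \<open>The functions are scalar so that they can be multiplied. Continuity on the triangle
  makes every section r -> A r (r + h) measurable at once.\<close>

definition BO :: "real \<Rightarrow> (real \<Rightarrow> real \<Rightarrow> real) \<Rightarrow> bool" where
  "BO k A \<longleftrightarrow> continuous_on (triangle2 T) (\<lambda>(s, t). A s t) \<and>
     (\<forall>s t. 0 \<le> s \<and> s \<le> t \<and> t \<le> T \<longrightarrow> 0 \<le> A s t) \<and> (\<exists>w. BO_modulus k A w)"

lemma BO_modulusD:
  assumes "BO_modulus k A w"
  shows "mono_on {0<..T} w" "\<And>h. 0 < h \<Longrightarrow> h \<le> T \<Longrightarrow> 0 < w h"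
    "\<And>h. 0 < h \<Longrightarrow> h \<le> T \<Longrightarrow> gauge_le (\<beta> / k) {0..T - h} (\<lambda>r. A r (r + h)) (w h)"
    "lq_seq q k (\<lambda>j. (2 ^ j) powr (k * \<alpha>) * w (T / 2 ^ j))"
    "\<And>j. 0 \<le> (2 ^ j) powr (k * \<alpha>) * w (T / 2 ^ j)"
proof -
  show pos: "0 < w h" if "0 < h" "h \<le> T" for h
    using assms that by (force simp: BO_modulus_def gauge_le_def)
  show "0 \<le> (2 ^ j) powr (k * \<alpha>) * w (T / 2 ^ j)" for j
    using dyadic_bounds[OF T, of j] pos by (simp add: less_imp_le)
qed (use assms in \<open>auto simp: BO_modulus_def\<close>)

lemma BO_E:
  assumes "BO k A" obtains w where "BO_modulus k A w"
  using assms by (auto simp: BO_def)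

lemma BO_I:
  assumes "continuous_on (triangle2 T) (\<lambda>(s, t). A s t)" "\<And>s t. 0 \<le> s \<Longrightarrow> s \<le> t \<Longrightarrow> t \<le> T \<Longrightarrow> 0 \<le> A s t"
    "mono_on {0<..T} w"
    "\<And>h. 0 < h \<Longrightarrow> h \<le> T \<Longrightarrow> gauge_le (\<beta> / k) {0..T - h} (\<lambda>r. A r (r + h)) (w h)"
    "lq_seq q k (\<lambda>j. (2 ^ j) powr (k * \<alpha>) * w (T / 2 ^ j))"
  shows "BO k A"
  using assms unfolding BO_def BO_modulus_def by auto

lemma BO_cont: "BO k A \<Longrightarrow> continuous_on (triangle2 T) (\<lambda>(s, t). A s t)"
  and BO_nonneg: "BO k A \<Longrightarrow> 0 \<le> s \<Longrightarrow> s \<le> t \<Longrightarrow> t \<le> T \<Longrightarrow> 0 \<le> A s t"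
  by (auto simp: BO_def)

lemma lag_continuous:
  fixes A :: "real \<Rightarrow> real \<Rightarrow> 'b::topological_space"
  assumes "continuous_on (triangle2 T) (\<lambda>(s, t). A s t)" "0 \<le> h" 
  shows "continuous_on {0..T - h} (\<lambda>r. A r (r + h))"
  using assms by (intro continuous_on_triangle2_compose[OF assms(1)] continuous_intros) auto

section \<open>Algebra of the graded classes\<close>

lemma BO_le:
  assumes k: "0 < k" and B: "BO k B" and A: "continuous_on (triangle2 T) (\<lambda>(s, t). A s t)"
    "\<And>s t. 0 \<le> s \<Longrightarrow> s \<le> t \<Longrightarrow> t \<le> T \<Longrightarrow> 0 \<le> A s t \<and> A s t \<le> B s t"
  shows "BO k A"
proof -
  obtain w where "BO_modulus k B w" using BO_E[OF B] .
  note w = BO_modulusD[OF this]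
  show ?thesis
  proof (rule BO_I[OF A(1) _ w(1) _ w(4)])
    fix h :: real assume h: "0 < h" "h \<le> T"
    show "gauge_le (\<beta> / k) {0..T - h} (\<lambda>r. A r (r + h)) (w h)"
      by (rule gauge_le_mono[OF _ w(3)[OF h]])
         (use beta k h A in \<open>auto intro!: lag_continuous\<close>)
  qed (use A(2) in auto)
qed

lemma BO_add:
  assumes k: "0 < k" and A: "BO k A" and B: "BO k B"
  shows "BO k (\<lambda>s t. A s t + B s t)"
proof -
  obtain w where "BO_modulus k A w" using BO_E[OF A] .
  note w = BO_modulusD[OF this]
  obtain v where "BO_modulus k B v" using BO_E[OF B] .
  note v = BO_modulusD[OF this]
  show ?thesis
  proof (rule BO_I[where w = "\<lambda>h. w h + v h"])
    show "continuous_on (triangle2 T) (\<lambda>(s, t). A s t + B s t)"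
      using BO_cont[OF A] BO_cont[OF B] unfolding case_prod_unfold by (intro continuous_intros)
    show "mono_on {0<..T} (\<lambda>h. w h + v h)"
      using w(1) v(1) by (auto simp: mono_on_def intro: add_mono)
    show "lq_seq q k (\<lambda>j. (2 ^ j) powr (k * \<alpha>) * (w (T / 2 ^ j) + v (T / 2 ^ j)))"
      using lq_seq_add[OF q k w(4,5) v(4,5)] by (simp add: algebra_simps)
  qed (use beta k w v BO_nonneg[OF A] BO_nonneg[OF B] in \<open>auto intro!: gauge_le_add\<close>)
qed

lemma BO_scale:
  assumes k: "0 < k" and A: "BO k A" and c: "0 < c"
  shows "BO k (\<lambda>s t. c * A s t)"
proof -
  obtain w where "BO_modulus k A w" using BO_E[OF A] .
  note w = BO_modulusD[OF this]
  show ?thesis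
  proof (rule BO_I[where w = "\<lambda>h. c * w h"])
    show "continuous_on (triangle2 T) (\<lambda>(s, t). c * A s t)"
      using BO_cont[OF A] unfolding case_prod_unfold by (intro continuous_intros)
    show "mono_on {0<..T} (\<lambda>h. c * w h)"
      using w(1) c by (auto simp: mono_on_def)
    show "lq_seq q k (\<lambda>j. (2 ^ j) powr (k * \<alpha>) * (c * w (T / 2 ^ j)))"
      using lq_seq_scale[OF w(4,5), of c] c by (simp add: algebra_simps)
  qed (use c w BO_nonneg[OF A] in \<open>auto intro!: gauge_le_scale\<close>)
qed

lemma BO_mult:
  assumes k: "0 < j" "0 < k" and A: "BO j A" and B: "BO k B"
  shows "BO (j + k) (\<lambda>s t. A s t * B s t)"
proof -
  obtain w where "BO_modulus j A w" using BO_E[OF A] .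
  note w = BO_modulusD[OF this]
  obtain v where "BO_modulus k B v" using BO_E[OF B] .
  note v = BO_modulusD[OF this]
  have pos: "0 < \<beta> / j" "0 < \<beta> / k" using k beta by auto
  have "1 / (\<beta> / (j + k)) = 1 / (\<beta> / j) + 1 / (\<beta> / k)" using k by (simp add: add_divide_distrib)
  note mult = gauge_le_mult[OF pos this T]
  obtain K where K: "0 < K" "\<And>D u v c d. D \<in> sets borel \<Longrightarrow> D \<subseteq> {0..T} \<Longrightarrow> gauge_le (\<beta> / j) D u c \<Longrightarrow>
      gauge_le (\<beta> / k) D v d \<Longrightarrow> gauge_le (\<beta> / (j + k)) D (\<lambda>r. u r * v r) (K * (c * d))"
    using mult by blast
  show ?thesis
  proof (rule BO_I[where w = "\<lambda>h. K * (w h * v h)"])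
    show "continuous_on (triangle2 T) (\<lambda>(s, t). A s t * B s t)"
      using BO_cont[OF A] BO_cont[OF B] unfolding case_prod_unfold by (intro continuous_intros)
    show "mono_on {0<..T} (\<lambda>h. K * (w h * v h))"
      using w(1,2) v(1,2) K(1) by (auto simp: mono_on_def less_imp_le intro!: mult_left_mono mult_mono)
    have "lq_seq q (j + k) (\<lambda>i. K * (((2 ^ i) powr (j * \<alpha>) * w (T / 2 ^ i)) * ((2 ^ i) powr (k * \<alpha>) * v (T / 2 ^ i))))"
      by (intro lq_seq_scale lq_seq_mult q k w(4,5) v(4,5) mult_nonneg_nonneg[OF w(5) v(5)]) (use K in auto)
    then show "lq_seq q (j + k) (\<lambda>i. (2 ^ i) powr ((j + k) * \<alpha>) * (K * (w (T / 2 ^ i) * v (T / 2 ^ i))))"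
      by (simp add: ring_distribs powr_add mult_ac)
  qed (use K w v BO_nonneg[OF A] BO_nonneg[OF B] in auto)
qed

lemma powr_dyadic:
  "(2 ^ j) powr a * (T / 2 ^ j) powr b = T powr b * (2 powr (a - b)) ^ j"
proof -
  have "(2 ^ j) powr c = (2 powr c) ^ j" for c :: real
    by (simp add: powr_realpow[symmetric] powr_powr mult.commute)
  then show ?thesis using T by (simp add: powr_divide powr_diff power_divide)
qed

lemma lq_seq_powr:
  assumes k: "0 < k" and g: "k * \<alpha> < g"
  shows "lq_seq q k (\<lambda>j. (2 ^ j) powr (k * \<alpha>) * (T / 2 ^ j) powr g)"
proof -
  have "lq_seq q k (\<lambda>j. T powr g * (2 powr (k * \<alpha> - g)) ^ j)"
    using g by (intro lq_seq_scale lq_seq_geometric q k) (auto simp: powr_less_one)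
  then show ?thesis by (simp add: powr_dyadic)
qed

text \<open>An exponent strictly above k\<alpha> turns the rescaled dyadic sequence into a geometric
  one, which lies in l^(q/k) for every \<open>q\<close>.\<close>

lemma BO_bounded:
  assumes k: "0 < k" and g: "k * \<alpha> < g" and C: "0 < C"
    and A: "continuous_on (triangle2 T) (\<lambda>(s, t). A s t)"
    "\<And>s t. 0 \<le> s \<Longrightarrow> s \<le> t \<Longrightarrow> t \<le> T \<Longrightarrow> 0 \<le> A s t \<and> A s t \<le> C * (t - s) powr g"
  shows "BO k A"
proof -
  obtain K where K: "0 < K" "\<And>D u v. D \<in> sets borel \<Longrightarrow> D \<subseteq> {0..T} \<Longrightarrow> 0 < v \<Longrightarrow> continuous_on D u \<Longrightarrow>
      (\<And>r. r \<in> D \<Longrightarrow> 0 \<le> u r \<and> u r \<le> v) \<Longrightarrow> gauge_le (\<beta> / k) D u (K * v)"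
    using gauge_le_const[OF divide_pos_pos[OF beta k] T] by blast
  have g0: "0 < g" using k alpha g by (smt (verit) mult_pos_pos)
  show ?thesis
  proof (rule BO_I[OF A(1), where w = "\<lambda>h. K * (C * h powr g)"])
    show "mono_on {0<..T} (\<lambda>h. K * (C * h powr g))"
      using K C g0 by (auto simp: mono_on_def intro!: mult_left_mono powr_mono2)
    show "gauge_le (\<beta> / k) {0..T - h} (\<lambda>r. A r (r + h)) (K * (C * h powr g))" if h: "0 < h" "h \<le> T" for h
    proof (intro K lag_continuous A)
      fix r assume "r \<in> {0..T - h}"
      then show "0 \<le> A r (r + h) \<and> A r (r + h) \<le> C * h powr g" using A(2)[of r "r + h"] h by simp
    qed (use h C in auto)
    have "lq_seq q k (\<lambda>j. (K * C) * ((2 ^ j) powr (k * \<alpha>) * (T / 2 ^ j) powr g))"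
      using K C by (intro lq_seq_scale lq_seq_powr k g) auto
    then show "lq_seq q k (\<lambda>j. (2 ^ j) powr (k * \<alpha>) * (K * (C * (T / 2 ^ j) powr g)))"
      by (simp add: mult_ac)
  qed (use A(2) in auto)
qed

text \<open>A sequence in l^(q/k) is bounded. Monotonicity carries the bound from dyadic arguments
  to all \<open>h\<close>; moving to the next dyadic point costs the factor 2^(k\<alpha>).\<close>

lemma lq_seq_imp_powr_bound:
  assumes k: "0 < k" and w: "mono_on {0<..T} w" "\<And>h. 0 < h \<Longrightarrow> h \<le> T \<Longrightarrow> 0 < w h"
    "lq_seq q k (\<lambda>j. (2 ^ j) powr (k * \<alpha>) * w (T / 2 ^ j))"
  obtains C where "0 < C" "\<And>h. 0 < h \<Longrightarrow> h \<le> T \<Longrightarrow> w h \<le> C * h powr (k * \<alpha>)"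
proof -
  have "0 \<le> (2 ^ j) powr (k * \<alpha>) * w (T / 2 ^ j)" for j
    using dyadic_bounds[OF T, of j] w(2) by (simp add: less_imp_le)
  then obtain C where C: "0 < C" "\<And>j. (2 ^ j) powr (k * \<alpha>) * w (T / 2 ^ j) \<le> C"
    using lq_seq_bounded[OF q k w(3)] by blast
  show ?thesis
  proof (rule that[of "C * (2 / T) powr (k * \<alpha>)"])
    fix h assume h: "0 < h" "h \<le> T"
    obtain j where j: "T / 2 ^ Suc j < h" "h \<le> T / 2 ^ j" using dyadic_interval_ex[OF h] by metis
    have "w h \<le> w (T / 2 ^ j)"
      using j h dyadic_bounds[OF T, of j] by (intro mono_onD[OF w(1)]) auto
    also have "\<dots> \<le> C / (2 ^ j) powr (k * \<alpha>)" using C(2)[of j] by (simp add: field_simps)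
    finally have wh: "w h \<le> C / (2 ^ j) powr (k * \<alpha>)" .
    have "1 / 2 ^ j \<le> (2 / T) * h" using j T by (simp add: field_simps)
    then have "(1 / 2 ^ j) powr (k * \<alpha>) \<le> ((2 / T) * h) powr (k * \<alpha>)"
      using k alpha by (intro powr_mono2) auto
    then have "C * (1 / 2 ^ j) powr (k * \<alpha>) \<le> C * ((2 / T) * h) powr (k * \<alpha>)"
      using C(1) by (intro mult_left_mono) auto
    moreover have "C * (1 / 2 ^ j) powr (k * \<alpha>) = C / (2 ^ j) powr (k * \<alpha>)"
      by (simp add: powr_divide)
    moreover have "C * ((2 / T) * h) powr (k * \<alpha>) = C * (2 / T) powr (k * \<alpha>) * h powr (k * \<alpha>)"
      by (simp only: powr_mult mult.assoc)
    ultimately show "w h \<le> C * (2 / T) powr (k * \<alpha>) * h powr (k * \<alpha>)" using wh by linarith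
  qed (use C T in auto)
qed

section \<open>Passage between Besov-Orlicz norms and graded classes\<close>

lemma orlicz_norm_lag_bounded:
  fixes \<Xi> :: "real \<Rightarrow> real \<Rightarrow> 'v::real_normed_vector"
  assumes b: "0 < b" and cont: "continuous_on (triangle2 T) (\<lambda>(s, t). \<Xi> s t)"
  obtains M where "0 < M" "\<And>h. 0 \<le> h \<Longrightarrow> h \<le> T \<Longrightarrow> orlicz_norm b {0..T - h} (\<lambda>r. \<Xi> r (r + h)) \<le> ennreal M"
proof -
  obtain K where K: "0 < K" "\<And>D u v. D \<in> sets borel \<Longrightarrow> D \<subseteq> {0..T} \<Longrightarrow> 0 < v \<Longrightarrow> continuous_on D u \<Longrightarrow>
      (\<And>r. r \<in> D \<Longrightarrow> 0 \<le> u r \<and> u r \<le> v) \<Longrightarrow> gauge_le b D u (K * v)"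
    using gauge_le_const[OF b T] by blast
  have "bounded ((\<lambda>(s, t). \<Xi> s t) ` triangle2 T)"
    by (intro compact_imp_bounded compact_continuous_image cont compact_triangle2)
  then obtain M where M: "0 < M" "\<And>s t. (s, t) \<in> triangle2 T \<Longrightarrow> norm (\<Xi> s t) \<le> M"
    unfolding bounded_pos by force
  show ?thesis
  proof (rule that[of "K * M"])
    fix h assume h: "0 \<le> h" "h \<le> T"
    have "gauge_le b {0..T - h} (\<lambda>r. norm (\<Xi> r (r + h))) (K * M)"
      using M h by (intro K continuous_intros lag_continuous cont) (auto simp: triangle2_def)
    then show "orlicz_norm b {0..T - h} (\<lambda>r. \<Xi> r (r + h)) \<le> ennreal (K * M)" by (rule orlicz_norm_le_gauge)
  qed (use K M in simp)
qed

lemma BO_if_besov2_norm: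
  fixes \<Xi> :: "real \<Rightarrow> real \<Rightarrow> 'v::real_normed_vector"
  assumes k: "0 < k" and Q: "Q = \<infinity> \<longleftrightarrow> q = \<infinity>" "enn2real Q = enn2real q / k"
    and cont: "continuous_on (triangle2 T) (\<lambda>(s, t). \<Xi> s t)"
    and fin: "besov2_norm (k * \<alpha>) (\<beta> / k) Q T \<Xi> < \<infinity>"
  shows "BO k (\<lambda>s t. norm (\<Xi> s t))"
proof -
  define S where "S t = (SUP h \<in> {0..t}. orlicz_norm (\<beta> / k) {0..T - h} (\<lambda>r. \<Xi> r (r + h)))" for t
  \<comment> \<open>By continuity on the compact triangle every lag norm is finite, so that
    \<open>enn2real\<close> below does not silently turn an infinite value into 0.\<close>
  obtain M where M: "0 < M" "\<And>h. 0 \<le> h \<Longrightarrow> h \<le> T \<Longrightarrow> orlicz_norm (\<beta> / k) {0..T - h} (\<lambda>r. \<Xi> r (r + h)) \<le> ennreal M"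
    using orlicz_norm_lag_bounded[OF divide_pos_pos[OF beta k] cont] by blast
  have SM: "S t \<le> ennreal M" if "t \<le> T" for t
    unfolding S_def using M that by (intro SUP_least) auto
  then have Sfin: "S t < top" if "t \<le> T" for t using that by (metis ennreal_less_top le_less_trans)
  define v where "v t = enn2real (S t)" for t
  have v: "S t = ennreal (v t)" "0 \<le> v t" if "t \<le> T" for t
    using Sfin[OF that] by (auto simp: v_def)
  have Smono: "S s \<le> S t" if "s \<le> t" for s t unfolding S_def using that by (intro SUP_subset_mono) auto
  have vmono: "mono_on {0<..T} v"
    using Sfin Smono by (auto simp: mono_on_def v_def intro!: enn2real_mono)
  have g: "0 < k * \<alpha>" using k alpha by simp
  have lqv: "lq_seq q k (\<lambda>j. (2 ^ j) powr (k * \<alpha>) * v (T / 2 ^ j))"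
    using fin unfolding besov2_norm_def S_def[symmetric]
    by (intro Lq_norm_less_topD[OF T g q k Q, of S v] vmono v)
  \<comment> \<open>The added power makes the bound strict, hence admissible as a gauge constant,
    and its exponent exceeds k\<alpha>, so summability is kept.\<close>
  define w where "w t = v t + t powr (k * \<alpha> + 1)" for t
  show ?thesis
  proof (rule BO_I[where w = w])
    show "continuous_on (triangle2 T) (\<lambda>(s, t). norm (\<Xi> s t))"
      using cont unfolding case_prod_unfold by (intro continuous_intros)
    show "mono_on {0<..T} w"
      using vmono g by (auto simp: mono_on_def w_def intro!: add_mono powr_mono2)
    have "lq_seq q k (\<lambda>j. (2 ^ j) powr (k * \<alpha>) * v (T / 2 ^ j) + (2 ^ j) powr (k * \<alpha>) * (T / 2 ^ j) powr (k * \<alpha> + 1))"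
      using v dyadic_bounds[OF T] by (intro lq_seq_add q k lqv lq_seq_powr) auto
    then show "lq_seq q k (\<lambda>j. (2 ^ j) powr (k * \<alpha>) * w (T / 2 ^ j))"
      by (simp add: w_def distrib_left)
    fix h assume h: "0 < h" "h \<le> T"
    have "orlicz_norm (\<beta> / k) {0..T - h} (\<lambda>r. \<Xi> r (r + h)) \<le> S h"
      unfolding S_def using h by (intro SUP_upper) auto
    also have "\<dots> < ennreal (w h)" using v[of h] h by (simp add: w_def ennreal_lessI)
    finally show "gauge_le (\<beta> / k) {0..T - h} (\<lambda>r. norm (\<Xi> r (r + h))) (w h)"
      using beta k h by (intro gauge_le_orlicz_norm lag_continuous cont) auto
  qed simp
qed

lemma besov2_space_if_BO:
  fixes \<Xi> :: "real \<Rightarrow> real \<Rightarrow> 'v::real_normed_vector"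
  assumes k: "0 < k" and Q: "Q = \<infinity> \<longleftrightarrow> q = \<infinity>" "enn2real Q = enn2real q / k"
    and cont: "continuous_on (triangle2 T) (\<lambda>(s, t). \<Xi> s t)" and diag: "\<And>r. 0 \<le> r \<Longrightarrow> r \<le> T \<Longrightarrow> \<Xi> r r = 0"
    and bo: "BO k (\<lambda>s t. norm (\<Xi> s t))"
  shows "\<Xi> \<in> besov2_space (k * \<alpha>) (\<beta> / k) Q T"
proof -
  obtain w where "BO_modulus k (\<lambda>s t. norm (\<Xi> s t)) w" using BO_E[OF bo] .
  note w = BO_modulusD[OF this]
  define S where "S t = (SUP h \<in> {0..t}. orlicz_norm (\<beta> / k) {0..T - h} (\<lambda>r. \<Xi> r (r + h)))" for t
  have "S t \<le> ennreal (w t)" if t: "0 < t" "t \<le> T" for t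
    unfolding S_def
  proof (rule SUP_least)
    fix h assume h: "h \<in> {0..t}"
    show "orlicz_norm (\<beta> / k) {0..T - h} (\<lambda>r. \<Xi> r (r + h)) \<le> ennreal (w t)"
    \<comment> \<open>Lag 0 belongs to the supremum but not to \<open>BO\<close>, which only speaks
      of h > 0. There \<open>diag\<close> makes the function vanish.\<close>
    proof (cases "h = 0")
      case True
      have "gauge_le (\<beta> / k) {0..T} (\<lambda>_. 0) (w t)"
        using w(2)[OF t] by (simp add: gauge_le_def)
      then have "gauge_le (\<beta> / k) {0..T} (\<lambda>r. norm (\<Xi> r r)) (w t)"
        by (rule gauge_le_mono[OF divide_pos_pos[OF beta k]])
           (use lag_continuous[OF cont, of 0] diag in \<open>auto intro!: continuous_intros\<close>)
      then show ?thesis using True by (auto intro: orlicz_norm_le_gauge)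
    next
      case False
      then have "orlicz_norm (\<beta> / k) {0..T - h} (\<lambda>r. \<Xi> r (r + h)) \<le> ennreal (w h)"
        using h t by (intro orlicz_norm_le_gauge w) auto
      also have "w h \<le> w t" using h t False by (intro mono_onD[OF w(1)]) auto
      then have "ennreal (w h) \<le> ennreal (w t)" by (rule ennreal_leI)
      finally show ?thesis .
    qed
  qed
  moreover have "mono S" unfolding S_def by (intro monoI SUP_subset_mono) auto
  ultimately have "Lq_norm Q (dtau_over_tau T) (\<lambda>t. ennreal (t powr - (k * \<alpha>)) * S t) < \<infinity>"
    using k alpha w by (intro Lq_norm_less_topI[OF T _ q k Q, of _ _ w]) (auto simp: less_imp_le)
  then have "besov2_norm (k * \<alpha>) (\<beta> / k) Q T \<Xi> < \<infinity>" by (simp add: besov2_norm_def S_def)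
  moreover have "(\<lambda>(s, t). \<Xi> s t) \<in> borel_measurable (restrict_space borel (triangle2 T))"
    using cont by (rule borel_measurable_continuous_on_restrict)
  ultimately show ?thesis by (simp add: besov2_space_def)
qed

end

section \<open>Pointwise bounds\<close>

text \<open>Averages over [0, l] tend to the value at 0. This removes the initial term of the
  telescoping argument below.\<close>

lemma integral_small_near_zero:
  fixes \<phi> :: "real \<Rightarrow> 'v::euclidean_space"
  assumes h: "0 < h" and cont: "continuous_on {0..h} \<phi>" and zero: "\<phi> 0 = 0" and e: "0 < e"
  obtains d where "0 < d" "\<And>l. 0 < l \<Longrightarrow> l < d \<Longrightarrow> l \<le> h \<Longrightarrow> norm (integral {0..l} \<phi>) \<le> e * l"
proof -
  have "\<exists>d>0. \<forall>x\<in>{0..h}. dist x 0 < d \<longrightarrow> dist (\<phi> x) (\<phi> 0) < e"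
    using cont h e unfolding continuous_on_iff by (metis atLeastAtMost_iff less_imp_le order_refl)
  then obtain d where d: "0 < d" "\<And>x. x \<in> {0..h} \<Longrightarrow> x < d \<Longrightarrow> norm (\<phi> x) < e"
    by (auto simp: zero)
  show ?thesis
  proof (rule that[OF d(1)])
    fix l assume l: "0 < l" "l < d" "l \<le> h"
    have "norm (integral {0..l} \<phi>) \<le> integral {0..l} (\<lambda>_. e)"
    proof (rule integral_norm_bound_integral)
      show "\<phi> integrable_on {0..l}"
        using l by (intro integrable_continuous_real continuous_on_subset[OF cont]) auto
    qed (use d l in \<open>auto intro: less_imp_le\<close>)
    then show "norm (integral {0..l} \<phi>) \<le> e * l" using l by (simp add: mult.commute)
  qed
qed

text \<open>Comparing the averages over \<open>[0, l]\<close> and \<open>[0, 2l]\<close> and telescoping over dyadic \<open>l\<close>.\<close>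

lemma average_bound:
  fixes \<phi> :: "real \<Rightarrow> 'v::euclidean_space"
  assumes h: "0 < h" and cont: "continuous_on {0..h} \<phi>" and zero: "\<phi> 0 = 0" and g: "0 < g" and C: "0 \<le> C"
    and bd: "\<And>l. 0 < l \<Longrightarrow> 2 * l \<le> h \<Longrightarrow> norm (integral {0..l} (\<lambda>u. \<phi> (u + l) - \<phi> u)) \<le> C * l * l powr g"
  shows "norm (integral {0..h} \<phi>) \<le> (C / (1 - 2 powr (- g))) * h * h powr g"
proof -
  define r where "r = 2 powr (- g)"
  have r: "0 < r" "r < 1" using g by (auto simp: r_def powr_less_one)
  define K where "K = C / (1 - r)"
  have K0: "0 \<le> K" using C r by (simp add: K_def)
  have KC: "C = K * (1 - r)" using r by (simp add: K_def)
  have step: "norm (integral {0..2 * l} \<phi>) \<le> 2 * norm (integral {0..l} \<phi>) + C * l * l powr g"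
    if l: "0 < l" "2 * l \<le> h" for l
  proof -
    have int: "\<phi> integrable_on {a..b}" if "0 \<le> a" "b \<le> h" for a b
      using that by (intro integrable_continuous_real continuous_on_subset[OF cont]) auto
    have shift: "((\<lambda>u. \<phi> (u + l)) has_integral integral {l..2 * l} \<phi>) {0..l}"
      using has_integral_shift_real_ivl[of \<phi> "integral {l..2*l} \<phi>" l "2 * l" l]
        integrable_integral[OF int[of l "2 * l"]] l by simp
    have "integral {0..2 * l} \<phi> = integral {0..l} \<phi> + integral {l..2 * l} \<phi>"
      using l by (intro Henstock_Kurzweil_Integration.integral_combine[symmetric] int) auto
    also have "integral {l..2 * l} \<phi> = integral {0..l} (\<lambda>u. \<phi> (u + l))"
      using shift by (simp add: integral_unique)
    also have "\<dots> = integral {0..l} (\<lambda>u. \<phi> (u + l) - \<phi> u) + integral {0..l} \<phi>"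
      using shift int[of 0 l] l by (subst Henstock_Kurzweil_Integration.integral_diff) (auto simp: has_integral_integrable)
    finally have "integral {0..2 * l} \<phi> = 2 *\<^sub>R integral {0..l} \<phi> + integral {0..l} (\<lambda>u. \<phi> (u + l) - \<phi> u)"
      by (simp add: scaleR_2)
    then have "norm (integral {0..2 * l} \<phi>) \<le> norm (2 *\<^sub>R integral {0..l} \<phi>) + norm (integral {0..l} (\<lambda>u. \<phi> (u + l) - \<phi> u))"
      by (metis norm_triangle_ineq)
    then show ?thesis using bd[OF l] by simp
  qed
  have main: "norm (integral {0..h} \<phi>) \<le> 2 ^ n * norm (integral {0..h / 2 ^ n} \<phi>) + K * h * h powr g" for n
  proof -
    \<comment> \<open>With the factor 1 - r^n the induction closes: one more halving costs at most K
      (r^n - r^(n+1)), because C = K (1 - r).\<close>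
    have "norm (integral {0..h} \<phi>) \<le> 2 ^ n * norm (integral {0..h / 2 ^ n} \<phi>) + K * h * h powr g * (1 - r ^ n)"
    proof (induction n)
      case (Suc n)
      let ?l = "h / 2 ^ Suc n"
      have l: "0 < ?l" "2 * ?l = h / 2 ^ n" using h by auto
      have "2 * ?l \<le> h" using dyadic_bounds(2)[OF h, of n] by simp
      from step[OF l(1) this]
      have "2 ^ n * norm (integral {0..h / 2 ^ n} \<phi>) \<le> 2 ^ n * (2 * norm (integral {0..?l} \<phi>) + C * ?l * ?l powr g)"
        unfolding l(2) by (intro mult_left_mono) auto
      also have "\<dots> = 2 ^ Suc n * norm (integral {0..?l} \<phi>) + C / 2 * h * ?l powr g"
        by (simp add: field_simps)
      also have "?l powr g = h powr g * r ^ Suc n"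
      proof -
        have "(2 ^ Suc n) powr g = (2 powr g) ^ Suc n" by (simp add: powr_powr powr_realpow[symmetric] mult.commute del: power_Suc)
        then show ?thesis using h by (simp add: powr_divide r_def powr_minus_divide power_divide del: power_Suc)
      qed
      also have "C / 2 * h * (h powr g * r ^ Suc n) \<le> K * h * h powr g * (r ^ n - r ^ Suc n)"
      proof -
        have "C / 2 * r ^ Suc n \<le> K * (r ^ n - r ^ Suc n)"
        proof -
          have "K * (r ^ n - r ^ Suc n) = C * r ^ n" unfolding KC by (simp add: algebra_simps)
          moreover have "C / 2 * r ^ Suc n \<le> C * r ^ n"
            using C r by (intro mult_mono) (auto simp: mult_le_cancel_right2)
          ultimately show ?thesis by simp
        qed
        then have "(h * h powr g) * (C / 2 * r ^ Suc n) \<le> (h * h powr g) * (K * (r ^ n - r ^ Suc n))"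
          using h by (intro mult_left_mono) auto
        then show ?thesis by (simp add: mult_ac)
      qed
      finally show ?case using Suc by (simp add: algebra_simps)
    qed simp
    also have "K * h * h powr g * (1 - r ^ n) \<le> K * h * h powr g"
      using K0 h r by (intro mult_right_le_one_le) (auto simp: power_le_one)
    finally show ?thesis by simp
  qed
  show ?thesis unfolding r_def[symmetric] K_def[symmetric]
  proof (rule field_le_epsilon)
    fix e :: real assume e: "0 < e"
    then have e': "0 < e / h" using h by simp
    obtain d where d: "0 < d" "\<And>l. 0 < l \<Longrightarrow> l < d \<Longrightarrow> l \<le> h \<Longrightarrow> norm (integral {0..l} \<phi>) \<le> e / h * l"
      using integral_small_near_zero[OF h cont zero e'] by blast
    obtain n :: nat where n: "h / d < 2 ^ n" using real_arch_pow[of 2] by auto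
    then have "h / 2 ^ n < d" using d by (simp add: field_simps)
    then have "norm (integral {0..h / 2 ^ n} \<phi>) \<le> e / h * (h / 2 ^ n)"
      using dyadic_bounds[OF h, of n] by (intro d) auto
    then have "2 ^ n * norm (integral {0..h / 2 ^ n} \<phi>) \<le> e" using h by (simp add: field_simps)
    then show "norm (integral {0..h} \<phi>) \<le> K * h * h powr g + e" using main[of n] by simp
  qed
qed

lemma norm_diff_le: "norm (x - z - y) \<le> c \<Longrightarrow> norm (x - y) \<le> norm z + c" for x :: "'a::real_normed_vector"
  using norm_triangle_sub[of "x - y" z] by (simp add: algebra_simps)

lemma norm_diff2_le: "norm (x - z - y) \<le> c \<Longrightarrow> norm x \<le> c + norm z + norm y" for x :: "'a::real_normed_vector"
  using norm_triangle_sub[of x y] norm_diff_le[of x z y c] by simp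

lemma gauge_le_subset:
  assumes b: "0 < b" and g: "gauge_le b D u c" and D': "D' \<subseteq> D"
  shows "gauge_le b D' u c"
proof (rule gauge_le_mono[OF b g D' order_refl])
  show "continuous_on D' u" using g D' by (metis continuous_on_subset gauge_le_def)
qed (use g D' in \<open>auto simp: gauge_le_def\<close>)

context besov_orlicz
begin

text \<open>The modulus contributes l^(k\<alpha>), and the loss allowed in
  \<open>gauge_le_average\<close> is taken to be the whole gap k\<alpha> - g.\<close>

lemma BO_average_bound:
  assumes k: "0 < k" and A: "BO k A" and g: "g < k * \<alpha>"
  obtains C where "0 < C" "\<And>s l. 0 \<le> s \<Longrightarrow> 0 < l \<Longrightarrow> s + 2 * l \<le> T \<Longrightarrow>
    integral {s..s + l} (\<lambda>r. A r (r + l)) \<le> C * l * l powr g"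
proof -
  obtain w where "BO_modulus k A w" using BO_E[OF A] .
  note w = BO_modulusD[OF this]
  obtain C where C: "0 < C" "\<And>h. 0 < h \<Longrightarrow> h \<le> T \<Longrightarrow> w h \<le> C * h powr (k * \<alpha>)"
    using lq_seq_imp_powr_bound[OF k w(1,2,4)] by blast
  define e where "e = k * \<alpha> - g"
  have e: "0 < e" using g by (simp add: e_def)
  obtain K where K: "0 < K" "\<And>D u c s h. gauge_le (\<beta> / k) D u c \<Longrightarrow> 0 < h \<Longrightarrow> h \<le> T \<Longrightarrow> {s..s + h} \<subseteq> D \<Longrightarrow>
      integral {s..s + h} u \<le> K * c * h * h powr (- e)"
    using gauge_le_average[OF divide_pos_pos[OF beta k] T e] by blast
  show ?thesis
  proof (rule that[of "K * C"])
    fix s l :: real assume sl: "0 \<le> s" "0 < l" "s + 2 * l \<le> T"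
    have "integral {s..s + l} (\<lambda>r. A r (r + l)) \<le> K * w l * l * l powr (- e)"
      by (rule K(2)[OF w(3)]) (use sl in auto)
    also have "\<dots> \<le> K * (C * l powr (k * \<alpha>)) * l * l powr (- e)"
      using K C(2)[of l] sl by (intro mult_right_mono mult_left_mono) auto
    also have "\<dots> = K * C * l * (l powr (k * \<alpha>) * l powr (- e))" by simp
    also have "l powr (k * \<alpha>) * l powr (- e) = l powr g" using sl by (simp add: e_def flip: powr_add)
    finally show "integral {s..s + l} (\<lambda>r. A r (r + l)) \<le> K * C * l * l powr g" .
  qed (use K C in simp)
qed

text \<open>Up to the defect, A s t is the mean over v of A s (s + v) + A (s + v) t. Read from s
  onwards and from t backwards, both summands are paths that start at 0 by \<open>diag\<close>, and
  whose increments over lag l are lag values of \<open>A\<close> up to the defect. Averages of lag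
  values are bounded, so \<open>average_bound\<close> applies at either end.\<close>

lemma BO_pointwise:
  fixes A :: "real \<Rightarrow> real \<Rightarrow> 'v::euclidean_space"
  assumes k: "0 < k" and bo: "BO k (\<lambda>s t. norm (A s t))" and cont: "continuous_on (triangle2 T) (\<lambda>(s, t). A s t)"
    and g: "0 < g" "g < k * \<alpha>" and diag: "\<And>s. 0 \<le> s \<Longrightarrow> s \<le> T \<Longrightarrow> A s s = 0" and C: "0 \<le> C"
    and delta: "\<And>s u t. 0 \<le> s \<Longrightarrow> s \<le> u \<Longrightarrow> u \<le> t \<Longrightarrow> t \<le> T \<Longrightarrow>
      norm (A s t - A s u - A u t) \<le> C * (t - s) powr g"
  obtains C' where "0 < C'" "\<And>s t. 0 \<le> s \<Longrightarrow> s \<le> t \<Longrightarrow> t \<le> T \<Longrightarrow> norm (A s t) \<le> C' * (t - s) powr g"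
proof -
  obtain K where K: "0 < K" "\<And>s l. 0 \<le> s \<Longrightarrow> 0 < l \<Longrightarrow> s + 2 * l \<le> T \<Longrightarrow>
    integral {s..s + l} (\<lambda>r. norm (A r (r + l))) \<le> K * l * l powr g"
    using BO_average_bound[OF k bo g(2)] by blast
  \<comment> \<open>The defect enters on intervals of length u + l <= 2l, which gives the factor
    2^g.\<close>
  define M where "M = K + C * 2 powr g"
  have M: "0 < M" using K C by (simp add: M_def add_pos_nonneg)
  define K' where "K' = M / (1 - 2 powr (- g))"
  have r: "2 powr (- g) < 1" using g by (simp add: powr_less_one)
  have K': "0 < K'" using M r by (simp add: K'_def)
  have lag: "continuous_on {a..b} (\<lambda>r. norm (A r (r + l)))" if "0 \<le> a" "0 \<le> l" "b + l \<le> T" for a b l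
    using that by (intro continuous_intros continuous_on_triangle2_compose[OF cont]) auto
  \<comment> \<open>Common to both ends: a path from 0 whose increments over lag l are dominated by
    some function \<open>\<psi> l\<close> with controlled mean, plus the defect.\<close>
  have key: "norm (integral {0..h} \<phi>) \<le> K' * h * h powr g"
    if h: "0 < h" "continuous_on {0..h} \<phi>" "\<phi> 0 = 0"
      and a: "\<And>l u. 0 < l \<Longrightarrow> 2 * l \<le> h \<Longrightarrow> u \<in> {0..l} \<Longrightarrow>
        norm (\<phi> (u + l) - \<phi> u) \<le> \<psi> l u + C * (2 * l) powr g"
      and b: "\<And>l. 0 < l \<Longrightarrow> 2 * l \<le> h \<Longrightarrow> continuous_on {0..l} (\<psi> l) \<and> integral {0..l} (\<psi> l) \<le> K * l * l powr g"
    for h and \<phi> :: "real \<Rightarrow> 'v" and \<psi>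
    unfolding K'_def
  proof (rule average_bound[OF h g(1)])
    fix l assume l: "0 < l" "2 * l \<le> h"
    have "norm (integral {0..l} (\<lambda>u. \<phi> (u + l) - \<phi> u)) \<le> integral {0..l} (\<lambda>u. \<psi> l u + C * (2 * l) powr g)"
      using l a[OF l] b[OF l]
      by (intro integral_norm_bound_integral integrable_continuous_real continuous_intros
           continuous_on_compose2[OF h(2), of "{0..l}" "\<lambda>u. u + l"] continuous_on_subset[OF h(2)]) auto
    also have "\<dots> = integral {0..l} (\<psi> l) + l * (C * (2 * l) powr g)"
      using b[OF l] l by (subst Henstock_Kurzweil_Integration.integral_add) (auto intro: integrable_continuous_real)
    also have "\<dots> \<le> K * l * l powr g + l * (C * (2 * l) powr g)" using b[OF l] by simp
    also have "\<dots> = M * l * l powr g" by (simp add: M_def powr_mult algebra_simps)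
    finally show "norm (integral {0..l} (\<lambda>u. \<phi> (u + l) - \<phi> u)) \<le> M * l * l powr g" .
  qed (use M in auto)
  show ?thesis
  proof (rule that[of "2 * K' + C + 1"])
    show "0 < 2 * K' + C + 1" using K' C by simp
    fix s t assume st: "0 \<le> s" "s \<le> t" "t \<le> T"
    show "norm (A s t) \<le> (2 * K' + C + 1) * (t - s) powr g"
    proof (cases "s = t")
      case True then show ?thesis using diag[of s] st by simp
    next
      case False
      define h where "h = t - s"
      have h: "0 < h" "s + h = t" using st False by (auto simp: h_def)
      let ?L = "\<lambda>v. A s (s + v)" and ?R = "\<lambda>v. A (t - v) t"
      have cL: "continuous_on {0..h} ?L" and cR: "continuous_on {0..h} ?R"
        using st h by (auto intro!: continuous_on_triangle2_compose[OF cont] continuous_intros)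
      have L: "norm (integral {0..h} ?L) \<le> K' * h * h powr g"
      proof (rule key[where \<psi> = "\<lambda>l u. norm (A (s + u) (s + u + l))", OF h(1) cL])
        fix l assume l: "0 < l" "2 * l \<le> h"
        have "((\<lambda>u. norm (A (u + s) (u + s + l))) has_integral integral {s..s + l} (\<lambda>r. norm (A r (r + l)))) {0..l}"
          using has_integral_shift_real_ivl[of "\<lambda>r. norm (A r (r + l))" "integral {s..s + l} (\<lambda>r. norm (A r (r + l)))" s "s + l" s]
            integrable_integral[OF integrable_continuous_real[OF lag[of s l "s + l"]]] st h l by simp
        then have "integral {0..l} (\<lambda>u. norm (A (s + u) (s + u + l))) = integral {s..s + l} (\<lambda>r. norm (A r (r + l)))"
          by (intro integral_unique) (simp add: add.commute add.left_commute)
        moreover have "continuous_on {0..l} (\<lambda>u. norm (A (s + u) (s + u + l)))"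
          using st h l by (intro continuous_intros continuous_on_triangle2_compose[OF cont]) auto
        ultimately show "continuous_on {0..l} (\<lambda>u. norm (A (s + u) (s + u + l))) \<and>
            integral {0..l} (\<lambda>u. norm (A (s + u) (s + u + l))) \<le> K * l * l powr g"
          using K(2)[of s l] st h l by simp
        fix u assume u: "u \<in> {0..l}"
        have "norm (A s (s + (u + l)) - A s (s + u) - A (s + u) (s + u + l)) \<le> C * (u + l) powr g"
          using delta[of s "s + u" "s + (u + l)"] u l h st by (simp add: add.assoc)
        also have "\<dots> \<le> C * (2 * l) powr g" using u l g C by (intro mult_left_mono powr_mono2) auto
        finally show "norm (A s (s + (u + l)) - A s (s + u)) \<le> norm (A (s + u) (s + u + l)) + C * (2 * l) powr g"
          by (intro norm_diff_le) (simp add: algebra_simps)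
      qed (use diag[of s] st in auto)
      \<comment> \<open>Time reversed: as u runs over [0, l], the left points t - l - u of the lag
        values sweep [t - 2l, t - l].\<close>
      have R: "norm (integral {0..h} ?R) \<le> K' * h * h powr g"
      proof (rule key[where \<psi> = "\<lambda>l u. norm (A (t - l - u) (t - l - u + l))", OF h(1) cR])
        fix l assume l: "0 < l" "2 * l \<le> h"
        let ?f = "\<lambda>r. norm (A r (r + l))"
        let ?s = "t - 2 * l"
        have "(?f has_integral integral {?s..?s + l} ?f) {?s..?s + l}"
          using st h l by (intro integrable_integral integrable_continuous_real lag) auto
        then have "((\<lambda>x. ?f (- x)) has_integral integral {?s..?s + l} ?f) {- (?s + l)..- ?s}"
          by (subst has_integral_reflect_real) simp
        from has_integral_shift_real_ivl[OF this, of "l - t"]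
        have "((\<lambda>u. norm (A (t - l - u) (t - l - u + l))) has_integral integral {?s..?s + l} ?f) {0..l}"
          by (simp add: algebra_simps)
        then have "integral {0..l} (\<lambda>u. norm (A (t - l - u) (t - l - u + l))) = integral {?s..?s + l} ?f"
          by (rule integral_unique)
        moreover have "continuous_on {0..l} (\<lambda>u. norm (A (t - l - u) (t - l - u + l)))"
          using st h l by (intro continuous_intros continuous_on_triangle2_compose[OF cont]) auto
        ultimately show "continuous_on {0..l} (\<lambda>u. norm (A (t - l - u) (t - l - u + l))) \<and>
            integral {0..l} (\<lambda>u. norm (A (t - l - u) (t - l - u + l))) \<le> K * l * l powr g"
          using K(2)[of ?s l] st h l by simp
        fix u assume u: "u \<in> {0..l}"
        have "norm (A (t - (u + l)) t - A (t - (u + l)) (t - u) - A (t - u) t) \<le> C * (u + l) powr g"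
          using delta[of "t - (u + l)" "t - u" t] u l h st by simp
        also have "\<dots> \<le> C * (2 * l) powr g" using u l g C by (intro mult_left_mono powr_mono2) auto
        finally have "norm (A (t - (u + l)) t - A (t - u) t) \<le> norm (A (t - (u + l)) (t - u)) + C * (2 * l) powr g"
          by (rule norm_diff_le)
        moreover have eq: "t - l - u = t - (u + l)" by simp
        ultimately show "norm (A (t - (u + l)) t - A (t - u) t) \<le> norm (A (t - l - u) (t - l - u + l)) + C * (2 * l) powr g"
          unfolding eq by simp
      qed (use diag[of t] st in auto)
      \<comment> \<open>The substitution v -> h - v identifies the mean of the second summand with
        that of the reversed path.\<close>
      have R': "integral {0..h} (\<lambda>v. A (s + v) t) = integral {0..h} ?R"
      proof -
        have "(?R has_integral integral {0..h} ?R) {0..h}"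
          by (intro integrable_integral integrable_continuous_real cR)
        then have "((\<lambda>x. ?R (- x)) has_integral integral {0..h} ?R) {- h..- 0}"
          by (subst has_integral_reflect_real) simp
        from has_integral_shift_real_ivl[OF this, of "- h"]
        have "((\<lambda>v. A (s + v) t) has_integral integral {0..h} ?R) {0..h}"
          by (simp add: h_def algebra_simps)
        then show ?thesis by (rule integral_unique)
      qed
      have cR': "continuous_on {0..h} (\<lambda>v. A (s + v) t)"
        using st h by (intro continuous_on_triangle2_compose[OF cont] continuous_intros) auto
      have "norm (integral {0..h} (\<lambda>v. A s t - A s (s + v) - A (s + v) t)) \<le> integral {0..h} (\<lambda>_. C * h powr g)"
      proof (rule integral_norm_bound_integral)
        show "(\<lambda>v. A s t - A s (s + v) - A (s + v) t) integrable_on {0..h}"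
          by (intro integrable_continuous_real continuous_intros cL cR')
        fix v assume "v \<in> {0..h}"
        then show "norm (A s t - A s (s + v) - A (s + v) t) \<le> C * h powr g"
          using delta[of s "s + v" t] st h by (simp add: h_def)
      qed auto
      moreover have "integral {0..h} (\<lambda>v. A s t - A s (s + v) - A (s + v) t) =
          h *\<^sub>R A s t - integral {0..h} ?L - integral {0..h} ?R"
        using h cL cR' by (simp add: Henstock_Kurzweil_Integration.integral_diff integrable_continuous_real continuous_intros R')
      ultimately have "norm (h *\<^sub>R A s t - integral {0..h} ?L - integral {0..h} ?R) \<le> C * h * h powr g"
        using h by (simp add: mult_ac)
      then have "norm (h *\<^sub>R A s t) \<le> C * h * h powr g + K' * h * h powr g + K' * h * h powr g"
        using norm_diff2_le L R by fastforce
      then have "h * norm (A s t) \<le> h * ((2 * K' + C) * h powr g)" using h by (simp add: algebra_simps)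
      then have "norm (A s t) \<le> (2 * K' + C) * h powr g" using h by simp
      also have "\<dots> \<le> (2 * K' + C + 1) * h powr g" by (intro mult_right_mono) auto
      finally show ?thesis by (simp add: h_def)
    qed
  qed
qed

section \<open>Sewing in the Orlicz gauge\<close>

lemma BO_shifted_mult:
  assumes k: "0 < j" "0 < k" and A: "BO_modulus j A w" and B: "BO_modulus k B v"
  obtains K where "0 < K" "\<And>h. 0 < h \<Longrightarrow> 2 * h \<le> T \<Longrightarrow>
    gauge_le (\<beta> / (j + k)) {0..T - 2 * h} (\<lambda>r. A r (r + h) * B (r + h) (r + 2 * h)) (K * (w h * v h))"
proof -
  note w = BO_modulusD[OF A] and v = BO_modulusD[OF B]
  have pos: "0 < \<beta> / j" "0 < \<beta> / k" using k beta by auto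
  have "1 / (\<beta> / (j + k)) = 1 / (\<beta> / j) + 1 / (\<beta> / k)" using k by (simp add: add_divide_distrib)
  note mult = gauge_le_mult[OF pos this T]
  obtain K where K: "0 < K" "\<And>D u v c d. D \<in> sets borel \<Longrightarrow> D \<subseteq> {0..T} \<Longrightarrow> gauge_le (\<beta> / j) D u c \<Longrightarrow>
      gauge_le (\<beta> / k) D v d \<Longrightarrow> gauge_le (\<beta> / (j + k)) D (\<lambda>r. u r * v r) (K * (c * d))"
    using mult by blast
  show ?thesis
  proof (rule that[OF K(1)])
    fix h assume h: "0 < h" "2 * h \<le> T"
    have hT: "h \<le> T" using h by simp
    \<comment> \<open>Unlike in \<open>BO_mult\<close>, the second factor lives on the second half
      of [r, r + 2h]. Shifting by h leaves its gauge unchanged and moves its domain, which still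
      contains [0, T - 2h].\<close>
    have sub: "{0..T - 2 * h} \<subseteq> {0..T - h}" "{0..T - 2 * h} \<subseteq> {0 - h..T - h - h}" using h by auto
    have gA: "gauge_le (\<beta> / j) {0..T - 2 * h} (\<lambda>r. A r (r + h)) (w h)"
      by (rule gauge_le_subset[OF pos(1) w(3)[OF h(1) hT] sub(1)])
    have "gauge_le (\<beta> / k) {0 - h..T - h - h} (\<lambda>r. B (r + h) (r + h + h)) (v h)"
      by (rule gauge_le_shift[OF pos(2) v(3)[OF h(1) hT]])
    then have "gauge_le (\<beta> / k) {0..T - 2 * h} (\<lambda>r. B (r + h) (r + h + h)) (v h)"
      using sub(2) by (rule gauge_le_subset[OF pos(2)])
    then have gB: "gauge_le (\<beta> / k) {0..T - 2 * h} (\<lambda>r. B (r + h) (r + 2 * h)) (v h)"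
      by (metis (no_types, lifting) ext add.assoc mult_2)
    show "gauge_le (\<beta> / (j + k)) {0..T - 2 * h} (\<lambda>r. A r (r + h) * B (r + h) (r + 2 * h)) (K * (w h * v h))"
      by (rule K(2)[OF _ _ gA gB]) (use h in auto)
  qed
qed

text \<open>Sewing: iterating \<open>R\<^sub>s\<^sub>,\<^sub>t = R\<^sub>s\<^sub>,\<^sub>u + R\<^sub>u\<^sub>,\<^sub>t + \<dots>\<close> at midpoints; the triangle inequality must hold
  with constant one, since \<open>k\<alpha>\<close> may be arbitrarily close to one.\<close>

lemma BO_sewing:
  fixes R :: "real \<Rightarrow> real \<Rightarrow> 'v::real_normed_vector"
  assumes k: "0 < k" and ka: "1 < k * \<alpha>" and cont: "continuous_on (triangle2 T) (\<lambda>(s, t). R s t)"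
    and b: "1 < b" and C: "0 < C" and Rb: "\<And>s t. 0 \<le> s \<Longrightarrow> s \<le> t \<Longrightarrow> t \<le> T \<Longrightarrow> norm (R s t) \<le> C * (t - s) powr b"
    and w: "mono_on {0<..T} w" "\<And>h. 0 < h \<Longrightarrow> h \<le> T \<Longrightarrow> 0 < w h" "lq_seq q k (\<lambda>j. (2 ^ j) powr (k * \<alpha>) * w (T / 2 ^ j))"
    and dl: "\<And>h. 0 < h \<Longrightarrow> 2 * h \<le> T \<Longrightarrow> \<exists>D. gauge_le (\<beta> / k) {0..T - 2 * h} D (w h) \<and>
       (\<forall>r\<in>{0..T - 2 * h}. norm (R r (r + 2 * h) - R r (r + h) - R (r + h) (r + 2 * h)) \<le> D r)"
  shows "BO k (\<lambda>s t. norm (R s t))"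
proof -
  have bk: "0 < \<beta> / k" using beta k by simp
  obtain K where K: "0 < K" "\<And>D u v. D \<in> sets borel \<Longrightarrow> D \<subseteq> {0..T} \<Longrightarrow> 0 < v \<Longrightarrow> continuous_on D u \<Longrightarrow>
      (\<And>r. r \<in> D \<Longrightarrow> 0 \<le> u r \<and> u r \<le> v) \<Longrightarrow> gauge_le (\<beta> / k) D u (K * v)"
    using gauge_le_const[OF bk T] by blast
  obtain C0 where C0: "0 < C0" "\<And>h. 0 < h \<Longrightarrow> h \<le> T \<Longrightarrow> w h \<le> C0 * h powr (k * \<alpha>)"
    using lq_seq_imp_powr_bound[OF k w] by blast
  \<comment> \<open>Halving doubles the number of intervals and gains 2^(-k\<alpha>) on each;
    \<open>c\<close> is the net factor per level.\<close>
  define c where "c = 2 powr (1 - k * \<alpha>)"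
  have c: "0 < c" "c < 1" using ka by (auto simp: c_def powr_less_one)
  have pw: "(2 ^ i) powr a = (2 powr a) ^ i" for a :: real and i :: nat
    by (simp add: powr_powr powr_realpow[symmetric] mult.commute)
  \<comment> \<open>The total of the defects over all dyadic levels: the solution of S h = w h + 2 S
    (h / 2).\<close>
  define S where "S h = (\<Sum>i. 2 ^ i * w (h / 2 ^ i))" for h
  have term_bound: "2 ^ i * w (h / 2 ^ i) \<le> C0 * h powr (k * \<alpha>) * c ^ i" if h: "0 < h" "h \<le> T" for h i
  proof -
    have "2 ^ i * w (h / 2 ^ i) \<le> 2 ^ i * (C0 * (h / 2 ^ i) powr (k * \<alpha>))"
      using dyadic_bounds[OF h(1), of i] h by (intro mult_left_mono C0) auto
    also have "\<dots> = C0 * h powr (k * \<alpha>) * c ^ i"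
      using h by (simp add: powr_divide pw c_def powr_diff power_divide)
    finally show ?thesis .
  qed
  have term_pos: "0 < w (h / 2 ^ i)" if h: "0 < h" "h \<le> T" for h i
    using dyadic_bounds[OF h(1), of i] h by (intro w) auto
  have summ: "summable (\<lambda>i. 2 ^ i * w (h / 2 ^ i))" if h: "0 < h" "h \<le> T" for h
    by (rule summable_comparison_test'[where N = 0 and g = "\<lambda>i. C0 * h powr (k * \<alpha>) * c ^ i"])
       (use term_bound[OF h] term_pos[OF h] c in \<open>auto intro!: summable_mult summable_geometric simp: less_imp_le\<close>)
  have S_rec: "S h = w h + 2 * S (h / 2)" if h: "0 < h" "h \<le> T" for h
  proof -
    have "S h = (\<Sum>i. 2 ^ Suc i * w (h / 2 ^ Suc i)) + w h"
      unfolding S_def using suminf_split_head[OF summ[OF h]] by simp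
    also have "(\<Sum>i. 2 ^ Suc i * w (h / 2 ^ Suc i)) = (\<Sum>i. 2 * (2 ^ i * w (h / 2 / 2 ^ i)))"
      by (simp add: mult.assoc)
    also have "\<dots> = 2 * S (h / 2)" unfolding S_def using h by (intro suminf_mult summ) auto
    finally show ?thesis by simp
  qed
  have S_pos: "0 < S h" if h: "0 < h" "h \<le> T" for h
    unfolding S_def using term_pos[OF h] by (intro suminf_pos summ h) auto
  have S_bound: "S h \<le> C0 / (1 - c) * h powr (k * \<alpha>)" if h: "0 < h" "h \<le> T" for h
  proof -
    have "S h \<le> (\<Sum>i. C0 * h powr (k * \<alpha>) * c ^ i)"
      unfolding S_def using c by (intro suminf_le term_bound h summ summable_mult summable_geometric) auto
    also have "\<dots> = C0 / (1 - c) * h powr (k * \<alpha>)"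
      using c by (simp add: suminf_mult summable_geometric suminf_geometric)
    finally show ?thesis .
  qed
  have S_mono: "mono_on {0<..T} S"
  proof (rule mono_onI)
    fix h h' assume h: "h \<in> {0<..T}" "h' \<in> {0<..T}" "h \<le> h'"
    show "S h \<le> S h'"
      unfolding S_def
    proof (intro suminf_le summ mult_left_mono)
      fix i show "w (h / 2 ^ i) \<le> w (h' / 2 ^ i)"
        using h dyadic_bounds[of h i] dyadic_bounds[of h' i] by (intro mono_onD[OF w(1)] divide_right_mono) auto
    qed (use h in auto)
  qed
  define g where "g j = (2 ^ j) powr (k * \<alpha>) * S (T / 2 ^ j)" for j
  \<comment> \<open>After rescaling, the equation for \<open>S\<close> reads g j = w_j + c g (j +
    1), where w_j is the rescaled w (T / 2^j). So \<open>lq_seq_recursion\<close> transfers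
    summability from \<open>w\<close> to \<open>S\<close> for every exponent.\<close>
  have lqS: "lq_seq q k g"
  proof (rule lq_seq_recursion[OF q k w(3) _ _ _ c])
    fix j
    note Tj = dyadic_bounds[OF T, of j]
    show "0 \<le> (2 ^ j) powr (k * \<alpha>) * w (T / 2 ^ j)" using w(2)[OF Tj(1)] Tj(2) T by (simp add: less_imp_le)
    show "0 \<le> g j" using S_pos[OF Tj(1)] Tj(2) T by (simp add: g_def less_imp_le)
    have "g j \<le> (2 ^ j) powr (k * \<alpha>) * (C0 / (1 - c) * (T / 2 ^ j) powr (k * \<alpha>))"
      unfolding g_def using Tj T by (intro mult_left_mono S_bound) auto
    also have "\<dots> = C0 / (1 - c) * ((2 ^ j) powr (k * \<alpha>) * (T / 2 ^ j) powr (k * \<alpha>))" by simp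
    also have "\<dots> = C0 / (1 - c) * T powr (k * \<alpha>)" unfolding powr_dyadic by simp
    finally show "g j \<le> C0 / (1 - c) * T powr (k * \<alpha>)" .
    have "S (T / 2 ^ j) = w (T / 2 ^ j) + 2 * S (T / 2 ^ Suc j)"
      using S_rec[OF Tj(1)] Tj(2) T by (simp add: mult.commute)
    moreover have "c * (2 ^ Suc j) powr (k * \<alpha>) = 2 * (2 ^ j) powr (k * \<alpha>)"
      by (simp add: c_def powr_mult powr_diff)
    then have "c * g (Suc j) = 2 * (2 ^ j) powr (k * \<alpha>) * S (T / 2 ^ Suc j)"
      unfolding g_def by (metis mult.assoc)
    ultimately have "g j = (2 ^ j) powr (k * \<alpha>) * w (T / 2 ^ j) + c * g (Suc j)"
      unfolding g_def[of j] by (simp only: distrib_left mult.assoc mult.left_commute)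
    then show "g j \<le> (2 ^ j) powr (k * \<alpha>) * w (T / 2 ^ j) + c * g (Suc j)" by simp
  qed
  have lag: "continuous_on {a..d} (\<lambda>r. norm (R (r + l) (r + l')))" if "0 \<le> a + l" "l \<le> l'" "d + l' \<le> T" for a d l l'
    using that by (intro continuous_intros continuous_on_triangle2_compose[OF cont]) auto
  \<comment> \<open>After n halvings 2^n pieces remain, each bounded only by the pointwise estimate.
    Their total tends to 0 since b > 1.\<close>
  have iter: "gauge_le (\<beta> / k) {0..T - h} (\<lambda>r. norm (R r (r + h))) (S h + 2 ^ n * (K * (C * (h / 2 ^ n) powr b)))"
    if "0 < h" "h \<le> T" for h n
    using that
  proof (induction n arbitrary: h)
    case 0
    have "gauge_le (\<beta> / k) {0..T - h} (\<lambda>r. norm (R r (r + h))) (K * (C * h powr b))"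
    proof (rule K(2))
      fix r assume "r \<in> {0..T - h}"
      then show "0 \<le> norm (R r (r + h)) \<and> norm (R r (r + h)) \<le> C * h powr b"
        using Rb[of r "r + h"] 0 by simp
    qed (use 0 C lag[of 0 0 h "T - h"] in auto)
    then show ?case
      by (rule gauge_le_mono[OF bk]) (use 0 S_pos[OF 0] lag[of 0 0 h "T - h"] in auto)
  next
    case (Suc n)
    define l where "l = h / 2"
    have l: "0 < l" "2 * l = h" "l \<le> T" using Suc.prems by (auto simp: l_def)
    obtain D where D: "gauge_le (\<beta> / k) {0..T - h} D (w l)"
      "\<And>r. r \<in> {0..T - h} \<Longrightarrow> norm (R r (r + h) - R r (r + l) - R (r + l) (r + h)) \<le> D r"
      using dl[OF l(1)] l Suc.prems by auto
    let ?M = "S l + 2 ^ n * (K * (C * (l / 2 ^ n) powr b))"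
    note IH = Suc.IH[OF l(1,3)]
    have sub: "{0..T - h} \<subseteq> {0..T - l}" "{0..T - h} \<subseteq> {0 - l..T - l - l}" using l by auto
    have g1: "gauge_le (\<beta> / k) {0..T - h} (\<lambda>r. norm (R r (r + l))) ?M"
      by (rule gauge_le_mono[OF bk IH sub(1)]) (use l lag[of 0 0 l "T - h"] in auto)
    have eq: "r + l + l = r + h" for r using l by simp
    have "gauge_le (\<beta> / k) {0 - l..T - l - l} (\<lambda>r. norm (R (r + l) (r + h))) ?M"
      using gauge_le_shift[OF bk IH, of l] unfolding eq .
    then have "gauge_le (\<beta> / k) {0..T - h} (\<lambda>r. norm (R (r + l) (r + h))) ?M"
      by (rule gauge_le_mono[OF bk _ sub(2)]) (use l lag[of 0 l h "T - h"] in auto)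
    from gauge_le_add[OF bk _ D(1) gauge_le_add[OF bk _ g1 this]]
    have "gauge_le (\<beta> / k) {0..T - h} (\<lambda>r. D r + (norm (R r (r + l)) + norm (R (r + l) (r + h)))) (w l + (?M + ?M))"
      by simp
    then show ?case
    proof (rule gauge_le_mono[OF bk])
      have "w l \<le> w h" using l Suc.prems by (intro mono_onD[OF w(1)]) auto
      moreover have "S h = w h + 2 * S l" using S_rec[OF Suc.prems] by (simp add: l_def)
      moreover have "l / 2 ^ n = h / 2 ^ Suc n" by (simp add: l_def)
      ultimately show "w l + (?M + ?M) \<le> S h + 2 ^ Suc n * (K * (C * (h / 2 ^ Suc n) powr b))"
        by simp
      fix r assume r: "r \<in> {0..T - h}"
      show "norm (R r (r + h)) \<le> D r + (norm (R r (r + l)) + norm (R (r + l) (r + h)))"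
        using norm_diff2_le[OF D(2)[OF r]] by simp
    qed (use lag[of 0 0 h "T - h"] Suc.prems in auto)
  qed
  show ?thesis
  \<comment> \<open>The extra power leaves room for the remaining pieces after sufficiently many
    halvings. Their number depends on \<open>h\<close>, but the resulting modulus does not.\<close>
  proof (rule BO_I[where w = "\<lambda>h. S h + h powr (k * \<alpha> + 1)"])
    show "continuous_on (triangle2 T) (\<lambda>(s, t). norm (R s t))"
      using cont unfolding case_prod_unfold by (intro continuous_intros)
    show "mono_on {0<..T} (\<lambda>h. S h + h powr (k * \<alpha> + 1))"
      using S_mono ka by (auto simp: mono_on_def intro!: add_mono powr_mono2)
    have "lq_seq q k (\<lambda>j. g j + (2 ^ j) powr (k * \<alpha>) * (T / 2 ^ j) powr (k * \<alpha> + 1))"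
      using S_pos dyadic_bounds[OF T] by (intro lq_seq_add q k lqS lq_seq_powr) (auto simp: g_def less_imp_le)
    then show "lq_seq q k (\<lambda>j. (2 ^ j) powr (k * \<alpha>) * (S (T / 2 ^ j) + (T / 2 ^ j) powr (k * \<alpha> + 1)))"
      by (simp add: g_def distrib_left)
    fix h assume h: "0 < h" "h \<le> T"
    have "2 powr (1 - b) < 1" using b by (simp add: powr_less_one)
    then have "(\<lambda>n. K * C * h powr b * (2 powr (1 - b)) ^ n) \<longlonglongrightarrow> K * C * h powr b * 0"
      by (intro tendsto_mult_left LIMSEQ_realpow_zero) auto
    moreover have "0 < h powr (k * \<alpha> + 1)" using h by simp
    ultimately have "\<forall>\<^sub>F n in sequentially. K * C * h powr b * (2 powr (1 - b)) ^ n < h powr (k * \<alpha> + 1)"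
      by (simp add: order_tendstoD(2))
    then obtain n where n: "K * C * h powr b * (2 powr (1 - b)) ^ n < h powr (k * \<alpha> + 1)"
      by (auto simp: eventually_sequentially)
    have "2 ^ n * (K * (C * (h / 2 ^ n) powr b)) = K * C * h powr b * (2 powr (1 - b)) ^ n"
      using h by (simp add: powr_divide pw powr_diff power_divide)
    then have le: "2 ^ n * (K * (C * (h / 2 ^ n) powr b)) \<le> h powr (k * \<alpha> + 1)" using n by linarith
    show "gauge_le (\<beta> / k) {0..T - h} (\<lambda>r. norm (R r (r + h))) (S h + h powr (k * \<alpha> + 1))"
      using lag[of 0 0 h "T - h"] h by (intro gauge_le_mono[OF bk iter[OF h, of n] order_refl add_left_mono[OF le]]) auto
  qed simp
qed

end

section \<open>Almost flows\<close>

lemma powr_tendsto_0_at_right: "0 < a \<Longrightarrow> ((\<lambda>x::real. x powr a) \<longlongrightarrow> 0) (at_right 0)"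
  by (rule tendsto_zero_powrI[where b = a]) (auto intro!: tendsto_intros eventually_at_rightI[of 0 1])

lemma powr_half: "0 \<le> h \<Longrightarrow> (h / 2) powr b = h powr b * 2 powr (- b)" for h b :: real
  by (simp add: powr_divide powr_minus_divide)

lemma norm_triangle3: "norm (x + y + z) \<le> norm x + norm y + norm z" for x :: "'a::real_normed_vector"
  using norm_triangle_ineq[of "x + y" z] norm_triangle_ineq[of x y] by linarith

text \<open>\<open>Z\<close> abstracts the driver: it allows steps over grid times to be compared
  with the step over the times they converge to. \<open>flow_defect_lipschitz\<close> and
  \<open>flow_four_point\<close> concern pairs of solutions and are what uniqueness rests
  on.\<close>

locale almost_flow =
  fixes T a K :: real and \<mu> :: "real \<Rightarrow> real \<Rightarrow> 'e::euclidean_space \<Rightarrow> 'e"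
    and Z :: "real \<Rightarrow> real \<Rightarrow> 'z::real_normed_vector"
  assumes T: "0 < T" and a: "0 < a" "1 < 3 * a" and K: "0 < K"
    and flow_refl: "\<And>s y. 0 \<le> s \<Longrightarrow> s \<le> T \<Longrightarrow> \<mu> s s y = y"
    and flow_bound: "\<And>s t y. 0 \<le> s \<Longrightarrow> s \<le> t \<Longrightarrow> t \<le> T \<Longrightarrow> norm (\<mu> s t y - y) \<le> K * (t - s) powr a"
    and flow_lipschitz: "\<And>s t y z. 0 \<le> s \<Longrightarrow> s \<le> t \<Longrightarrow> t \<le> T \<Longrightarrow>
      norm ((\<mu> s t y - y) - (\<mu> s t z - z)) \<le> K * (t - s) powr a * norm (y - z)"
    and flow_four_point: "\<And>s t x x' z z'. 0 \<le> s \<Longrightarrow> s \<le> t \<Longrightarrow> t \<le> T \<Longrightarrow>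
      norm ((\<mu> s t x - x) - (\<mu> s t x' - x') - ((\<mu> s t z - z) - (\<mu> s t z' - z')))
        \<le> K * (t - s) powr a *
          (norm ((x - x') - (z - z')) + (norm (x - x') + norm (z - z')) * (norm (x - z) + norm (x' - z')))"
    and flow_defect: "\<And>s u t y. 0 \<le> s \<Longrightarrow> s \<le> u \<Longrightarrow> u \<le> t \<Longrightarrow> t \<le> T \<Longrightarrow>
      norm (\<mu> u t (\<mu> s u y) - \<mu> s t y) \<le> K * (t - s) powr (3 * a)"
    and flow_defect_lipschitz: "\<And>s u t y z. 0 \<le> s \<Longrightarrow> s \<le> u \<Longrightarrow> u \<le> t \<Longrightarrow> t \<le> T \<Longrightarrow>
      norm ((\<mu> u t (\<mu> s u y) - \<mu> s t y) - (\<mu> u t (\<mu> s u z) - \<mu> s t z))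
        \<le> K * (t - s) powr (3 * a) * norm (y - z)"
    and driver_cont: "continuous_on (triangle2 T) (\<lambda>(s, t). Z s t)"
    and flow_driver: "\<And>s t s' t' y. norm (\<mu> s t y - \<mu> s' t' y) \<le> K * norm (Z s t - Z s' t')"
begin

definition davie_solution :: "real \<Rightarrow> (real \<Rightarrow> 'e) \<Rightarrow> bool" where
  "davie_solution C Y \<longleftrightarrow>
     (\<forall>s t. 0 \<le> s \<longrightarrow> s \<le> t \<longrightarrow> t \<le> T \<longrightarrow> norm (Y t - \<mu> s t (Y s)) \<le> C * (t - s) powr (3 * a))"

lemma flow_lipschitz':
  assumes "0 \<le> s" "s \<le> t" "t \<le> T"
  shows "norm (\<mu> s t y - \<mu> s t z) \<le> (1 + K * (t - s) powr a) * norm (y - z)"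
proof -
  have "\<mu> s t y - \<mu> s t z = ((\<mu> s t y - y) - (\<mu> s t z - z)) + (y - z)" by simp
  then have "norm (\<mu> s t y - \<mu> s t z) \<le> norm ((\<mu> s t y - y) - (\<mu> s t z - z)) + norm (y - z)"
    by (metis norm_triangle_ineq)
  also have "\<dots> \<le> K * (t - s) powr a * norm (y - z) + norm (y - z)" using flow_lipschitz[OF assms] by simp
  finally show ?thesis by (simp add: algebra_simps)
qed

section \<open>Euler schemes on uniform grids\<close>

definition grid :: "nat \<Rightarrow> nat \<Rightarrow> real" where
  "grid N i = real i * T / real N"

fun euler :: "nat \<Rightarrow> 'e \<Rightarrow> nat \<Rightarrow> 'e" where
  "euler N y 0 = y"
| "euler N y (Suc i) = \<mu> (grid N i) (grid N (Suc i)) (euler N y i)"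

definition rest :: "nat \<Rightarrow> 'e \<Rightarrow> nat \<Rightarrow> nat \<Rightarrow> real" where
  "rest N y i j = norm (euler N y j - \<mu> (grid N i) (grid N j) (euler N y i))"

lemma grid_mono: "i \<le> j \<Longrightarrow> grid N i \<le> grid N j"
  using T by (simp add: grid_def divide_right_mono mult_right_mono)

lemma grid_nonneg: "0 \<le> grid N i"
  using T by (simp add: grid_def)

lemma grid_le: "i \<le> N \<Longrightarrow> grid N i \<le> T"
  using T by (cases "N = 0") (auto simp: grid_def divide_le_eq mult_right_mono)

lemma rest_small: "i \<le> N \<Longrightarrow> rest N y i i = 0" "Suc i \<le> N \<Longrightarrow> rest N y i (Suc i) = 0"
  by (auto simp: rest_def flow_refl grid_nonneg grid_le)

lemma rest_split:
  assumes "i \<le> m" "m \<le> j" "j \<le> N"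
  shows "rest N y i j \<le> rest N y m j + K * (grid N j - grid N i) powr (3 * a) +
    (1 + K * (grid N j - grid N i) powr a) * rest N y i m"
proof -
  let ?e = "euler N y" and ?p = "grid N"
  let ?x = "\<mu> (?p i) (?p m) (?e i)"
  note g = grid_nonneg[of N i] grid_mono[OF assms(1), of N] grid_mono[OF assms(2), of N] grid_le[OF assms(3)]
  have g0: "0 \<le> ?p m" using g by simp
  have "?e j - \<mu> (?p i) (?p j) (?e i) = (?e j - \<mu> (?p m) (?p j) (?e m)) +
      (\<mu> (?p m) (?p j) ?x - \<mu> (?p i) (?p j) (?e i)) + (\<mu> (?p m) (?p j) (?e m) - \<mu> (?p m) (?p j) ?x)" by simp
  then have "rest N y i j \<le> rest N y m j + norm (\<mu> (?p m) (?p j) ?x - \<mu> (?p i) (?p j) (?e i)) +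
      norm (\<mu> (?p m) (?p j) (?e m) - \<mu> (?p m) (?p j) ?x)"
    unfolding rest_def by (metis norm_triangle3)
  moreover have "norm (\<mu> (?p m) (?p j) ?x - \<mu> (?p i) (?p j) (?e i)) \<le> K * (?p j - ?p i) powr (3 * a)"
    by (rule flow_defect[OF g])
  moreover have "norm (\<mu> (?p m) (?p j) (?e m) - \<mu> (?p m) (?p j) ?x) \<le> (1 + K * (?p j - ?p m) powr a) * rest N y i m"
    using flow_lipschitz'[OF g0 g(3,4), of "?e m" ?x] by (simp add: rest_def)
  moreover have "\<dots> \<le> (1 + K * (?p j - ?p i) powr a) * rest N y i m"
    using g K a by (intro mult_right_mono add_left_mono mult_left_mono powr_mono2) (auto simp: rest_def)
  ultimately show ?thesis by linarith
qed

text \<open>The time midpoint need not be a grid point. The block is therefore cut into [i, m], the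
  single step [m, m + 1] and [m + 1, j]: the single step has no rest, and the other two are at most
  half as long. Two cuts cost two defects, hence 2 K.\<close>

lemma rest_halving:
  assumes ij: "i + 2 \<le> j" "j \<le> N" and L: "0 \<le> L"
    and IH: "\<And>i' j'. i' \<le> j' \<Longrightarrow> j' \<le> N \<Longrightarrow> j' - i' < j - i \<Longrightarrow> grid N j' - grid N i' \<le> (grid N j - grid N i) / 2 \<Longrightarrow>
       rest N y i' j' \<le> L * (grid N j' - grid N i') powr (3 * a)"
  shows "rest N y i j \<le> (2 powr (- (3 * a)) * (2 + K * (grid N j - grid N i) powr a) * L + 2 * K) *
    (grid N j - grid N i) powr (3 * a)"
proof -
  define m where "m = (i + j) div 2"
  have m: "i \<le> m" "Suc m \<le> j" "m \<le> j" "2 * m \<le> i + j" "i + j \<le> 2 * m + 1" using ij by (auto simp: m_def)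
  have N: "0 < N" using ij by simp
  let ?p = "grid N" and ?b = "3 * a"
  define h where "h = ?p j - ?p i"
  have h: "0 \<le> h" using grid_mono[of i j N] ij by (simp add: h_def)
  have "real (2 * m) \<le> real (i + j)" "real (i + j) \<le> real (2 * m + 1)" using m by (simp_all only: of_nat_le_iff)
  then have le: "?p m - ?p i \<le> h / 2" "?p j - ?p (Suc m) \<le> h / 2"
  proof -
    define g where "g = T / real N"
    have g: "0 \<le> g" "grid N k = real k * g" for k using T by (auto simp: g_def grid_def)
    have "2 * real m * g \<le> (real i + real j) * g" "(real i + real j) * g \<le> (2 * real m + 1) * g"
      using \<open>real (2 * m) \<le> _\<close> \<open>real (i + j) \<le> _\<close> g by (intro mult_right_mono; simp)+
    then have "2 * (real m * g) \<le> real i * g + real j * g" "real i * g + real j * g \<le> 2 * (real m * g) + g"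
      by (simp_all add: algebra_simps)
    moreover have "real (Suc m) * g = real m * g + g" by (simp add: distrib_right)
    moreover have "x - y \<le> (z - y) / 2 \<and> z - (x + g) \<le> (z - y) / 2"
      if "2 * x \<le> y + z" "y + z \<le> 2 * x + g" for x y z :: real
      using that g(1) by (auto simp: field_simps)
    ultimately have "real m * g - real i * g \<le> (real j * g - real i * g) / 2 \<and>
        real j * g - real (Suc m) * g \<le> (real j * g - real i * g) / 2"
      by metis
    then show "?p m - ?p i \<le> h / 2" "?p j - ?p (Suc m) \<le> h / 2"
      unfolding h_def g(2) by blast+
  qed
  have half: "L * (?p j' - ?p i') powr ?b \<le> L * (h powr ?b * 2 powr (- ?b))" if "i' \<le> j'" "?p j' - ?p i' \<le> h / 2" for i' j'
    unfolding powr_half[OF h, symmetric] using that grid_mono[OF that(1), of N] L a by (intro mult_left_mono powr_mono2) auto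
  have lt: "m - i < j - i" "j - Suc m < j - i" "m \<le> N" using m ij by arith+
  have r1: "rest N y i m \<le> L * (h powr ?b * 2 powr (- ?b))"
    by (rule order_trans[OF IH[OF m(1) lt(3,1) le(1)[unfolded h_def]] half[OF m(1) le(1)]])
  have r2: "rest N y (Suc m) j \<le> L * (h powr ?b * 2 powr (- ?b))"
    by (rule order_trans[OF IH[OF m(2) ij(2) lt(2) le(2)[unfolded h_def]] half[OF m(2) le(2)]])
  have "?p j - ?p m \<le> h" using grid_mono[OF m(1), of N] by (simp add: h_def)
  then have "K * (?p j - ?p m) powr ?b \<le> K * h powr ?b"
    using grid_mono[OF m(3), of N] K a by (intro mult_left_mono powr_mono2) auto
  then have r3: "rest N y m j \<le> L * (h powr ?b * 2 powr (- ?b)) + K * h powr ?b"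
    using rest_split[of m "Suc m" j N y] rest_small(2)[of m N y] m ij r2 by simp
  have "rest N y i j \<le> rest N y m j + K * h powr ?b + (1 + K * h powr a) * rest N y i m"
    unfolding h_def by (rule rest_split[OF m(1,3) ij(2)])
  also have "\<dots> \<le> (L * (h powr ?b * 2 powr (- ?b)) + K * h powr ?b) + K * h powr ?b +
      (1 + K * h powr a) * (L * (h powr ?b * 2 powr (- ?b)))"
    using r3 r1 K by (intro add_mono mult_left_mono) auto
  also have "\<dots> = (2 powr (- ?b) * (2 + K * h powr a) * L + 2 * K) * h powr ?b" by (simp add: algebra_simps)
  finally show ?thesis by (simp add: h_def)
qed

lemma rest_bound_local:
  obtains d L where "0 < d" "0 \<le> L" "\<And>N y i j. i \<le> j \<Longrightarrow> j \<le> N \<Longrightarrow> grid N j - grid N i \<le> d \<Longrightarrow>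
    rest N y i j \<le> L * (grid N j - grid N i) powr (3 * a)"
proof -
  let ?b = "3 * a"
  have "((\<lambda>d. 2 powr (- ?b) * (2 + K * d powr a)) \<longlongrightarrow> 2 powr (- ?b) * (2 + K * 0)) (at_right 0)"
    by (intro tendsto_intros powr_tendsto_0_at_right a)
  moreover have lt1: "2 powr (- ?b) * 2 < 1"
  proof -
    have "2 powr (- ?b) * 2 = 2 powr (1 - ?b)" by (simp add: powr_diff powr_minus_divide)
    then show ?thesis using a by (simp add: powr_less_one)
  qed
  ultimately have "\<forall>\<^sub>F d in at_right 0. 2 powr (- ?b) * (2 + K * d powr a) < 1"
    by (intro order_tendstoD(2)) auto
  then obtain d' where d': "0 < d'" "\<And>d. 0 < d \<Longrightarrow> d < d' \<Longrightarrow> 2 powr (- ?b) * (2 + K * d powr a) < 1"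
    unfolding eventually_at_right_field by blast
  define d where "d = d' / 2"
  have d: "0 < d" "2 powr (- ?b) * (2 + K * d powr a) < 1"
    using d'(1) d'(2)[of d] by (auto simp: d_def)
  define t where "t = 2 powr (- ?b) * (2 + K * d powr a)"
  \<comment> \<open>The fixed point of L = t L + 2 K, so the halving estimate reproduces the same
    constant.\<close>
  define L where "L = 2 * K / (1 - t)"
  have t: "0 \<le> t" "t < 1" using d K by (auto simp: t_def)
  have L: "0 \<le> L" "t * L + 2 * K = L" using t K by (auto simp: L_def field_simps)
  have "rest N y i j \<le> L * (grid N j - grid N i) powr ?b"
    if "i \<le> j" "j \<le> N" "grid N j - grid N i \<le> d" for N y i j
    using that
  proof (induction "j - i" arbitrary: i j rule: less_induct)
    case less
    show ?case
    proof (cases "i + 2 \<le> j")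
      case False
      then have "j = i \<or> j = Suc i" using less.prems by auto
      then have "rest N y i j = 0" using less.prems rest_small by auto
      then show ?thesis using L by simp
    next
      case True
      let ?h = "grid N j - grid N i"
      have h: "0 \<le> ?h" using grid_mono[of i j N] less.prems by simp
      have "rest N y i j \<le> (2 powr (- ?b) * (2 + K * ?h powr a) * L + 2 * K) * ?h powr ?b"
      proof (rule rest_halving[OF True less.prems(2) L(1)])
        fix i' j' assume "i' \<le> j'" "j' \<le> N" "j' - i' < j - i" "grid N j' - grid N i' \<le> ?h / 2"
        then show "rest N y i' j' \<le> L * (grid N j' - grid N i') powr ?b"
          using less.prems h by (intro less.hyps) auto
      qed
      also have "\<dots> \<le> (t * L + 2 * K) * ?h powr ?b"
        unfolding t_def using less.prems h L K a
        by (intro mult_right_mono add_right_mono mult_left_mono add_left_mono powr_mono2) auto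
      finally show ?thesis using L by simp
    qed
  qed
  then show ?thesis using that[OF d(1) L(1)] by blast
qed

text \<open>Each doubling of the admissible length uses \<open>rest_halving\<close> once and worsens
  the constant. Finitely many doublings reach \<open>T\<close>, and their number depends neither on
  the grid nor on the starting point.\<close>

lemma rest_bound:
  obtains L where "0 \<le> L" "\<And>N y i j. i \<le> j \<Longrightarrow> j \<le> N \<Longrightarrow>
    rest N y i j \<le> L * (grid N j - grid N i) powr (3 * a)"
proof -
  let ?b = "3 * a"
  obtain d L0 where d: "0 < d" and L0: "0 \<le> L0" "\<And>N y i j. i \<le> j \<Longrightarrow> j \<le> N \<Longrightarrow> grid N j - grid N i \<le> d \<Longrightarrow>
    rest N y i j \<le> L0 * (grid N j - grid N i) powr ?b"
    using rest_bound_local by blast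
  have "\<exists>L\<ge>0. \<forall>N y i j. i \<le> j \<longrightarrow> j \<le> N \<longrightarrow> grid N j - grid N i \<le> 2 ^ n * d \<longrightarrow>
    rest N y i j \<le> L * (grid N j - grid N i) powr ?b" for n :: nat
  proof (induction n)
    case 0
    then show ?case using L0 by (intro exI[of _ L0]) auto
  next
    case (Suc n)
    then obtain L where L: "0 \<le> L" "\<And>N y i j. i \<le> j \<Longrightarrow> j \<le> N \<Longrightarrow> grid N j - grid N i \<le> 2 ^ n * d \<Longrightarrow>
      rest N y i j \<le> L * (grid N j - grid N i) powr ?b" by blast
    define L' where "L' = 2 powr (- ?b) * (2 + K * T powr a) * L + 2 * K"
    have L': "0 \<le> L'" using L K by (simp add: L'_def)
    have "rest N y i j \<le> L' * (grid N j - grid N i) powr ?b"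
      if ij: "i \<le> j" "j \<le> N" "grid N j - grid N i \<le> 2 ^ Suc n * d" for N y i j
    proof (cases "i + 2 \<le> j")
      case False
      then have "j = i \<or> j = Suc i" using ij by auto
      then have "rest N y i j = 0" using ij rest_small by auto
      then show ?thesis using L' by simp
    next
      case True
      let ?h = "grid N j - grid N i"
      have h: "0 \<le> ?h" "?h \<le> T" using grid_mono[of i j N] grid_le[of j N] grid_nonneg[of N i] ij by auto
      have "rest N y i j \<le> (2 powr (- ?b) * (2 + K * ?h powr a) * L + 2 * K) * ?h powr ?b"
        by (rule rest_halving[OF True ij(2) L(1)]) (use ij in \<open>auto intro!: L(2)\<close>)
      also have "\<dots> \<le> L' * ?h powr ?b"
        unfolding L'_def using h L K a
        by (intro mult_right_mono add_right_mono mult_left_mono add_left_mono powr_mono2) auto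
      finally show ?thesis .
    qed
    then show ?case using L' by blast
  qed
  moreover obtain n :: nat where n: "T / d < 2 ^ n" using real_arch_pow[of 2] by auto
  ultimately obtain L where L: "0 \<le> L" "\<And>N y i j. i \<le> j \<Longrightarrow> j \<le> N \<Longrightarrow> grid N j - grid N i \<le> 2 ^ n * d \<Longrightarrow>
      rest N y i j \<le> L * (grid N j - grid N i) powr ?b" by blast
  show ?thesis
  proof (rule that[OF L(1)])
    fix N y i j assume ij: "i \<le> j" "j \<le> (N::nat)"
    have "grid N j - grid N i \<le> T" using grid_le[OF ij(2)] grid_nonneg[of N i] by simp
    also have "T \<le> 2 ^ n * d" using n d by (simp add: field_simps)
    finally show "rest N y i j \<le> L * (grid N j - grid N i) powr ?b" by (rule L(2)[OF ij])
  qed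
qed

text \<open>Rounds down to the grid. \<open>min\<close> and \<open>nat\<close> keep the index in
  0..N for every real t, so the Euler paths are bounded functions on the whole line, as compactness
  of the product space demands.\<close>

definition index :: "nat \<Rightarrow> real \<Rightarrow> nat" where
  "index N t = min N (nat \<lfloor>t * real N / T\<rfloor>)"

lemma grid_index_tendsto:
  assumes t: "0 \<le> t" "t \<le> T"
  shows "(\<lambda>N. grid N (index N t)) \<longlonglongrightarrow> t"
proof (rule tendsto_sandwich)
  have ind: "real (index N t) = of_int \<lfloor>t * real N / T\<rfloor>" for N
  proof -
    have f: "0 \<le> \<lfloor>t * real N / T\<rfloor>" using t T by simp
    have "t * real N / T \<le> real N" using t T by (simp add: field_simps mult_right_mono)
    then have "\<lfloor>t * real N / T\<rfloor> \<le> int N" by linarith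
    then have "nat \<lfloor>t * real N / T\<rfloor> \<le> N" by linarith
    then have "index N t = nat \<lfloor>t * real N / T\<rfloor>" by (simp add: index_def)
    then show ?thesis using f by simp
  qed
  have up: "grid N (index N t) \<le> t" and lo: "t - T / real N \<le> grid N (index N t)" if "0 < N" for N
  proof -
    have "real (index N t) \<le> t * real N / T" unfolding ind by simp
    then show "grid N (index N t) \<le> t" using that T by (simp add: grid_def field_simps)
    have "t * real N / T - 1 \<le> real (index N t)" unfolding ind by linarith
    then have "(t * real N / T - 1) * (T / real N) \<le> real (index N t) * (T / real N)"
      using that T by (intro mult_right_mono) auto
    moreover have "(t * real N / T - 1) * (T / real N) = t - T / real N" using that T by (simp add: field_simps)
    ultimately show "t - T / real N \<le> grid N (index N t)" by (simp add: grid_def)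
  qed
  show "\<forall>\<^sub>F N in sequentially. grid N (index N t) \<le> t"
    using eventually_gt_at_top[of 0] by eventually_elim (rule up)
  show "\<forall>\<^sub>F N in sequentially. t - T / real N \<le> grid N (index N t)"
    using eventually_gt_at_top[of 0] by eventually_elim (rule lo)
  have "(\<lambda>N. T / real N) \<longlonglongrightarrow> 0" by (rule lim_const_over_n)
  then show "(\<lambda>N. t - T / real N) \<longlonglongrightarrow> t" by (auto intro: tendsto_eq_intros)
qed auto

lemma index_mono: "s \<le> t \<Longrightarrow> index N s \<le> index N t"
  unfolding index_def using T
  by (intro min.mono nat_mono floor_mono divide_right_mono mult_right_mono) auto

lemma index_le: "index N t \<le> N"
  by (simp add: index_def)

text \<open>A cluster point of the Euler schemes in the topology of pointwise convergence.\<close>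

lemma davie_solution_exists:
  obtains Y C where "Y 0 = y" "davie_solution C Y"
proof -
  let ?b = "3 * a"
  obtain L where L: "0 \<le> L" "\<And>N y i j. i \<le> j \<Longrightarrow> j \<le> N \<Longrightarrow>
    rest N y i j \<le> L * (grid N j - grid N i) powr ?b"
    using rest_bound by blast
  define B where "B = L * T powr ?b + K * T powr a"
  define E where "E N t = euler N y (index N t)" for N t
  have EB: "E N t \<in> cball y B" for N t
  proof -
    let ?i = "index N t"
    have i: "grid N 0 = 0" "0 \<le> grid N ?i" "grid N ?i \<le> T"
      using index_le grid_le grid_nonneg by (auto simp: grid_def)
    have "rest N y 0 ?i \<le> L * grid N ?i powr ?b" using L(2)[of 0 ?i N y] index_le i by simp
    also have "\<dots> \<le> L * T powr ?b" using i a L by (intro mult_left_mono powr_mono2) auto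
    finally have 1: "norm (E N t - \<mu> 0 (grid N ?i) y) \<le> L * T powr ?b" by (simp add: rest_def E_def i)
    have "norm (\<mu> 0 (grid N ?i) y - y) \<le> K * (grid N ?i - 0) powr a" using i by (intro flow_bound) auto
    also have "\<dots> \<le> K * T powr a" using i a K by (intro mult_left_mono powr_mono2) auto
    finally have "norm (\<mu> 0 (grid N ?i) y - y) \<le> K * T powr a" .
    with 1 have "norm (E N t - y) \<le> B"
      using norm_triangle_ineq[of "E N t - \<mu> 0 (grid N ?i) y" "\<mu> 0 (grid N ?i) y - y"] by (simp add: B_def)
    then show ?thesis by (simp add: dist_norm norm_minus_commute)
  qed
  define U where "U = PiE (UNIV :: real set) (\<lambda>_. cball y B)"
  have "compactin (product_topology (\<lambda>_. euclidean) UNIV) U"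
    unfolding U_def by (subst compactin_PiE) auto
  then have "compact U" by (simp add: euclidean_product_topology)
  moreover have "\<forall>\<^sub>F f in filtermap E sequentially. f \<in> U"
    using EB by (simp add: eventually_filtermap U_def PiE_def)
  moreover have "filtermap E sequentially \<noteq> bot" by (simp add: filtermap_bot_iff)
  ultimately obtain Y where Y: "inf (nhds Y) (filtermap E sequentially) \<noteq> bot"
    unfolding compact_filter by blast
  \<comment> \<open>A product over uncountably many times need not be sequentially compact. Instead
    of a subsequence, limits are taken along this filter, which refines both the neighbourhoods of
    \<open>Y\<close> and the sequence of schemes.\<close>
  define G where "G = inf (nhds Y) (filtermap E sequentially)"
  have G: "G \<noteq> bot" "G \<le> nhds Y" using Y by (auto simp: G_def)
  have ev: "\<forall>\<^sub>F f in G. P f" if "\<forall>\<^sub>F N in sequentially. P (E N)" for P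
  proof (rule filter_leD[of G "filtermap E sequentially"])
    show "G \<le> filtermap E sequentially" by (simp add: G_def)
  qed (use that in \<open>simp add: eventually_filtermap\<close>)
  have lim: "((\<lambda>f. f t) \<longlongrightarrow> Y t) G" for t
  proof -
    have "continuous_on UNIV (\<lambda>f :: real \<Rightarrow> 'e. f t)" by (rule continuous_on_product_coordinates)
    then have "((\<lambda>f. f t) \<longlongrightarrow> Y t) (nhds Y)"
      unfolding continuous_on_def
      by (simp add: tendsto_at_iff_tendsto_nhds[of "\<lambda>f. f t"])
    then show ?thesis by (rule tendsto_mono[OF G(2)])
  qed
  show ?thesis
  proof (rule that)
    have "\<forall>\<^sub>F f in G. f 0 = y" by (rule ev) (simp add: E_def index_def)
    then have "((\<lambda>f. f 0) \<longlongrightarrow> y) G" by (rule tendsto_eventually)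
    then show "Y 0 = y" using tendsto_unique[OF G(1) lim] by blast
    show "davie_solution L Y"
      unfolding davie_solution_def
    proof (intro allI impI)
      fix s t :: real assume st: "0 \<le> s" "s \<le> t" "t \<le> T"
      show "norm (Y t - \<mu> s t (Y s)) \<le> L * (t - s) powr ?b"
      proof (rule field_le_epsilon)
        fix e :: real assume e: "0 < e"
        let ?s = "\<lambda>N. grid N (index N s)" and ?t = "\<lambda>N. grid N (index N t)"
        have lims: "?s \<longlonglongrightarrow> s" "?t \<longlonglongrightarrow> t" using st by (auto intro: grid_index_tendsto)
        \<comment> \<open>The scheme satisfies the estimate only between grid times. Continuity of
          the driver lets the step between ?s N and ?t N be replaced by the step from s to
          t.\<close>
        have "(\<lambda>N. (\<lambda>(s, t). Z s t) (?s N, ?t N)) \<longlonglongrightarrow> (\<lambda>(s, t). Z s t) (s, t)"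
        proof (rule continuous_on_tendsto_compose[OF driver_cont])
          show "(\<lambda>N. (?s N, ?t N)) \<longlonglongrightarrow> (s, t)" by (intro tendsto_intros lims)
          show "\<forall>\<^sub>F N in sequentially. (?s N, ?t N) \<in> triangle2 T"
            using index_le grid_nonneg grid_le grid_mono[OF index_mono[OF st(2)]]
            by (intro always_eventually) (simp add: triangle2_def)
        qed (use st in \<open>simp add: triangle2_def\<close>)
        then have "(\<lambda>N. L * (?t N - ?s N) powr ?b + K * norm (Z (?s N) (?t N) - Z s t)) \<longlonglongrightarrow>
            L * (t - s) powr ?b + K * norm (Z s t - Z s t)"
          using a st grid_mono[OF index_mono[OF st(2)]]
          by (intro tendsto_intros lims tendsto_powr') (auto intro!: always_eventually)
        then have "\<forall>\<^sub>F N in sequentially. L * (?t N - ?s N) powr ?b + K * norm (Z (?s N) (?t N) - Z s t)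
            < L * (t - s) powr ?b + e"
          using e by (intro order_tendstoD(2)) auto
        then have "\<forall>\<^sub>F N in sequentially. norm (E N t - \<mu> s t (E N s)) \<le> L * (t - s) powr ?b + e"
        proof eventually_elim
          case (elim N)
          have "norm (E N t - \<mu> (?s N) (?t N) (E N s)) \<le> L * (?t N - ?s N) powr ?b"
            using L(2)[OF index_mono[OF st(2)] index_le, of N y] by (simp add: rest_def E_def)
          moreover have "norm (\<mu> (?s N) (?t N) (E N s) - \<mu> s t (E N s)) \<le> K * norm (Z (?s N) (?t N) - Z s t)"
            by (rule flow_driver)
          ultimately show ?case
            using elim norm_triangle_ineq[of "E N t - \<mu> (?s N) (?t N) (E N s)" "\<mu> (?s N) (?t N) (E N s) - \<mu> s t (E N s)"]
            by simp
        qed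
        then have evG: "\<forall>\<^sub>F f in G. norm (f t - \<mu> s t (f s)) \<le> L * (t - s) powr ?b + e" by (rule ev)
        have "((\<lambda>f. \<mu> s t (f s)) \<longlongrightarrow> \<mu> s t (Y s)) G"
        proof (rule LIM_zero_cancel, rule Lim_null_comparison)
          show "\<forall>\<^sub>F f in G. norm (\<mu> s t (f s) - \<mu> s t (Y s)) \<le> (1 + K * (t - s) powr a) * norm (f s - Y s)"
            by (intro always_eventually allI flow_lipschitz'[OF st])
          show "((\<lambda>f. (1 + K * (t - s) powr a) * norm (f s - Y s)) \<longlongrightarrow> 0) G"
            by (intro tendsto_mult_right_zero tendsto_norm_zero) (use lim[of s] in \<open>simp add: LIM_zero\<close>)
        qed
        then have "((\<lambda>f. norm (f t - \<mu> s t (f s))) \<longlongrightarrow> norm (Y t - \<mu> s t (Y s))) G"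
          by (intro tendsto_intros lim)
        then show "norm (Y t - \<mu> s t (Y s)) \<le> L * (t - s) powr ?b + e"
          by (rule tendsto_upperbound[OF _ evG G(1)])
      qed
    qed
  qed
qed

text \<open>The quantity contracted is the difference \<Delta> of the two remainders. Halving turns
  a bound m |t - s|^(3a) into \<theta> m |t - s|^(3a): the two halves contribute 2 * 2^(-3a) < 1,
  and everything else carries a positive power of the interval length. Iterating from m = 2C forces
  \<Delta> = 0.\<close>

lemma davie_solutions_agree_locally:
  assumes Y: "davie_solution C Y" and V: "davie_solution C V" and C: "0 \<le> C"
  obtains \<eta> where "0 < \<eta>" "\<And>\<sigma> t. 0 \<le> \<sigma> \<Longrightarrow> Y \<sigma> = V \<sigma> \<Longrightarrow> \<sigma> \<le> t \<Longrightarrow> t \<le> \<sigma> + \<eta> \<Longrightarrow> t \<le> T \<Longrightarrow> Y t = V t"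
proof -
  let ?b = "3 * a"
  define c where "c = 2 powr (- ?b)"
  have c: "0 < c" "c \<le> 1" "2 * c < 1"
  proof -
    have "2 * c = 2 powr (1 - ?b)" by (simp add: c_def powr_diff powr_minus_divide)
    then show "2 * c < 1" using a by (simp add: powr_less_one)
    then show "0 < c" "c \<le> 1" by (auto simp: c_def)
  qed
  \<comment> \<open>2C bounds the two remainders on [s, u], and 2 + K T^a the distances of the two
    solutions and of their one-step images, in units of \<open>M\<close>.\<close>
  define D where "D = 2 * C * (2 + K * T powr a)"
  have D: "0 \<le> D" using C K by (simp add: D_def)
  define \<theta> where "\<theta> e = c * (2 + K * e powr a) + (K + K * e powr a * D) * e powr ?b" for e
  have "((\<lambda>e. c * (2 + K * e powr a) + (K + K * e powr a * D) * e powr ?b) \<longlongrightarrow>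
      c * (2 + K * 0) + (K + K * 0 * D) * 0) (at_right 0)"
    using a by (intro tendsto_intros powr_tendsto_0_at_right) auto
  then have "\<forall>\<^sub>F e in at_right 0. \<theta> e < 1"
    unfolding \<theta>_def by (rule order_tendstoD(2)) (use c in simp)
  then obtain e' where e': "0 < e'" "\<And>e. 0 < e \<Longrightarrow> e < e' \<Longrightarrow> \<theta> e < 1"
    unfolding eventually_at_right_field by blast
  define \<eta> where "\<eta> = e' / 2"
  have eta: "0 < \<eta>" "\<theta> \<eta> < 1" using e' by (auto simp: \<eta>_def)
  have th0: "0 \<le> \<theta> \<eta>" using K D c by (simp add: \<theta>_def)
  show ?thesis
  proof (rule that[OF eta(1)])
    fix \<sigma> t0 assume sg: "0 \<le> \<sigma>" "Y \<sigma> = V \<sigma>" and t0: "\<sigma> \<le> t0" "t0 \<le> \<sigma> + \<eta>" "t0 \<le> T"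
    define \<Delta> where "\<Delta> s t = (Y t - \<mu> s t (Y s)) - (V t - \<mu> s t (V s))" for s t
    define J where "J s t \<longleftrightarrow> \<sigma> \<le> s \<and> s \<le> t \<and> t \<le> \<sigma> + \<eta> \<and> t \<le> T" for s t
    have YJ: "norm (Y t - \<mu> s t (Y s)) \<le> C * (t - s) powr ?b" "norm (V t - \<mu> s t (V s)) \<le> C * (t - s) powr ?b"
      if "J s t" for s t
      using Y V that sg by (auto simp: davie_solution_def J_def)
    have step: "norm (\<Delta> s t) \<le> \<theta> \<eta> * m * (t - s) powr ?b"
      if m: "0 \<le> m" "\<And>s t. J s t \<Longrightarrow> norm (\<Delta> s t) \<le> m * (t - s) powr ?b" and J: "J s t" for m s t
    proof -
      have st: "0 \<le> s" "s \<le> t" "t \<le> T" "t - s \<le> \<eta>" using J sg by (auto simp: J_def)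
      define h where "h = t - s"
      define u where "u = s + h / 2"
      have h: "0 \<le> h" "h \<le> \<eta>" "h \<le> T" using st by (auto simp: h_def)
      have u: "s \<le> u" "u \<le> t" "u - s = h / 2" "t - u = h / 2" "0 \<le> u" "u \<le> T"
        using st h by (auto simp: u_def h_def field_simps)
      have Ju: "J s u" "J u t" "J \<sigma> s" "J \<sigma> u" using J u by (auto simp: J_def)
      define M where "M = m * \<eta> powr ?b"
      have M: "0 \<le> M" using m by (simp add: M_def)
      \<comment> \<open>Since both paths agree at \<sigma>, the flow terms in \<Delta> \<sigma> r
        cancel. This closes the loop from remainders back to the paths.\<close>
      have Dt: "norm (Y r - V r) \<le> M" if "J \<sigma> r" for r
      proof -
        have "Y r - V r = \<Delta> \<sigma> r" using sg by (simp add: \<Delta>_def)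
        then have "norm (Y r - V r) \<le> m * (r - \<sigma>) powr ?b" using m(2)[OF that] by simp
        also have "\<dots> \<le> M" unfolding M_def using that m a by (intro mult_left_mono powr_mono2) (auto simp: J_def)
        finally show ?thesis .
      qed
      let ?x = "\<mu> s u (Y s)" and ?z = "\<mu> s u (V s)"
      let ?\<psi> = "\<lambda>x. \<mu> u t x - x"
      let ?\<Theta> = "\<lambda>y. \<mu> u t (\<mu> s u y) - \<mu> s t y"
      \<comment> \<open>Besides the two halves there remain the difference of the flow defects and
        the change of the increment over [u, t] when Y u is replaced by the step from s. The last
        one is a four-point difference.\<close>
      have eq: "\<Delta> s t = \<Delta> u t + \<Delta> s u + (?\<Theta> (Y s) - ?\<Theta> (V s)) +
          (?\<psi> (Y u) - ?\<psi> ?x - (?\<psi> (V u) - ?\<psi> ?z))"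
        by (simp add: \<Delta>_def)
      have hb: "(h / 2) powr ?b = h powr ?b * c" using powr_half[OF h(1)] by (simp add: c_def)
      have n1: "norm (\<Delta> u t) \<le> m * (h powr ?b * c)" "norm (\<Delta> s u) \<le> m * (h powr ?b * c)"
        using m(2)[OF Ju(2)] m(2)[OF Ju(1)] u hb by auto
      have n2: "norm (?\<Theta> (Y s) - ?\<Theta> (V s)) \<le> K * h powr ?b * M"
      proof -
        have "norm (?\<Theta> (Y s) - ?\<Theta> (V s)) \<le> K * (t - s) powr ?b * norm (Y s - V s)"
          by (rule flow_defect_lipschitz) (use st u in auto)
        also have "\<dots> \<le> K * h powr ?b * M"
          unfolding h_def[symmetric] using K Dt[OF Ju(3)] by (intro mult_left_mono) auto
        finally show ?thesis .
      qed
      have ha: "(h / 2) powr a \<le> \<eta> powr a" "(h / 2) powr a \<le> T powr a" using h a by (auto intro!: powr_mono2)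
      have xz: "norm (?x - ?z) \<le> (1 + K * T powr a) * M"
      proof -
        have "norm (?x - ?z) \<le> (1 + K * (u - s) powr a) * norm (Y s - V s)"
          by (rule flow_lipschitz') (use st u in auto)
        also have "\<dots> \<le> (1 + K * T powr a) * M"
          unfolding u(3) using K Dt[OF Ju(3)] ha by (intro mult_mono add_left_mono mult_left_mono) auto
        finally show ?thesis .
      qed
      have n3: "norm (?\<psi> (Y u) - ?\<psi> ?x - (?\<psi> (V u) - ?\<psi> ?z)) \<le>
          K * \<eta> powr a * (m * (h powr ?b * c) + h powr ?b * (D * M))"
      proof -
        have "norm (?\<psi> (Y u) - ?\<psi> ?x - (?\<psi> (V u) - ?\<psi> ?z)) \<le> K * (t - u) powr a *
            (norm ((Y u - ?x) - (V u - ?z)) + (norm (Y u - ?x) + norm (V u - ?z)) * (norm (Y u - V u) + norm (?x - ?z)))"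
          by (rule flow_four_point) (use st u in auto)
        also have "\<dots> \<le> K * \<eta> powr a * (m * (h powr ?b * c) +
            (C * (h powr ?b * c) + C * (h powr ?b * c)) * (M + (1 + K * T powr a) * M))"
        proof (intro mult_mono add_mono xz Dt Ju)
          show "norm ((Y u - ?x) - (V u - ?z)) \<le> m * (h powr ?b * c)"
            using n1(2) by (simp add: \<Delta>_def)
          show "norm (Y u - ?x) \<le> C * (h powr ?b * c)" "norm (V u - ?z) \<le> C * (h powr ?b * c)"
            using YJ[OF Ju(1)] u hb by auto
        qed (use K ha(1)[folded u(4)] M C c m(1) in auto)
        also have "(C * (h powr ?b * c) + C * (h powr ?b * c)) * (M + (1 + K * T powr a) * M) = h powr ?b * (c * (D * M))"
          by (simp add: D_def algebra_simps)
        also have "\<dots> \<le> h powr ?b * (1 * (D * M))" using c D M by (intro mult_left_mono mult_right_mono) auto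
        finally show ?thesis using K by (simp add: mult_left_mono)
      qed
      have "norm (\<Delta> s t) \<le> norm (\<Delta> u t + \<Delta> s u + (?\<Theta> (Y s) - ?\<Theta> (V s))) +
          norm (?\<psi> (Y u) - ?\<psi> ?x - (?\<psi> (V u) - ?\<psi> ?z))"
        unfolding eq by (rule norm_triangle_ineq)
      also have "\<dots> \<le> (m * (h powr ?b * c) + m * (h powr ?b * c) + K * h powr ?b * M) +
          K * \<eta> powr a * (m * (h powr ?b * c) + h powr ?b * (D * M))"
        using n1 n2 n3 norm_triangle3[of "\<Delta> u t" "\<Delta> s u" "?\<Theta> (Y s) - ?\<Theta> (V s)"] by linarith
      also have "\<dots> = \<theta> \<eta> * m * h powr ?b" by (simp add: \<theta>_def M_def algebra_simps)
      finally show ?thesis by (simp add: h_def)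
    qed
    have iter: "norm (\<Delta> s t) \<le> \<theta> \<eta> ^ n * (2 * C) * (t - s) powr ?b" if "J s t" for n s t
      using that
    proof (induction n arbitrary: s t)
      case 0
      have "norm (\<Delta> s t) \<le> norm (Y t - \<mu> s t (Y s)) + norm (V t - \<mu> s t (V s))"
        unfolding \<Delta>_def by (rule norm_triangle_ineq4)
      then show ?case using YJ[OF 0] by simp
    next
      case (Suc n)
      have "norm (\<Delta> s t) \<le> \<theta> \<eta> * (\<theta> \<eta> ^ n * (2 * C)) * (t - s) powr ?b"
        by (rule step) (use Suc th0 C in auto)
      then show ?case by (simp add: mult.assoc)
    qed
    have Jt: "J \<sigma> t0" using t0 by (simp add: J_def)
    have "(\<lambda>n. \<theta> \<eta> ^ n * (2 * C) * (t0 - \<sigma>) powr ?b) \<longlonglongrightarrow> 0 * (2 * C) * (t0 - \<sigma>) powr ?b"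
      using th0 eta by (intro tendsto_mult_right LIMSEQ_realpow_zero) auto
    then have "norm (\<Delta> \<sigma> t0) \<le> 0 * (2 * C) * (t0 - \<sigma>) powr ?b"
      by (rule tendsto_lowerbound) (use iter[OF Jt] in auto)
    then show "Y t0 = V t0" using sg by (simp add: \<Delta>_def)
  qed
qed

text \<open>The step \<eta> is the same for every starting time, so finitely many steps reach any
  t.\<close>

lemma davie_solution_unique:
  assumes Y: "davie_solution C Y" and V: "davie_solution C' V" and eq: "Y 0 = V 0" and t: "0 \<le> t" "t \<le> T"
  shows "Y t = V t"
proof -
  define B where "B = max 0 (max C C')"
  have B: "0 \<le> B" "C \<le> B" "C' \<le> B" by (auto simp: B_def)
  have "davie_solution B Y" "davie_solution B V"
    using Y V B unfolding davie_solution_def by (meson mult_right_mono order_trans powr_ge_zero)+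
  then obtain \<eta> where eta: "0 < \<eta>"
    "\<And>\<sigma> t. 0 \<le> \<sigma> \<Longrightarrow> Y \<sigma> = V \<sigma> \<Longrightarrow> \<sigma> \<le> t \<Longrightarrow> t \<le> \<sigma> + \<eta> \<Longrightarrow> t \<le> T \<Longrightarrow> Y t = V t"
    using davie_solutions_agree_locally[OF _ _ B(1)] by blast
  have "\<forall>t. 0 \<le> t \<and> t \<le> real n * \<eta> \<and> t \<le> T \<longrightarrow> Y t = V t" for n :: nat
  proof (induction n)
    case 0 then show ?case using eq by auto
  next
    case (Suc n)
    show ?case
    proof (intro allI impI)
      fix t assume t: "0 \<le> t \<and> t \<le> real (Suc n) * \<eta> \<and> t \<le> T"
      show "Y t = V t"
      proof (cases "t \<le> real n * \<eta>")
        case True then show ?thesis using Suc t by auto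
      next
        case False
        have "Y (real n * \<eta>) = V (real n * \<eta>)" using Suc False t eta by auto
        then show ?thesis using eta(2)[of "real n * \<eta>" t] False t eta(1) by (simp add: algebra_simps)
      qed
    qed
  qed
  moreover obtain n :: nat where "t / \<eta> \<le> real n" using real_arch_simple by blast
  then have "t \<le> real n * \<eta>" using eta by (simp add: field_simps)
  ultimately show ?thesis using t by blast
qed

end

section \<open>Bounded Lipschitz maps with the four-point property\<close>

text \<open>The second-difference estimate of a map with bounded Lipschitz derivative, stated
  without the derivative; in this form it passes to sums, products and bounded linear
  images.\<close>

definition C11_b :: "real \<Rightarrow> ('a::real_normed_vector \<Rightarrow> 'b::real_normed_vector) \<Rightarrow> bool" where
  "C11_b K \<phi> \<longleftrightarrow> (\<forall>y. norm (\<phi> y) \<le> K) \<and> (\<forall>x y. norm (\<phi> x - \<phi> y) \<le> K * norm (x - y)) \<and>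
     (\<forall>x x' z z'. norm ((\<phi> x - \<phi> x') - (\<phi> z - \<phi> z')) \<le>
        K * (norm ((x - x') - (z - z')) + (norm (x - x') + norm (z - z')) * (norm (x - z) + norm (x' - z'))))"

lemma C11_bD:
  assumes "C11_b K \<phi>"
  shows "norm (\<phi> y) \<le> K" "norm (\<phi> x - \<phi> y) \<le> K * norm (x - y)"
    "norm ((\<phi> x - \<phi> x') - (\<phi> z - \<phi> z')) \<le>
        K * (norm ((x - x') - (z - z')) + (norm (x - x') + norm (z - z')) * (norm (x - z) + norm (x' - z')))"
  using assms by (auto simp: C11_b_def)

lemma C11_b_nonneg: "C11_b K \<phi> \<Longrightarrow> 0 \<le> K"
  using C11_bD(1)[of K \<phi> undefined] norm_ge_zero[of "\<phi> undefined"] by linarith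

lemma C11_b_mono:
  assumes "C11_b K \<phi>" "K \<le> L" shows "C11_b L \<phi>"
  unfolding C11_b_def
  by (intro conjI allI order_trans[OF C11_bD(1)[OF assms(1)]] order_trans[OF C11_bD(2)[OF assms(1)]]
      order_trans[OF C11_bD(3)[OF assms(1)]] mult_right_mono assms(2) add_nonneg_nonneg mult_nonneg_nonneg norm_ge_zero)

lemma C11_b_add:
  assumes "C11_b K \<phi>" "C11_b L \<xi>" shows "C11_b (K + L) (\<lambda>y. \<phi> y + \<xi> y)"
proof -
  note a = C11_bD[OF assms(1)] and b = C11_bD[OF assms(2)]
  have 1: "norm ((\<phi> x + \<xi> x) - (\<phi> y + \<xi> y)) \<le> norm (\<phi> x - \<phi> y) + norm (\<xi> x - \<xi> y)" for x y
    using norm_triangle_ineq[of "\<phi> x - \<phi> y" "\<xi> x - \<xi> y"] by (simp add: algebra_simps)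
  have 2: "norm (((\<phi> x + \<xi> x) - (\<phi> x' + \<xi> x')) - ((\<phi> z + \<xi> z) - (\<phi> z' + \<xi> z'))) \<le>
     norm ((\<phi> x - \<phi> x') - (\<phi> z - \<phi> z')) + norm ((\<xi> x - \<xi> x') - (\<xi> z - \<xi> z'))" for x x' z z'
    using norm_triangle_ineq[of "(\<phi> x - \<phi> x') - (\<phi> z - \<phi> z')" "(\<xi> x - \<xi> x') - (\<xi> z - \<xi> z')"]
    by (simp add: algebra_simps)
  show ?thesis
    unfolding C11_b_def distrib_right[of K L]
    by (intro conjI allI order_trans[OF norm_triangle_ineq] order_trans[OF 1] order_trans[OF 2] add_mono a b)
qed

lemma C11_b_bounded_linear:
  assumes L: "bounded_linear L" and b: "\<And>x. norm (L x) \<le> C * norm x" and C: "0 \<le> C" and n: "C11_b K \<phi>"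
  shows "C11_b (C * K) (\<lambda>y. L (\<phi> y))"
proof -
  note D = C11_bD[OF n]
  note diff = linear_diff[OF bounded_linear.linear[OF L]]
  show ?thesis
    unfolding C11_b_def diff[symmetric] mult.assoc
    by (intro conjI allI; rule order_trans[OF b mult_left_mono[OF _ C]]; rule D)
qed

lemma (in bounded_bilinear) C11_b_left:
  assumes C: "\<And>a b. norm (prod a b) \<le> norm a * norm b * C" and n: "C11_b K \<phi>" and C0: "0 \<le> C"
  shows "C11_b (norm v * C * K) (\<lambda>y. prod (\<phi> y) v)"
  by (rule C11_b_bounded_linear[OF bounded_linear_left _ _ n]) (use C C0 in \<open>auto simp: mult_ac\<close>)

text \<open>A discrete Leibniz rule splits the second difference of a product into two terms with a
  second difference and two with first differences in both factors. Counting the mixed products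
  gives the constant 4.\<close>

lemma (in bounded_bilinear) C11_b_prod:
  assumes C: "\<And>a b. norm (prod a b) \<le> norm a * norm b * C" and C0: "0 \<le> C"
    and f: "C11_b K \<phi>" and g: "C11_b K \<xi>"
  shows "C11_b (4 * K * K * C) (\<lambda>y. prod (\<phi> y) (\<xi> y))"
proof -
  note F = C11_bD[OF f] and G = C11_bD[OF g]
  have K: "0 \<le> K" using f by (rule C11_b_nonneg)
  have le: "norm (prod a b) \<le> A * B * C" if "norm a \<le> A" "norm b \<le> B" for a b A B
  proof -
    have "0 \<le> A" "0 \<le> B" using that norm_ge_zero order_trans by blast+
    then have "norm a * norm b * C \<le> A * B * C" using that C0 by (intro mult_right_mono mult_mono) auto
    then show ?thesis using C[of a b] by linarith
  qed
  have KKC: "0 \<le> K * K * C" using K C0 by simp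
  show ?thesis
    unfolding C11_b_def
  proof (intro conjI allI)
    fix x y x' z z'
    show "norm (prod (\<phi> y) (\<xi> y)) \<le> 4 * K * K * C"
      using le[OF F(1)[of y] G(1)[of y]] KKC by linarith
    have "prod (\<phi> x) (\<xi> x) - prod (\<phi> y) (\<xi> y) = prod (\<phi> x - \<phi> y) (\<xi> x) + prod (\<phi> y) (\<xi> x - \<xi> y)"
      by (simp add: diff_left diff_right)
    then have "norm (prod (\<phi> x) (\<xi> x) - prod (\<phi> y) (\<xi> y)) \<le>
        norm (prod (\<phi> x - \<phi> y) (\<xi> x)) + norm (prod (\<phi> y) (\<xi> x - \<xi> y))"
      by (metis norm_triangle_ineq)
    also have "\<dots> \<le> K * norm (x - y) * K * C + K * (K * norm (x - y)) * C"
      by (intro add_mono le F G)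
    also have "\<dots> = 2 * (K * K * C * norm (x - y))" by simp
    also have "\<dots> \<le> 4 * (K * K * C * norm (x - y))" using KKC K C0 by (intro mult_right_mono mult_nonneg_nonneg) auto
    finally show "norm (prod (\<phi> x) (\<xi> x) - prod (\<phi> y) (\<xi> y)) \<le> 4 * K * K * C * norm (x - y)" by (simp add: mult.assoc)
    define p where "p = norm ((x - x') - (z - z'))"
    define r where "r = norm (x - x') + norm (z - z')"
    define s where "s = norm (x - z) + norm (x' - z')"
    have prs: "0 \<le> p" "0 \<le> r" "0 \<le> s" "norm (x - x') \<le> r" "norm (z - z') \<le> r" "norm (x - z) \<le> s" "norm (x' - z') \<le> s"
      by (auto simp: p_def r_def s_def)
    have Fl: "norm (\<phi> a - \<phi> b) \<le> K * c" and Gl: "norm (\<xi> a - \<xi> b) \<le> K * c" if "norm (a - b) \<le> c" for a b c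
      using F(2)[of a b] G(2)[of a b] mult_left_mono[OF that K] by linarith+
    have eq: "(prod (\<phi> x) (\<xi> x) - prod (\<phi> x') (\<xi> x')) - (prod (\<phi> z) (\<xi> z) - prod (\<phi> z') (\<xi> z')) =
        (prod ((\<phi> x - \<phi> x') - (\<phi> z - \<phi> z')) (\<xi> x) + prod (\<phi> z - \<phi> z') (\<xi> x - \<xi> z)) +
        (prod (\<phi> x') ((\<xi> x - \<xi> x') - (\<xi> z - \<xi> z')) + prod (\<phi> x' - \<phi> z') (\<xi> z - \<xi> z'))"
      by (simp add: diff_left diff_right add_left add_right algebra_simps)
    have "norm ((prod (\<phi> x) (\<xi> x) - prod (\<phi> x') (\<xi> x')) - (prod (\<phi> z) (\<xi> z) - prod (\<phi> z') (\<xi> z'))) \<le>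
        ((K * (p + r * s)) * K * C + (K * r) * (K * s) * C) + (K * (K * (p + r * s)) * C + (K * s) * (K * r) * C)"
      unfolding eq
      by (intro order_trans[OF norm_triangle_ineq] add_mono le F(1) G(1) F(3)[of x x' z z', folded p_def r_def s_def]
          G(3)[of x x' z z', folded p_def r_def s_def] Fl Gl prs)
    also have "\<dots> = K * K * C * (2 * p + 4 * (r * s))" by (simp add: algebra_simps)
    also have "\<dots> \<le> K * K * C * (4 * (p + r * s))" using KKC prs by (intro mult_left_mono) auto
    finally show "norm ((prod (\<phi> x) (\<xi> x) - prod (\<phi> x') (\<xi> x')) - (prod (\<phi> z) (\<xi> z) - prod (\<phi> z') (\<xi> z'))) \<le>
        4 * K * K * C * (norm ((x - x') - (z - z')) + (norm (x - x') + norm (z - z')) * (norm (x - z) + norm (x' - z')))"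
      by (simp add: p_def r_def s_def mult_ac)
  qed
qed

lemma onorm_blinfun_le: "norm A \<le> B \<Longrightarrow> onorm (blinfun_apply A) \<le> B"
  by (simp add: norm_blinfun.rep_eq)

text \<open>Mean value inequality for t -> \<phi> (P t) - \<phi> (P' t), where P runs from z to x
  and P' from z' to x'. Its derivative splits into D (P t) applied to the second difference of the
  points and (D (P t) - D (P' t)) applied to x' - z'.\<close>

lemma C11_b_if_derivative:
  fixes D :: "'a::real_normed_vector \<Rightarrow> 'a \<Rightarrow>\<^sub>L 'b::real_normed_vector"
  assumes d: "\<And>y. (\<phi> has_derivative blinfun_apply (D y)) (at y)" and b: "\<And>y. norm (\<phi> y) \<le> K"
    and D: "\<And>y. norm (D y) \<le> K" "\<And>x y. norm (D x - D y) \<le> K * norm (x - y)"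
  shows "C11_b K \<phi>"
proof -
  have K: "0 \<le> K" using b[of undefined] norm_ge_zero order_trans by blast
  show ?thesis
    unfolding C11_b_def
  proof (intro conjI allI)
    fix x y x' z z' :: 'a
    show "norm (\<phi> y) \<le> K" by (rule b)
    show "norm (\<phi> x - \<phi> y) \<le> K * norm (x - y)"
      by (rule differentiable_bound[of UNIV _ "\<lambda>y. blinfun_apply (D y)"]) (auto intro!: d onorm_blinfun_le D)
    define P P' where "P t = z + t *\<^sub>R (x - z)" and "P' t = z' + t *\<^sub>R (x' - z')" for t :: real
    let ?R = "norm ((x - x') - (z - z')) + (norm (x - x') + norm (z - z')) * (norm (x - z) + norm (x' - z'))"
    have der: "((\<lambda>t. \<phi> (P t) - \<phi> (P' t)) has_derivative
        (\<lambda>h. blinfun_apply (D (P t)) (h *\<^sub>R (x - z)) - blinfun_apply (D (P' t)) (h *\<^sub>R (x' - z')))) (at t within {0..1})" for t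
      unfolding P_def P'_def
      by (rule has_derivative_diff; rule has_derivative_compose[OF _ d]) (auto intro!: derivative_eq_intros)
    have "norm ((\<phi> (P 1) - \<phi> (P' 1)) - (\<phi> (P 0) - \<phi> (P' 0))) \<le> (K * ?R) * norm (1 - 0 :: real)"
    proof (rule differentiable_bound[of "{0..1::real}", OF _ der])
      fix t :: real assume t: "t \<in> {0..1}"
      show "onorm (\<lambda>h. blinfun_apply (D (P t)) (h *\<^sub>R (x - z)) - blinfun_apply (D (P' t)) (h *\<^sub>R (x' - z'))) \<le> K * ?R"
      proof (rule onorm_bound)
        fix h :: real
        have "P t - P' t = (1 - t) *\<^sub>R (z - z') + t *\<^sub>R (x - x')" by (simp add: P_def P'_def algebra_simps)
        then have "norm (P t - P' t) \<le> (1 - t) * norm (z - z') + t * norm (x - x')"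
          using t norm_triangle_ineq[of "(1 - t) *\<^sub>R (z - z')" "t *\<^sub>R (x - x')"] by simp
        also have "\<dots> \<le> 1 * norm (z - z') + 1 * norm (x - x')" using t by (intro add_mono mult_right_mono) auto
        finally have PP: "norm (P t - P' t) \<le> norm (x - x') + norm (z - z')" by simp
        have "blinfun_apply (D (P t)) (x - z) - blinfun_apply (D (P' t)) (x' - z') =
            blinfun_apply (D (P t)) ((x - x') - (z - z')) + blinfun_apply (D (P t) - D (P' t)) (x' - z')"
          by (simp add: blinfun.diff_left blinfun.diff_right)
        then have "norm (blinfun_apply (D (P t)) (x - z) - blinfun_apply (D (P' t)) (x' - z')) \<le>
            norm (blinfun_apply (D (P t)) ((x - x') - (z - z'))) + norm (blinfun_apply (D (P t) - D (P' t)) (x' - z'))"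
          by (metis norm_triangle_ineq)
        also have "\<dots> \<le> norm (D (P t)) * norm ((x - x') - (z - z')) + norm (D (P t) - D (P' t)) * norm (x' - z')"
          by (intro add_mono norm_blinfun)
        also have "\<dots> \<le> K * norm ((x - x') - (z - z')) +
            (K * (norm (x - x') + norm (z - z'))) * (norm (x - z) + norm (x' - z'))"
        proof (intro add_mono mult_mono D(1))
          show "norm (D (P t) - D (P' t)) \<le> K * (norm (x - x') + norm (z - z'))"
            using D(2)[of "P t" "P' t"] mult_left_mono[OF PP K] by linarith
        qed (use K in auto)
        also have "\<dots> = K * ?R" by (simp add: algebra_simps)
        finally have "norm (blinfun_apply (D (P t)) (x - z) - blinfun_apply (D (P' t)) (x' - z')) \<le> K * ?R" .
        then have "\<bar>h\<bar> * norm (blinfun_apply (D (P t)) (x - z) - blinfun_apply (D (P' t)) (x' - z')) \<le> \<bar>h\<bar> * (K * ?R)"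
          by (intro mult_left_mono) auto
        moreover have "blinfun_apply (D (P t)) (h *\<^sub>R (x - z)) - blinfun_apply (D (P' t)) (h *\<^sub>R (x' - z')) =
            h *\<^sub>R (blinfun_apply (D (P t)) (x - z) - blinfun_apply (D (P' t)) (x' - z'))"
          unfolding blinfun.scaleR_right by (rule scaleR_diff_right[symmetric])
        ultimately show "norm (blinfun_apply (D (P t)) (h *\<^sub>R (x - z)) - blinfun_apply (D (P' t)) (h *\<^sub>R (x' - z'))) \<le> K * ?R * norm h"
          by (simp add: mult.commute)
      qed (use K in simp)
    qed auto
    then show "norm ((\<phi> x - \<phi> x') - (\<phi> z - \<phi> z')) \<le> K * ?R" by (simp add: P_def P'_def)
  qed
qed

lemma taylor_bound:
  fixes D :: "'a::real_normed_vector \<Rightarrow> 'a \<Rightarrow>\<^sub>L 'b::real_normed_vector"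
  assumes d: "\<And>y. (\<phi> has_derivative blinfun_apply (D y)) (at y)"
    and D: "\<And>x y. norm (D x - D y) \<le> K * norm (x - y)" and K: "0 \<le> K"
  shows "norm (\<phi> (y + w) - \<phi> y - blinfun_apply (D y) w) \<le> K * norm w * norm w"
proof -
  have "norm (\<phi> (y + w) - \<phi> y - blinfun_apply (D y) ((y + w) - y)) \<le> norm ((y + w) - y) * (K * norm w)"
  proof (rule differentiable_bound_linearization[of _ _ "cball y (norm w)"])
    fix t :: real assume "t \<in> {0..1}"
    then show "y + t *\<^sub>R (y + w - y) \<in> cball y (norm w)"
      by (auto simp: dist_norm mult_left_le_one_le)
  next
    fix x assume x: "x \<in> cball y (norm w)"
    show "(\<phi> has_derivative blinfun_apply (D x)) (at x within cball y (norm w))"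
      by (rule has_derivative_at_withinI[OF d])
    have "norm (D x - D y) \<le> K * norm w"
      using D[of x y] x K by (auto simp: dist_norm norm_minus_commute intro: order_trans mult_left_mono)
    then have "onorm (blinfun_apply (D x - D y)) \<le> K * norm w" by (rule onorm_blinfun_le)
    then show "onorm (blinfun_apply (D x) - blinfun_apply (D y)) \<le> K * norm w"
      by (simp add: blinfun.diff_left[abs_def] fun_diff_def)
  qed simp
  then show ?thesis by (simp add: mult_ac)
qed

text \<open>Base point and increment are varied separately. For fixed w the derivative along t w is
  a double difference of D in which the second difference of the points vanishes; the two remaining
  factors are each doubled, hence 4 K. For a fixed base point y' the derivative in w is D (y' + w) -
  D y'.\<close>

lemma taylor_bound_lipschitz:
  fixes D :: "'a::real_normed_vector \<Rightarrow> 'a \<Rightarrow>\<^sub>L 'b::real_normed_vector"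
  assumes d: "\<And>y. (\<phi> has_derivative blinfun_apply (D y)) (at y)" and nD: "C11_b K D"
  shows "norm ((\<phi> (y + w) - \<phi> y - blinfun_apply (D y) w) - (\<phi> (y' + w') - \<phi> y' - blinfun_apply (D y') w')) \<le>
    4 * K * norm w * norm w * norm (y - y') + K * (norm w + norm w') * norm (w - w')"
proof -
  note D = C11_bD(2)[OF nD]
  have K: "0 \<le> K" using nD by (rule C11_b_nonneg)
  define G where "G y w = \<phi> (y + w) - \<phi> y - blinfun_apply (D y) w" for y w
  have 1: "norm (G y w - G y' w) \<le> 4 * K * norm w * norm w * norm (y - y')"
  proof -
    define k where "k t = (\<phi> (y + t *\<^sub>R w) - t *\<^sub>R blinfun_apply (D y) w) -
        (\<phi> (y' + t *\<^sub>R w) - t *\<^sub>R blinfun_apply (D y') w)" for t :: real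
    have "norm (k 1 - k 0) \<le> (4 * K * norm w * norm w * norm (y - y')) * norm (1 - 0 :: real)"
    proof (rule differentiable_bound[of "{0..1::real}"])
      fix t :: real assume t: "t \<in> {0..1}"
      show "(k has_derivative (\<lambda>h. (blinfun_apply (D (y + t *\<^sub>R w)) (h *\<^sub>R w) - h *\<^sub>R blinfun_apply (D y) w) -
          (blinfun_apply (D (y' + t *\<^sub>R w)) (h *\<^sub>R w) - h *\<^sub>R blinfun_apply (D y') w))) (at t within {0..1})"
        unfolding k_def
        by (intro has_derivative_diff has_derivative_compose[OF _ d]) (auto intro!: derivative_eq_intros)
      show "onorm (\<lambda>h. (blinfun_apply (D (y + t *\<^sub>R w)) (h *\<^sub>R w) - h *\<^sub>R blinfun_apply (D y) w) -
          (blinfun_apply (D (y' + t *\<^sub>R w)) (h *\<^sub>R w) - h *\<^sub>R blinfun_apply (D y') w)) \<le> 4 * K * norm w * norm w * norm (y - y')"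
      proof (rule onorm_bound)
        fix h :: real
        let ?E = "(D (y + t *\<^sub>R w) - D y) - (D (y' + t *\<^sub>R w) - D y')"
        have tw: "norm (t *\<^sub>R w) \<le> norm w" using t by (auto simp: mult_left_le_one_le)
        have "norm ?E \<le> K * ((norm (t *\<^sub>R w) + norm (t *\<^sub>R w)) * (norm (y - y') + norm (y - y')))"
          using C11_bD(3)[OF nD, of "y + t *\<^sub>R w" y "y' + t *\<^sub>R w" y'] by simp
        also have "\<dots> \<le> K * ((norm w + norm w) * (norm (y - y') + norm (y - y')))"
          using tw K by (intro mult_left_mono mult_right_mono add_mono) auto
        finally have E: "norm ?E \<le> 4 * K * norm w * norm (y - y')" by (simp add: algebra_simps)
        have "norm (blinfun_apply ?E (h *\<^sub>R w)) \<le> norm ?E * norm (h *\<^sub>R w)" by (rule norm_blinfun)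
        also have "\<dots> \<le> (4 * K * norm w * norm (y - y')) * norm (h *\<^sub>R w)" using E by (intro mult_right_mono) auto
        also have "blinfun_apply ?E (h *\<^sub>R w) = (blinfun_apply (D (y + t *\<^sub>R w)) (h *\<^sub>R w) - h *\<^sub>R blinfun_apply (D y) w) -
          (blinfun_apply (D (y' + t *\<^sub>R w)) (h *\<^sub>R w) - h *\<^sub>R blinfun_apply (D y') w)"
          by (simp add: blinfun.diff_left blinfun.add_left blinfun.scaleR_right algebra_simps)
        finally show "norm ((blinfun_apply (D (y + t *\<^sub>R w)) (h *\<^sub>R w) - h *\<^sub>R blinfun_apply (D y) w) -
          (blinfun_apply (D (y' + t *\<^sub>R w)) (h *\<^sub>R w) - h *\<^sub>R blinfun_apply (D y') w)) \<le>
          4 * K * norm w * norm w * norm (y - y') * norm h"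
          by (simp add: mult_ac)
      qed (use K in simp)
    qed auto
    then show ?thesis by (simp add: k_def G_def algebra_simps)
  qed
  have 2: "norm (G y' w - G y' w') \<le> (K * (norm w + norm w')) * norm (w - w')"
  proof (rule differentiable_bound[of "closed_segment w w'"])
    fix x assume x: "x \<in> closed_segment w w'"
    show "((\<lambda>w. G y' w) has_derivative blinfun_apply (D (y' + x) - D y')) (at x within closed_segment w w')"
      unfolding G_def blinfun.diff_left
      by (rule has_derivative_at_withinI)
        (auto intro!: derivative_eq_intros has_derivative_compose[OF _ d, of "\<lambda>w. y' + w"])
    have "norm x \<le> norm w + norm w'"
    proof -
      obtain t where t: "0 \<le> t" "t \<le> 1" "x = (1 - t) *\<^sub>R w + t *\<^sub>R w'"
        using x by (auto simp: closed_segment_def)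
      then have "norm x \<le> (1 - t) * norm w + t * norm w'"
        using norm_triangle_ineq[of "(1 - t) *\<^sub>R w" "t *\<^sub>R w'"] by simp
      also have "\<dots> \<le> 1 * norm w + 1 * norm w'" using t by (intro add_mono mult_right_mono) auto
      finally show ?thesis by simp
    qed
    then show "onorm (blinfun_apply (D (y' + x) - D y')) \<le> K * (norm w + norm w')"
      using D[of "y' + x" y'] K by (intro onorm_blinfun_le) (auto intro: order_trans mult_left_mono)
  qed auto
  have "G y w - G y' w' = (G y w - G y' w) + (G y' w - G y' w')" by simp
  then have "norm (G y w - G y' w') \<le> norm (G y w - G y' w) + norm (G y' w - G y' w')"
    by (metis norm_triangle_ineq)
  then show ?thesis using 1 2 by (simp add: G_def)
qed

section \<open>The second order Euler step of a rough differential equation\<close>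

definition blinfun_of_matrix_vector :: "real ^ 'n ^ 'm \<Rightarrow> (real ^ 'n) \<Rightarrow>\<^sub>L (real ^ 'm)" where
  "blinfun_of_matrix_vector M = Blinfun ((*v) M)"

lemma blinfun_of_matrix_vector_apply [simp]: "blinfun_apply (blinfun_of_matrix_vector M) v = M *v v"
  by (simp add: blinfun_of_matrix_vector_def bounded_linear_Blinfun_apply matrix_vector_mul_bounded_linear)

lemma bounded_bilinear_matrix_vector: "bounded_bilinear ((*v) :: real ^ 'n ^ 'm \<Rightarrow> real ^ 'n \<Rightarrow> real ^ 'm)"
proof -
  have "linear (\<lambda>M. M *v x)" for x :: "real ^ 'n"
    by (rule linearI) (simp_all add: matrix_vector_mult_add_rdistrib scaleR_matrix_vector_assoc)
  moreover have "linear ((*v) M)" for M :: "real ^ 'n ^ 'm"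
    by (rule linearI) (simp_all add: matrix_vector_right_distrib matrix_vector_mult_scaleR)
  ultimately have "bilinear ((*v) :: real ^ 'n ^ 'm \<Rightarrow> real ^ 'n \<Rightarrow> real ^ 'm)"
    unfolding bilinear_def by blast
  then show ?thesis by (simp add: bilinear_conv_bounded_bilinear)
qed

lemma matrix_vector_bound:
  obtains C where "0 < C" "\<And>(M :: real ^ 'n ^ 'm) v. norm (M *v v) \<le> norm M * norm v * C"
  using bounded_bilinear.pos_bounded[OF bounded_bilinear_matrix_vector] by blast

lemma linear_blinfun_of_matrix_vector: "linear (blinfun_of_matrix_vector :: real ^ 'n ^ 'm \<Rightarrow> _)"
  by (rule linearI; rule blinfun_eqI)
     (simp_all add: matrix_vector_mult_add_rdistrib blinfun.add_left blinfun.scaleR_left scaleR_matrix_vector_assoc)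

lemma norm_matrix_le: "norm M \<le> (\<Sum>i\<in>UNIV. norm (M $ i))" for M :: "real ^ 'n ^ 'm"
  by (simp add: norm_vec_def L2_set_le_sum)

lemma blinfun_matrix_act_bound:
  "\<exists>C>0. \<forall>(A :: (real ^ 'n) \<Rightarrow>\<^sub>L (real ^ 'n ^ 'm)) M. norm (blinfun_matrix_act A M) \<le> norm A * norm M * C"
proof -
  obtain C where C: "0 < C" "\<And>(M :: real ^ 'n ^ 'm) v. norm (M *v v) \<le> norm M * norm v * C"
    using matrix_vector_bound by blast
  show ?thesis
  proof (intro exI[of _ "C * real CARD('n)"] conjI allI)
    fix A :: "(real ^ 'n) \<Rightarrow>\<^sub>L (real ^ 'n ^ 'm)" and M :: "real ^ 'n ^ 'n"
    have "norm (blinfun_matrix_act A M) \<le> (\<Sum>i\<in>UNIV. norm (blinfun_apply A (axis i 1) *v (M $ i)))"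
      unfolding blinfun_matrix_act_def by (rule norm_sum)
    also have "\<dots> \<le> (\<Sum>i\<in>(UNIV :: 'n set). norm A * norm M * C)"
    proof (rule sum_mono)
      fix i :: 'n
      have "norm (blinfun_apply A (axis i 1)) \<le> norm A"
        using norm_blinfun[of A "axis i 1"] by simp
      then have "norm (blinfun_apply A (axis i 1)) * norm (M $ i) * C \<le> norm A * norm M * C"
        using C(1) by (intro mult_right_mono mult_mono) (auto simp: Finite_Cartesian_Product.norm_nth_le)
      then show "norm (blinfun_apply A (axis i 1) *v (M $ i)) \<le> norm A * norm M * C"
        using C(2)[of "blinfun_apply A (axis i 1)" "M $ i"] by linarith
    qed
    also have "\<dots> = norm A * norm M * (C * real CARD('n))" by simp
    finally show "norm (blinfun_matrix_act A M) \<le> norm A * norm M * (C * real CARD('n))" .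
  qed (use C in simp)
qed

lemma bounded_bilinear_blinfun_matrix_act:
  "bounded_bilinear (blinfun_matrix_act :: ((real ^ 'n) \<Rightarrow>\<^sub>L (real ^ 'n ^ 'm)) \<Rightarrow> real ^ 'n ^ 'n \<Rightarrow> real ^ 'm)"
proof (rule bounded_bilinear.intro)
  fix A B :: "(real ^ 'n) \<Rightarrow>\<^sub>L (real ^ 'n ^ 'm)" and M N :: "real ^ 'n ^ 'n" and c :: real
  show "blinfun_matrix_act (A + B) M = blinfun_matrix_act A M + blinfun_matrix_act B M"
    by (simp add: blinfun_matrix_act_def blinfun.add_left matrix_vector_mult_add_rdistrib sum.distrib)
  show "blinfun_matrix_act (c *\<^sub>R A) M = c *\<^sub>R blinfun_matrix_act A M"
    unfolding blinfun_matrix_act_def scaleR_sum_right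
    by (intro sum.cong refl) (simp only: blinfun.scaleR_left scaleR_matrix_vector_assoc)
  show "blinfun_matrix_act A (M + N) = blinfun_matrix_act A M + blinfun_matrix_act A N"
    by (rule linear_add[OF linear_blinfun_matrix_act])
  show "blinfun_matrix_act A (c *\<^sub>R M) = c *\<^sub>R blinfun_matrix_act A M"
    by (rule linear_scale[OF linear_blinfun_matrix_act])
  show "\<exists>K. \<forall>(A :: (real ^ 'n) \<Rightarrow>\<^sub>L (real ^ 'n ^ 'm)) M. norm (blinfun_matrix_act A M) \<le> norm A * norm M * K"
    using blinfun_matrix_act_bound by metis
qed

locale rde_field =
  fixes f :: "real ^ 'm \<Rightarrow> real ^ 'n ^ 'm"
  assumes C3: "C3_b f"
begin

definition Df :: "real ^ 'm \<Rightarrow> (real ^ 'm) \<Rightarrow>\<^sub>L (real ^ 'n ^ 'm)" where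
  "Df = frechet_D f"

text \<open>The Gubinelli derivative Df(Y) Y' of f(Y) when Y' = f(Y), as a function of the
  position.\<close>

definition gub :: "real ^ 'm \<Rightarrow> (real ^ 'n) \<Rightarrow>\<^sub>L (real ^ 'n ^ 'm)" where
  "gub y = Df y o\<^sub>L blinfun_of_matrix_vector (f y)"

definition incr :: "real ^ 'n \<Rightarrow> real ^ 'n ^ 'n \<Rightarrow> real ^ 'm \<Rightarrow> real ^ 'm" where
  "incr x M y = f y *v x + blinfun_matrix_act (gub y) M"

lemma frechet_D_has_derivative:
  fixes \<phi> :: "'a::real_normed_vector \<Rightarrow> 'b::real_normed_vector"
  assumes "\<phi> differentiable (at y)"
  shows "(\<phi> has_derivative blinfun_apply (frechet_D \<phi> y)) (at y)"
proof -
  have "(\<phi> has_derivative frechet_derivative \<phi> (at y)) (at y)" using assms frechet_derivative_works by blast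
  then show ?thesis
    by (simp add: frechet_D_def bounded_linear_Blinfun_apply has_derivative_bounded_linear)
qed

lemma bcontfun_bounded: "\<phi> \<in> bcontfun \<Longrightarrow> \<exists>B. \<forall>y. norm (\<phi> y) \<le> B"
  by (auto simp: bcontfun_def bounded_iff)

lemma Df_derivative: "(f has_derivative blinfun_apply (Df y)) (at y)"
  unfolding Df_def using C3 by (intro frechet_D_has_derivative) (simp add: C3_b_def)

lemma lipschitz_if_derivative:
  fixes D :: "'a::real_normed_vector \<Rightarrow> 'a \<Rightarrow>\<^sub>L 'b::real_normed_vector"
  assumes "\<And>y. (\<phi> has_derivative blinfun_apply (D y)) (at y)" "\<And>y. norm (D y) \<le> K"
  shows "norm (\<phi> x - \<phi> y) \<le> K * norm (x - y)"
  by (rule differentiable_bound[of UNIV _ "\<lambda>y. blinfun_apply (D y)"])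
     (use assms in \<open>auto intro: onorm_blinfun_le\<close>)

text \<open>Here the three bounded derivatives enter: the third makes the second Lipschitz, so that
  Df has the four-point property; \<open>gub\<close> inherits it as a product of Df and f.\<close>

lemma field_C11_b:
  obtains K where "0 < K" "C11_b K f" "C11_b K Df" "C11_b K gub"
proof -
  define D2 where "D2 = frechet_D Df"
  define D3 where "D3 = frechet_D D2"
  have d: "\<And>y. (Df has_derivative blinfun_apply (D2 y)) (at y)" "\<And>y. (D2 has_derivative blinfun_apply (D3 y)) (at y)"
    unfolding D3_def D2_def Df_def using C3 by (auto intro!: frechet_D_has_derivative simp: C3_b_def)
  have bc: "f \<in> bcontfun" "Df \<in> bcontfun" "D2 \<in> bcontfun" "D3 \<in> bcontfun"
    using C3 by (auto simp: C3_b_def D3_def D2_def Df_def)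
  obtain B0 where B0: "\<And>y. norm (f y) \<le> B0" using bcontfun_bounded[OF bc(1)] by blast
  obtain B1 where B1: "\<And>y. norm (Df y) \<le> B1" using bcontfun_bounded[OF bc(2)] by blast
  obtain B2 where B2: "\<And>y. norm (D2 y) \<le> B2" using bcontfun_bounded[OF bc(3)] by blast
  obtain B3 where B3: "\<And>y. norm (D3 y) \<le> B3" using bcontfun_bounded[OF bc(4)] by blast
  define B where "B = max (max B0 B1) (max B2 B3)"
  have b: "\<And>y. norm (f y) \<le> B" "\<And>y. norm (Df y) \<le> B" "\<And>y. norm (D2 y) \<le> B" "\<And>y. norm (D3 y) \<le> B"
    using B0 B1 B2 B3 by (auto simp: B_def le_max_iff_disj)
  note l1 = lipschitz_if_derivative[OF d(1) b(3)] and l2 = lipschitz_if_derivative[OF d(2) b(4)]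
  have n: "C11_b B f" "C11_b B Df"
    by (rule C11_b_if_derivative[OF Df_derivative b(1,2) l1], rule C11_b_if_derivative[OF d(1) b(2,3) l2])
  have B0: "0 \<le> B" by (rule C11_b_nonneg[OF n(1)])
  obtain C where C: "0 < C" "\<And>(M :: real ^ 'n ^ 'm) v. norm (M *v v) \<le> norm M * norm v * C"
    using matrix_vector_bound by blast
  have bm: "norm (blinfun_of_matrix_vector M) \<le> C * norm M" for M :: "real ^ 'n ^ 'm"
    using C by (intro norm_blinfun_bound) (auto simp: mult_ac)
  have bl: "bounded_linear (blinfun_of_matrix_vector :: real ^ 'n ^ 'm \<Rightarrow> _)"
    by (rule linear_conv_bounded_linear[THEN iffD1, OF linear_blinfun_of_matrix_vector])
  have "C11_b (C * B) (\<lambda>y. blinfun_of_matrix_vector (f y))"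
    using C by (intro C11_b_bounded_linear[OF bl bm _ n(1)]) auto
  then have n3: "C11_b (max B (C * B)) (\<lambda>y. blinfun_of_matrix_vector (f y))" by (rule C11_b_mono) simp
  have n2: "C11_b (max B (C * B)) Df" by (rule C11_b_mono[OF n(2)]) simp
  define E where "E = 4 * max B (C * B) * max B (C * B) * 1"
  have ng: "C11_b E gub"
    unfolding gub_def[abs_def] E_def
    by (rule bounded_bilinear.C11_b_prod[OF bounded_bilinear_blinfun_compose _ _ n2 n3])
       (use norm_blinfun_compose in auto)
  define K where "K = max 1 (max B E)"
  show ?thesis
    by (rule that[of K]) (auto simp: K_def intro: C11_b_mono[OF n(1)] C11_b_mono[OF n(2)] C11_b_mono[OF ng])
qed

lemma bilinear_constant:
  obtains C where "0 < C" "\<And>(M :: real ^ 'n ^ 'm) v. norm (M *v v) \<le> norm M * norm v * C"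
    "\<And>(A :: (real ^ 'n) \<Rightarrow>\<^sub>L (real ^ 'n ^ 'm)) M. norm (blinfun_matrix_act A M) \<le> norm A * norm M * C"
proof -
  obtain C where C: "0 < C" "\<And>(M :: real ^ 'n ^ 'm) v. norm (M *v v) \<le> norm M * norm v * C"
    using matrix_vector_bound by blast
  obtain D where D: "0 < D"
    "\<And>(A :: (real ^ 'n) \<Rightarrow>\<^sub>L (real ^ 'n ^ 'm)) M. norm (blinfun_matrix_act A M) \<le> norm A * norm M * D"
    using blinfun_matrix_act_bound by blast
  show ?thesis
  proof (rule that[of "C + D"])
    show "norm (M *v v) \<le> norm M * norm v * (C + D)" for M :: "real ^ 'n ^ 'm" and v
      using C(2)[of M v] mult_left_mono[of C "C + D" "norm M * norm v"] D(1) by simp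
    show "norm (blinfun_matrix_act A M) \<le> norm A * norm M * (C + D)"
      for A :: "(real ^ 'n) \<Rightarrow>\<^sub>L (real ^ 'n ^ 'm)" and M
      using D(2)[of A M] mult_left_mono[of D "C + D" "norm A * norm M"] C(1) by simp
  qed (use C D in simp)
qed

text \<open>\<open>p\<close> stands for |t - s|^a, so x has order p and M order p^2; p <= P reduces
  the latter to order p.\<close>

lemma incr_C11_b:
  assumes H: "0 < H" and P: "0 \<le> P"
  obtains A where "0 < A" "\<And>x M p. 0 \<le> p \<Longrightarrow> p \<le> P \<Longrightarrow> norm x \<le> H * p \<Longrightarrow> norm M \<le> H * (p * p) \<Longrightarrow>
    C11_b (A * p) (incr x M)"
proof -
  obtain K where K: "0 < K" "C11_b K f" "C11_b K Df" "C11_b K gub" using field_C11_b by blast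
  obtain C where C: "0 < C" "\<And>(M :: real ^ 'n ^ 'm) v. norm (M *v v) \<le> norm M * norm v * C"
    "\<And>(A :: (real ^ 'n) \<Rightarrow>\<^sub>L (real ^ 'n ^ 'm)) M. norm (blinfun_matrix_act A M) \<le> norm A * norm M * C"
    using bilinear_constant by blast
  show ?thesis
  proof (rule that[of "H * C * K * (1 + P)"])
    fix x :: "real ^ 'n" and M :: "real ^ 'n ^ 'n" and p :: real assume p: "0 \<le> p" "p \<le> P" and x: "norm x \<le> H * p" and M: "norm M \<le> H * (p * p)"
    have "C11_b (norm x * C * K + norm M * C * K) (incr x M)"
      unfolding incr_def[abs_def] using C K
      by (intro C11_b_add bounded_bilinear.C11_b_left[OF bounded_bilinear_matrix_vector]
          bounded_bilinear.C11_b_left[OF bounded_bilinear_blinfun_matrix_act]) auto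
    moreover have "norm x * C * K + norm M * C * K \<le> H * p * C * K + H * (p * P) * C * K"
    proof -
      have "norm M \<le> H * (p * P)" using M mult_left_mono[OF mult_left_mono[OF p(2,1)], of H] H by linarith
      then show ?thesis using x C K by (intro add_mono mult_right_mono) auto
    qed
    moreover have "\<dots> = H * C * K * (1 + P) * p" by (simp add: algebra_simps)
    ultimately show "C11_b (H * C * K * (1 + P) * p) (incr x M)" by (metis C11_b_mono)
  qed (use H C K P in simp)
qed

text \<open>Two successive steps against a single one, whose second level is the one Chen's relation
  assigns to the composite.\<close>

definition incr_defect :: "real ^ 'n \<Rightarrow> real ^ 'n ^ 'n \<Rightarrow> real ^ 'n \<Rightarrow> real ^ 'n ^ 'n \<Rightarrow> real ^ 'm \<Rightarrow> real ^ 'm" where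
  "incr_defect x1 M1 x2 M2 y =
    incr x1 M1 y + incr x2 M2 (y + incr x1 M1 y) - incr (x1 + x2) (M1 + M2 + outer_product x1 x2) y"

text \<open>All terms of order p and p^2 cancel: the linear part of f (y + w) - f y, applied to x2,
  is matched by the outer product from Chen's relation. What remains is of third order, and so is
  its dependence on y.\<close>

lemma incr_defect_bound:
  assumes H: "0 < H" and P: "0 \<le> P"
  obtains A where "0 < A" "\<And>x1 x2 M1 M2 p y z. 0 \<le> p \<Longrightarrow> p \<le> P \<Longrightarrow> norm x1 \<le> H * p \<Longrightarrow> norm x2 \<le> H * p \<Longrightarrow>
    norm M1 \<le> H * (p * p) \<Longrightarrow> norm M2 \<le> H * (p * p) \<Longrightarrow>
    norm (incr_defect x1 M1 x2 M2 y) \<le> A * (p * p * p) \<and>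
    norm (incr_defect x1 M1 x2 M2 y - incr_defect x1 M1 x2 M2 z) \<le> A * (p * p * p) * norm (y - z)"
proof -
  obtain K where K: "0 < K" "C11_b K f" "C11_b K Df" "C11_b K gub" using field_C11_b by blast
  obtain C where C: "0 < C" "\<And>(M :: real ^ 'n ^ 'm) v. norm (M *v v) \<le> norm M * norm v * C"
    "\<And>(A :: (real ^ 'n) \<Rightarrow>\<^sub>L (real ^ 'n ^ 'm)) M. norm (blinfun_matrix_act A M) \<le> norm A * norm M * C"
    using bilinear_constant by blast
  obtain A where A: "0 < A" "\<And>x M p. 0 \<le> p \<Longrightarrow> p \<le> P \<Longrightarrow> norm x \<le> H * p \<Longrightarrow> norm M \<le> H * (p * p) \<Longrightarrow>
    C11_b (A * p) (incr x M)" using incr_C11_b[OF H P] by blast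
  interpret mv: bounded_bilinear "(*v) :: real ^ 'n ^ 'm \<Rightarrow> real ^ 'n \<Rightarrow> real ^ 'm"
    by (rule bounded_bilinear_matrix_vector)
  interpret ma: bounded_bilinear "blinfun_matrix_act :: ((real ^ 'n) \<Rightarrow>\<^sub>L (real ^ 'n ^ 'm)) \<Rightarrow> real ^ 'n ^ 'n \<Rightarrow> real ^ 'm"
    by (rule bounded_bilinear_blinfun_matrix_act)
  \<comment> \<open>\<open>Tc\<close> bounds the coefficient of x2 in units of p^2, and
    \<open>Uc\<close> that of M2 in units of p. Both are sized for the Lipschitz estimates, which
    are larger than the sup bounds.\<close>
  define Tc where "Tc = 6 * K * A * A + 2 * K * H * C * K"
  define Uc where "Uc = K * A * (5 + 2 * A * P)"
  have pos: "0 < Tc" "0 < Uc" using K A H C P by (auto simp: Tc_def Uc_def intro!: add_pos_pos mult_pos_pos add_pos_nonneg)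
  show ?thesis
  proof (rule that[of "(Tc + Uc) * H * C"])
    show "0 < (Tc + Uc) * H * C" using pos H C by simp
    fix x1 x2 :: "real ^ 'n" and M1 M2 :: "real ^ 'n ^ 'n" and p :: real and y z :: "real ^ 'm"
    assume p: "0 \<le> p" "p \<le> P" and x: "norm x1 \<le> H * p" "norm x2 \<le> H * p"
      and M: "norm M1 \<le> H * (p * p)" "norm M2 \<le> H * (p * p)"
    define w where "w = incr x1 M1"
    have nw: "C11_b (A * p) w" unfolding w_def by (rule A(2)[OF p x(1) M(1)])
    note w = C11_bD[OF nw] and Kf = C11_bD[OF K(2)] and KD = C11_bD[OF K(3)] and Kg = C11_bD[OF K(4)]
    define b where "b y = blinfun_matrix_act (gub y) M1" for y
    have nb: "C11_b (norm M1 * C * K) b"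
      unfolding b_def[abs_def] using C K by (intro ma.C11_b_left) auto
    have "norm M1 * C * K \<le> H * (p * p) * C * K" using M C K by (intro mult_right_mono) auto
    then have nb: "C11_b (H * (p * p) * C * K) b" by (rule C11_b_mono[OF nb])
    note b = C11_bD[OF nb]
    define G where "G y = f (y + w y) - f y - blinfun_apply (Df y) (w y)" for y
    define S where "S y = blinfun_apply (Df y) (b y)" for y
    define U where "U y = gub (y + w y) - gub y" for y
    define \<Theta> where "\<Theta> = incr_defect x1 M1 x2 M2"
    \<comment> \<open>\<open>G\<close> is the Taylor remainder of f; \<open>S\<close> accounts for w
      being f y x1 plus the second level term \<open>b\<close>, while Chen's term only removes the
      contribution of f y x1.\<close>
    have eq: "\<Theta> y = (G y + S y) *v x2 + blinfun_matrix_act (U y) M2" for y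
    proof -
      have "blinfun_apply (gub y) x1 = blinfun_apply (Df y) (f y *v x1)" by (simp add: gub_def)
      also have "f y *v x1 = w y - b y" by (simp add: w_def b_def incr_def)
      finally have g1: "blinfun_apply (gub y) x1 = blinfun_apply (Df y) (w y) - S y"
        by (simp add: S_def blinfun.diff_right)
      have "\<Theta> y = (f (y + w y) - f y) *v x2 + blinfun_matrix_act (U y) M2 - blinfun_matrix_act (gub y) (outer_product x1 x2)"
        unfolding \<Theta>_def incr_defect_def w_def[symmetric] U_def unfolding w_def incr_def
        by (simp add: mv.diff_left mv.add_right ma.diff_left ma.add_right w_def incr_def)
      also have "blinfun_matrix_act (gub y) (outer_product x1 x2) = (blinfun_apply (Df y) (w y) - S y) *v x2"
        unfolding blinfun_matrix_act_outer_product g1 ..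
      finally show ?thesis by (simp add: G_def mv.diff_left mv.add_left algebra_simps)
    qed
    have Ap: "0 \<le> A * p" using A p by simp
    have ww: "norm (w y) * norm (w y) \<le> A * p * (A * p)" for y using w(1)[of y] Ap by (intro mult_mono) auto
    have G1: "norm (G y) \<le> K * (A * p * (A * p))" for y
    proof -
      have "norm (G y) \<le> K * norm (w y) * norm (w y)"
        unfolding G_def by (rule taylor_bound[OF Df_derivative KD(2)]) (use K in simp)
      also have "\<dots> \<le> K * (A * p * (A * p))" using ww[of y] K by (simp add: mult.assoc)
      finally show ?thesis .
    qed
    have G2: "norm (G y - G z) \<le> 6 * K * (A * p * (A * p)) * norm (y - z)"
    proof -
      have "norm (G y - G z) \<le> 4 * K * norm (w y) * norm (w y) * norm (y - z) + K * (norm (w y) + norm (w z)) * norm (w y - w z)"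
        unfolding G_def by (rule taylor_bound_lipschitz[OF Df_derivative K(3)])
      also have "\<dots> \<le> 4 * K * (A * p * (A * p)) * norm (y - z) + K * (A * p + A * p) * (A * p * norm (y - z))"
      proof (rule add_mono)
        have "4 * K * norm (w y) * norm (w y) \<le> 4 * K * (A * p * (A * p))" using ww[of y] K by (simp add: mult.assoc)
        then show "4 * K * norm (w y) * norm (w y) * norm (y - z) \<le> 4 * K * (A * p * (A * p)) * norm (y - z)"
          by (rule mult_right_mono) simp
        show "K * (norm (w y) + norm (w z)) * norm (w y - w z) \<le> K * (A * p + A * p) * (A * p * norm (y - z))"
          using K Ap by (intro mult_mono add_mono mult_left_mono w) auto
      qed
      also have "\<dots> = 6 * K * (A * p * (A * p)) * norm (y - z)" by (simp add: algebra_simps)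
      finally show ?thesis .
    qed
    have B0: "0 \<le> H * (p * p) * C * K" using H p C K by simp
    have bl: "norm (blinfun_apply F v) \<le> a * c" if "norm F \<le> a" "norm v \<le> c" for F :: "(real ^ 'm) \<Rightarrow>\<^sub>L (real ^ 'n ^ 'm)" and v a c
      using norm_blinfun[of F v] mult_mono[OF that] that norm_ge_zero[of F] norm_ge_zero[of v] by linarith
    have S1: "norm (S y) \<le> K * (H * (p * p) * C * K)" for y
      unfolding S_def by (rule bl[OF KD(1) b(1)])
    have S2: "norm (S y - S z) \<le> 2 * (K * (H * (p * p) * C * K)) * norm (y - z)"
    proof -
      have "S y - S z = blinfun_apply (Df y - Df z) (b y) + blinfun_apply (Df z) (b y - b z)"
        by (simp add: S_def blinfun.diff_left blinfun.diff_right)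
      then have "norm (S y - S z) \<le> norm (blinfun_apply (Df y - Df z) (b y)) + norm (blinfun_apply (Df z) (b y - b z))"
        by (metis norm_triangle_ineq)
      also have "\<dots> \<le> (K * norm (y - z)) * (H * (p * p) * C * K) + K * (H * (p * p) * C * K * norm (y - z))"
        by (intro add_mono bl KD b)
      finally show ?thesis by (simp add: algebra_simps)
    qed
    have T1: "norm (G y + S y) \<le> Tc * (p * p)"
    proof -
      have "norm (G y + S y) \<le> K * (A * p * (A * p)) + K * (H * (p * p) * C * K)"
        using norm_triangle_ineq[of "G y" "S y"] G1[of y] S1[of y] by linarith
      also have "\<dots> \<le> 6 * (K * (A * p * (A * p))) + 2 * (K * (H * (p * p) * C * K))"
      proof -
        have "0 \<le> K * (A * p * (A * p))" "0 \<le> K * (H * (p * p) * C * K)"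
          using K(1) Ap B0 by (auto intro!: mult_nonneg_nonneg[OF less_imp_le])
        then show ?thesis by linarith
      qed
      also have "\<dots> = Tc * (p * p)" by (simp add: Tc_def algebra_simps)
      finally show ?thesis .
    qed
    have T2: "norm ((G y + S y) - (G z + S z)) \<le> Tc * (p * p) * norm (y - z)"
    proof -
      have "norm ((G y + S y) - (G z + S z)) \<le> norm (G y - G z) + norm (S y - S z)"
        using norm_triangle_ineq[of "G y - G z" "S y - S z"] by (simp add: algebra_simps)
      also have "\<dots> \<le> Tc * (p * p) * norm (y - z)" using G2 S2 by (simp add: Tc_def algebra_simps)
      finally show ?thesis .
    qed
    have le5: "K * (A * p) * 1 \<le> K * (A * p) * (5 + 2 * A * P)"
      using K Ap A P by (intro mult_left_mono) auto
    have U1: "norm (U y) \<le> Uc * p"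
    proof -
      have "norm (U y) \<le> K * norm (w y)" unfolding U_def using Kg(2)[of "y + w y" y] by simp
      also have "\<dots> \<le> K * (A * p)" using w(1) K by simp
      also have "\<dots> \<le> Uc * p" using le5 by (simp add: Uc_def algebra_simps)
      finally show ?thesis .
    qed
    have U2: "norm (U y - U z) \<le> Uc * p * norm (y - z)"
    proof -
      have wyz: "norm (w y - w z) \<le> A * p * norm (y - z)" by (rule w(2))
      have "norm (y + w y - (z + w z)) \<le> norm (y - z) + norm (w y - w z)"
        using norm_triangle_ineq[of "y - z" "w y - w z"] by (simp add: algebra_simps)
      also have "\<dots> \<le> norm (y - z) + A * p * norm (y - z)" using wyz by simp
      finally have s: "norm (y + w y - (z + w z)) \<le> norm (y - z) + A * p * norm (y - z)" .
      have "norm (U y - U z) \<le> K * (norm (w y - w z) + (norm (w y) + norm (w z)) * (norm (y + w y - (z + w z)) + norm (y - z)))"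
        unfolding U_def using Kg(3)[of "y + w y" y "z + w z" z] by simp
      also have "\<dots> \<le> K * (A * p * norm (y - z) + (A * p + A * p) * ((norm (y - z) + A * p * norm (y - z)) + norm (y - z)))"
        using K Ap by (intro mult_left_mono add_mono mult_mono w s) auto
      also have "\<dots> = K * (A * p) * (5 + 2 * A * p) * norm (y - z)" by (simp add: algebra_simps)
      also have "\<dots> \<le> K * (A * p) * (5 + 2 * A * P) * norm (y - z)"
        using K Ap A p by (intro mult_right_mono mult_left_mono add_left_mono) auto
      finally show ?thesis by (simp add: Uc_def algebra_simps)
    qed
    \<comment> \<open>Taken with n = 1 for the size, and with n = norm (y - z) for the Lipschitz
      bound.\<close>
    have fin: "norm (R *v x2 + blinfun_matrix_act V M2) \<le> (Tc + Uc) * H * C * (p * p * p) * n"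
      if R: "norm R \<le> Tc * (p * p) * n" and V: "norm V \<le> Uc * p * n" and n: "0 \<le> n" for R :: "real ^ 'n ^ 'm" and V n
    proof -
      have "norm (R *v x2 + blinfun_matrix_act V M2) \<le> norm R * norm x2 * C + norm V * norm M2 * C"
        using norm_triangle_ineq[of "R *v x2" "blinfun_matrix_act V M2"] C(2)[of R x2] C(3)[of V M2] by linarith
      also have "\<dots> \<le> (Tc * (p * p) * n) * (H * p) * C + (Uc * p * n) * (H * (p * p)) * C"
        using R V x M C p n pos H by (intro add_mono mult_right_mono mult_mono) auto
      also have "\<dots> = (Tc + Uc) * H * C * (p * p * p) * n" by (simp add: algebra_simps)
      finally show ?thesis .
    qed
    have "norm (\<Theta> y) \<le> (Tc + Uc) * H * C * (p * p * p)"
      using fin[of "G y + S y" 1 "U y"] T1 U1 unfolding eq by simp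
    moreover have "\<Theta> y - \<Theta> z = ((G y + S y) - (G z + S z)) *v x2 + blinfun_matrix_act (U y - U z) M2"
      unfolding eq by (simp add: mv.diff_left ma.diff_left algebra_simps)
    then have "norm (\<Theta> y - \<Theta> z) \<le> (Tc + Uc) * H * C * (p * p * p) * norm (y - z)"
      using fin[OF T2 U2] by simp
    ultimately show "norm (incr_defect x1 M1 x2 M2 y) \<le> (Tc + Uc) * H * C * (p * p * p) \<and>
    norm (incr_defect x1 M1 x2 M2 y - incr_defect x1 M1 x2 M2 z) \<le> (Tc + Uc) * H * C * (p * p * p) * norm (y - z)"
      unfolding \<Theta>_def by blast
  qed
qed

lemma incr_difference:
  obtains A where "0 < A" "\<And>x x' M M' y. norm (incr x M y - incr x' M' y) \<le> A * norm ((x, M) - (x', M'))"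
proof -
  obtain K where K: "0 < K" "C11_b K f" "C11_b K Df" "C11_b K gub" using field_C11_b by blast
  obtain C where C: "0 < C" "\<And>(M :: real ^ 'n ^ 'm) v. norm (M *v v) \<le> norm M * norm v * C"
    "\<And>(A :: (real ^ 'n) \<Rightarrow>\<^sub>L (real ^ 'n ^ 'm)) M. norm (blinfun_matrix_act A M) \<le> norm A * norm M * C"
    using bilinear_constant by blast
  show ?thesis
  proof (rule that[of "2 * K * C"])
    fix x x' :: "real ^ 'n" and M M' :: "real ^ 'n ^ 'n" and y :: "real ^ 'm"
    have eq: "incr x M y - incr x' M' y = f y *v (x - x') + blinfun_matrix_act (gub y) (M - M')"
      by (simp add: incr_def bounded_bilinear.diff_right[OF bounded_bilinear_matrix_vector]
          bounded_bilinear.diff_right[OF bounded_bilinear_blinfun_matrix_act])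
    have "norm (incr x M y - incr x' M' y) \<le> norm (f y) * norm (x - x') * C + norm (gub y) * norm (M - M') * C"
      unfolding eq
      using norm_triangle_ineq[of "f y *v (x - x')" "blinfun_matrix_act (gub y) (M - M')"]
        C(2)[of "f y" "x - x'"] C(3)[of "gub y" "M - M'"] by linarith
    also have "\<dots> \<le> K * norm ((x, M) - (x', M')) * C + K * norm ((x, M) - (x', M')) * C"
      using C K C11_bD(1)[OF K(2)] C11_bD(1)[OF K(4)] norm_fst_le[of "x - x'" "M - M'"] norm_snd_le[of "M - M'" "x - x'"]
      by (intro add_mono mult_right_mono mult_mono) auto
    finally show "norm (incr x M y - incr x' M' y) \<le> 2 * K * C * norm ((x, M) - (x', M'))"
      by (simp add: algebra_simps)
  qed (use K C in simp)
qed

lemma almost_flow_rde: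
  fixes X :: "real \<Rightarrow> real ^ 'n" and XX :: "real \<Rightarrow> real \<Rightarrow> real ^ 'n ^ 'n"
  assumes T: "0 < T" and a: "1 < 3 * a" and H: "0 < H"
    and X: "\<And>s t. 0 \<le> s \<Longrightarrow> s \<le> t \<Longrightarrow> t \<le> T \<Longrightarrow> norm (X t - X s) \<le> H * (t - s) powr a"
    and XX: "\<And>s t. 0 \<le> s \<Longrightarrow> s \<le> t \<Longrightarrow> t \<le> T \<Longrightarrow> norm (XX s t) \<le> H * (t - s) powr (2 * a)"
    and chen: "\<And>s u t. 0 \<le> s \<Longrightarrow> s \<le> u \<Longrightarrow> u \<le> t \<Longrightarrow> t \<le> T \<Longrightarrow>
      XX s t - XX s u - XX u t = outer_product (X u - X s) (X t - X u)"
    and Xc: "continuous_on {0..T} X" and XXc: "continuous_on (triangle2 T) (\<lambda>(s, t). XX s t)"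
  obtains K where "almost_flow T a K (\<lambda>s t y. y + incr (X t - X s) (XX s t) y) (\<lambda>s t. (X t - X s, XX s t))"
proof -
  define P where "P = T powr a"
  have P: "0 \<le> P" by (simp add: P_def)
  obtain A1 where A1: "0 < A1" "\<And>x M p. 0 \<le> p \<Longrightarrow> p \<le> P \<Longrightarrow> norm x \<le> H * p \<Longrightarrow> norm M \<le> H * (p * p) \<Longrightarrow>
    C11_b (A1 * p) (incr x M)" using incr_C11_b[OF H P] by blast
  obtain A2 where A2: "0 < A2" "\<And>x1 x2 M1 M2 p y z. 0 \<le> p \<Longrightarrow> p \<le> P \<Longrightarrow> norm x1 \<le> H * p \<Longrightarrow> norm x2 \<le> H * p \<Longrightarrow>
    norm M1 \<le> H * (p * p) \<Longrightarrow> norm M2 \<le> H * (p * p) \<Longrightarrow>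
    norm (incr_defect x1 M1 x2 M2 y) \<le> A2 * (p * p * p) \<and>
    norm (incr_defect x1 M1 x2 M2 y - incr_defect x1 M1 x2 M2 z) \<le> A2 * (p * p * p) * norm (y - z)"
    by (rule incr_defect_bound[OF H P], rule that)
  obtain A3 where A3: "0 < A3" "\<And>x x' M M' y. norm (incr x M y - incr x' M' y) \<le> A3 * norm ((x, M) - (x', M'))"
    using incr_difference by blast
  define K where "K = max A1 (max A2 A3)"
  have K: "0 < K" "A1 \<le> K" "A2 \<le> K" "A3 \<le> K" using A1(1) by (auto simp: K_def)
  have pw: "h powr (2 * a) = h powr a * h powr a" "h powr (3 * a) = h powr a * h powr a * h powr a" for h
    by (simp_all add: powr_add[symmetric])
  have pP: "0 \<le> (t - s) powr a \<and> (t - s) powr a \<le> P" if "0 \<le> s" "s \<le> t" "t \<le> T" for s t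
    using that a by (auto simp: P_def intro!: powr_mono2)
  have n: "C11_b (K * (t - s) powr a) (incr (X t - X s) (XX s t))" if st: "0 \<le> s" "s \<le> t" "t \<le> T" for s t
    by (rule C11_b_mono[OF A1(2)[of "(t - s) powr a"]])
       (use pP[OF st] X[OF st] XX[OF st] K in \<open>auto simp: pw intro!: mult_right_mono\<close>)
  have mon: "H * (v - u) powr a \<le> H * (t - s) powr a" "H * ((v - u) powr a * (v - u) powr a) \<le> H * ((t - s) powr a * (t - s) powr a)"
    if "s \<le> u" "u \<le> v" "v \<le> t" for s u v t
    using that H a by (auto intro!: mult_left_mono mult_mono powr_mono2)
  let ?d = "\<lambda>s u t. incr_defect (X u - X s) (XX s u) (X t - X u) (XX u t)"
  have eq: "?d s u t y = incr (X u - X s) (XX s u) y + incr (X t - X u) (XX u t) (y + incr (X u - X s) (XX s u) y) -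
      incr (X t - X s) (XX s t) y" if st: "0 \<le> s" "s \<le> u" "u \<le> t" "t \<le> T" for s u t y
    using chen[OF st] by (simp add: incr_defect_def algebra_simps)
  have D: "norm (?d s u t y) \<le> K * (t - s) powr (3 * a) \<and>
      norm (?d s u t y - ?d s u t z) \<le> K * (t - s) powr (3 * a) * norm (y - z)"
    if st: "0 \<le> s" "s \<le> u" "u \<le> t" "t \<le> T" for s u t y z
  proof -
    have b: "norm (X u - X s) \<le> H * (t - s) powr a" "norm (X t - X u) \<le> H * (t - s) powr a"
      "norm (XX s u) \<le> H * ((t - s) powr a * (t - s) powr a)" "norm (XX u t) \<le> H * ((t - s) powr a * (t - s) powr a)"
      using X[of s u] X[of u t] XX[of s u] XX[of u t] mon[of s s u t] mon[of s u t t] st unfolding pw by linarith+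
    have "norm (?d s u t y) \<le> A2 * (t - s) powr (3 * a) \<and>
        norm (?d s u t y - ?d s u t z) \<le> A2 * (t - s) powr (3 * a) * norm (y - z)"
      unfolding pw(2) by (rule A2(2)) (use b pP[of s t] st in auto)
    moreover have KA: "A2 * (t - s) powr (3 * a) \<le> K * (t - s) powr (3 * a)" using K by (intro mult_right_mono) auto
    ultimately show ?thesis using mult_right_mono[OF KA norm_ge_zero, of "y - z"] by linarith
  qed
  show ?thesis
  proof (rule that[of K], unfold_locales)
    fix s t :: real and y z x x' z' :: "real ^ 'm" assume st: "0 \<le> s" "s \<le> t" "t \<le> T"
    note N = C11_bD[OF n[OF st]]
    show "norm (y + incr (X t - X s) (XX s t) y - y) \<le> K * (t - s) powr a" using N(1) by simp
    show "norm (y + incr (X t - X s) (XX s t) y - y - (z + incr (X t - X s) (XX s t) z - z)) \<le> K * (t - s) powr a * norm (y - z)"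
      using N(2) by simp
    show "norm (x + incr (X t - X s) (XX s t) x - x - (x' + incr (X t - X s) (XX s t) x' - x') -
        (z + incr (X t - X s) (XX s t) z - z - (z' + incr (X t - X s) (XX s t) z' - z')))
       \<le> K * (t - s) powr a * (norm (x - x' - (z - z')) + (norm (x - x') + norm (z - z')) * (norm (x - z) + norm (x' - z')))"
      using N(3) by simp
  next
    fix s :: real and y assume s: "0 \<le> s" "s \<le> T"
    \<comment> \<open>The Hoelder bound at zero length, where 0 powr (2 * a) is 0.\<close>
    have "norm (XX s s) \<le> 0" using XX[OF s(1) order_refl s(2)] by simp
    then show "y + incr (X s - X s) (XX s s) y = y"
      by (simp add: incr_def bounded_bilinear.zero_right[OF bounded_bilinear_matrix_vector]
          bounded_bilinear.zero_right[OF bounded_bilinear_blinfun_matrix_act])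
  next
    fix s u t :: real and y z :: "real ^ 'm" assume st: "0 \<le> s" "s \<le> u" "u \<le> t" "t \<le> T"
    show "norm (y + incr (X u - X s) (XX s u) y + incr (X t - X u) (XX u t) (y + incr (X u - X s) (XX s u) y) -
        (y + incr (X t - X s) (XX s t) y)) \<le> K * (t - s) powr (3 * a)"
      using conjunct1[OF D[OF st, of y y]] by (simp add: eq[OF st] algebra_simps)
    show "norm (y + incr (X u - X s) (XX s u) y + incr (X t - X u) (XX u t) (y + incr (X u - X s) (XX s u) y) -
        (y + incr (X t - X s) (XX s t) y) -
        (z + incr (X u - X s) (XX s u) z + incr (X t - X u) (XX u t) (z + incr (X u - X s) (XX s u) z) -
        (z + incr (X t - X s) (XX s t) z))) \<le> K * (t - s) powr (3 * a) * norm (y - z)"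
      using conjunct2[OF D[OF st, of y z]] by (simp add: eq[OF st] algebra_simps)
  next
    show "continuous_on (triangle2 T) (\<lambda>(s, t). (X t - X s, XX s t))"
      using continuous_on_triangle2_fst[OF Xc] continuous_on_triangle2_snd[OF Xc] XXc
      unfolding case_prod_unfold by (intro continuous_intros)
  next
    fix s t s' t' y
    show "norm (y + incr (X t - X s) (XX s t) y - (y + incr (X t' - X s') (XX s' t') y)) \<le>
        K * norm ((X t - X s, XX s t) - (X t' - X s', XX s' t'))"
      unfolding add_diff_cancel_left
      by (rule order_trans[OF A3(2) mult_right_mono[OF K(4) norm_ge_zero]])
  qed (use T a K in auto)
qed

end

section \<open>Product defects and membership in the Besov-Orlicz spaces\<close>

context besov_orlicz
begin

text \<open>Shaped for the third order remainder: its defect consists of a grade 2 factor times an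
  increment of X, and an increment of Y times XX. The grades occur in either order, but both
  products have the same total grade.\<close>

lemma BO_sewing_products:
  fixes R :: "real \<Rightarrow> real \<Rightarrow> 'v::real_normed_vector"
  assumes k: "0 < j" "0 < k" and ka: "1 < (j + k) * \<alpha>" and cont: "continuous_on (triangle2 T) (\<lambda>(s, t). R s t)"
    and b: "1 < b" and C: "0 < C" and Rb: "\<And>s t. 0 \<le> s \<Longrightarrow> s \<le> t \<Longrightarrow> t \<le> T \<Longrightarrow> norm (R s t) \<le> C * (t - s) powr b"
    and AB: "BO j A" "BO k B" "BO k A'" "BO j B'"
    and dl: "\<And>s u t. 0 \<le> s \<Longrightarrow> s \<le> u \<Longrightarrow> u \<le> t \<Longrightarrow> t \<le> T \<Longrightarrow>
      norm (R s t - R s u - R u t) \<le> A s u * B u t + A' s u * B' u t"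
  shows "BO (j + k) (\<lambda>s t. norm (R s t))"
proof -
  obtain w1 where "BO_modulus j A w1" using BO_E[OF AB(1)] .
  note m1 = this and w1 = BO_modulusD[OF this]
  obtain v1 where "BO_modulus k B v1" using BO_E[OF AB(2)] .
  note n1 = this and v1 = BO_modulusD[OF this]
  obtain w2 where "BO_modulus k A' w2" using BO_E[OF AB(3)] .
  note m2 = this and w2 = BO_modulusD[OF this]
  obtain v2 where "BO_modulus j B' v2" using BO_E[OF AB(4)] .
  note n2 = this and v2 = BO_modulusD[OF this]
  obtain K1 where K1: "0 < K1" "\<And>h. 0 < h \<Longrightarrow> 2 * h \<le> T \<Longrightarrow>
    gauge_le (\<beta> / (j + k)) {0..T - 2 * h} (\<lambda>r. A r (r + h) * B (r + h) (r + 2 * h)) (K1 * (w1 h * v1 h))"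
    using BO_shifted_mult[OF k m1 n1] by blast
  obtain K2 where K2: "0 < K2" "\<And>h. 0 < h \<Longrightarrow> 2 * h \<le> T \<Longrightarrow>
    gauge_le (\<beta> / (k + j)) {0..T - 2 * h} (\<lambda>r. A' r (r + h) * B' (r + h) (r + 2 * h)) (K2 * (w2 h * v2 h))"
    using BO_shifted_mult[OF k(2,1) m2 n2] by blast
  define w where "w h = K1 * (w1 h * v1 h) + K2 * (w2 h * v2 h)" for h
  have jk: "0 < j + k" using k by simp
  have bjk: "0 < \<beta> / (j + k)" using beta jk by simp
  show ?thesis
  proof (rule BO_sewing[OF jk ka cont b C Rb, where w = w])
    show "mono_on {0<..T} w"
      unfolding w_def using w1(1,2) v1(1,2) w2(1,2) v2(1,2) K1(1) K2(1)
      by (auto simp: mono_on_def less_imp_le intro!: add_mono mult_left_mono mult_mono)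
    show "0 < w h" if "0 < h" "h \<le> T" for h
      unfolding w_def using w1(2) v1(2) w2(2) v2(2) K1(1) K2(1) that by (auto intro!: add_pos_pos mult_pos_pos)
    have "lq_seq q (j + k) (\<lambda>i. K1 * (((2 ^ i) powr (j * \<alpha>) * w1 (T / 2 ^ i)) * ((2 ^ i) powr (k * \<alpha>) * v1 (T / 2 ^ i))) +
        K2 * (((2 ^ i) powr (k * \<alpha>) * w2 (T / 2 ^ i)) * ((2 ^ i) powr (j * \<alpha>) * v2 (T / 2 ^ i))))"
    proof (intro lq_seq_add lq_seq_scale q jk)
      show "lq_seq q (j + k) (\<lambda>i. ((2 ^ i) powr (j * \<alpha>) * w1 (T / 2 ^ i)) * ((2 ^ i) powr (k * \<alpha>) * v1 (T / 2 ^ i)))"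
        by (rule lq_seq_mult[OF q k w1(4,5) v1(4,5)])
      show "lq_seq q (j + k) (\<lambda>i. ((2 ^ i) powr (k * \<alpha>) * w2 (T / 2 ^ i)) * ((2 ^ i) powr (j * \<alpha>) * v2 (T / 2 ^ i)))"
        using lq_seq_mult[OF q k(2,1) w2(4,5) v2(4,5)] by (simp only: add.commute)
    qed (use K1(1) K2(1) in \<open>auto intro!: mult_nonneg_nonneg mult_nonneg_nonneg[OF w1(5) v1(5)] mult_nonneg_nonneg[OF w2(5) v2(5)]\<close>)
    then show "lq_seq q (j + k) (\<lambda>i. (2 ^ i) powr ((j + k) * \<alpha>) * w (T / 2 ^ i))"
      by (simp add: w_def ring_distribs powr_add mult_ac)
    fix h :: real assume h: "0 < h" "2 * h \<le> T"
    let ?D = "\<lambda>r. A r (r + h) * B (r + h) (r + 2 * h) + A' r (r + h) * B' (r + h) (r + 2 * h)"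
    have "gauge_le (\<beta> / (j + k)) {0..T - 2 * h} ?D (w h)"
      unfolding w_def using K1(2)[OF h] K2(2)[OF h] by (intro gauge_le_add[OF bjk]) (auto simp: add.commute)
    moreover have "norm (R r (r + 2 * h) - R r (r + h) - R (r + h) (r + 2 * h)) \<le> ?D r" if "r \<in> {0..T - 2 * h}" for r
      using that h by (intro dl) auto
    ultimately show "\<exists>D. gauge_le (\<beta> / (j + k)) {0..T - 2 * h} D (w h) \<and>
       (\<forall>r\<in>{0..T - 2 * h}. norm (R r (r + 2 * h) - R r (r + h) - R (r + h) (r + 2 * h)) \<le> D r)" by blast
  qed
qed

lemma increment_continuous:
  fixes g :: "real \<Rightarrow> 'v::real_normed_vector"
  assumes "continuous_on {0..T} g" shows "continuous_on (triangle2 T) (\<lambda>(s, t). g t - g s)"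
  using continuous_on_triangle2_fst[OF assms] continuous_on_triangle2_snd[OF assms]
  unfolding case_prod_unfold by (intro continuous_intros)

lemma besov_spaceD:
  assumes "g \<in> besov_space \<alpha> \<beta> q T"
  shows "continuous_on {0..T} g" "BO 1 (\<lambda>s t. norm (g t - g s))"
proof -
  show c: "continuous_on {0..T} g" using assms by (simp add: besov_space_def)
  show "BO 1 (\<lambda>s t. norm (g t - g s))"
    by (rule BO_if_besov2_norm[where Q = q])
       (use assms increment_continuous[OF c] in \<open>auto simp: besov_space_def besov2_norm_def besov_seminorm_def\<close>)
qed

lemma besov_spaceI:
  fixes g :: "real \<Rightarrow> 'v::real_normed_vector"
  assumes c: "continuous_on {0..T} g" and bo: "BO 1 (\<lambda>s t. norm (g t - g s))"
  shows "g \<in> besov_space \<alpha> \<beta> q T"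
proof -
  have "(\<lambda>s t. g t - g s) \<in> besov2_space (1 * \<alpha>) (\<beta> / 1) q T"
    by (rule besov2_space_if_BO) (use increment_continuous[OF c] bo in auto)
  then have "besov_seminorm \<alpha> \<beta> q T g < \<infinity>"
    by (simp add: besov2_space_def besov2_norm_def besov_seminorm_def)
  moreover have "continuous_on (triangle2 T) (\<lambda>(s, t). g s)"
    using continuous_on_triangle2_fst[OF c] by (simp add: case_prod_unfold)
  from orlicz_norm_lag_bounded[OF beta this] T
  obtain M where "orlicz_norm \<beta> {0..T - 0} (\<lambda>r. g r) \<le> ennreal M" by (metis less_imp_le order_refl)
  then have "orlicz_norm \<beta> {0..T} g < \<infinity>" by (simp add: le_less_trans)
  ultimately show ?thesis using c by (simp add: besov_space_def)
qed

end

lemma ennreal_divide_numeral_facts: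
  "q / numeral n = (\<infinity> :: ennreal) \<longleftrightarrow> q = \<infinity>" "enn2real (q / numeral n) = enn2real q / numeral n"
proof -
  show "q / numeral n = (\<infinity> :: ennreal) \<longleftrightarrow> q = \<infinity>"
    by (cases q) (auto simp: ennreal_divide_numeral ennreal_top_divide)
  show "enn2real (q / numeral n) = enn2real q / numeral n"
    by (cases q) (auto simp: ennreal_divide_numeral ennreal_top_divide)
qed

lemma outer_product_bound: "norm (outer_product b c) \<le> real CARD('m) * (norm b * norm c)"
  for b :: "real ^ 'm" and c :: "real ^ 'n"
proof -
  have "outer_product b c $ i = b $ i *\<^sub>R c" for i by (simp add: outer_product_def vec_eq_iff)
  then have "norm (outer_product b c) \<le> (\<Sum>i\<in>UNIV. \<bar>b $ i\<bar> * norm c)"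
    using norm_matrix_le[of "outer_product b c"] by simp
  also have "\<dots> \<le> (\<Sum>i\<in>(UNIV :: 'm set). norm b * norm c)"
    by (intro sum_mono mult_right_mono component_le_norm_cart) auto
  finally show ?thesis by simp
qed

section \<open>Algebra of the third order remainder\<close>

context rde_field
begin

text \<open>With y = Y s and y' = Y u, the coefficient of x2 is the remainder of the controlled path
  f(Y). Taylor's formula bounds it by the remainder of Y and the squared increment. The second
  conjunct shows f(Y) to be controlled; the first bounds the defect needed for sewing.\<close>

lemma euler_remainder_delta:
  obtains D where "0 < D" "\<And>y y' x1 x2 M2.
    norm ((f y' - f y - blinfun_apply (gub y) x1) *v x2 + blinfun_matrix_act (gub y' - gub y) M2) \<le>
      D * ((norm (y' - y - f y *v x1) + norm (y' - y) * norm (y' - y)) * norm x2 + norm (y' - y) * norm M2) \<and>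
    norm (f y' - f y - blinfun_apply (gub y) x1) \<le> D * (norm (y' - y - f y *v x1) + norm (y' - y) * norm (y' - y))"
proof -
  obtain K where K: "0 < K" "C11_b K f" "C11_b K Df" "C11_b K gub" using field_C11_b by blast
  obtain C where C: "0 < C" "\<And>(M :: real ^ 'n ^ 'm) v. norm (M *v v) \<le> norm M * norm v * C"
    "\<And>(A :: (real ^ 'n) \<Rightarrow>\<^sub>L (real ^ 'n ^ 'm)) M. norm (blinfun_matrix_act A M) \<le> norm A * norm M * C"
    using bilinear_constant by blast
  show ?thesis
  proof (rule that[of "K * C + K"])
    fix y y' :: "real ^ 'm" and x1 x2 :: "real ^ 'n" and M2 :: "real ^ 'n ^ 'n"
    let ?r = "norm (y' - y - f y *v x1)" and ?d = "norm (y' - y)"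
    let ?F = "f y' - f y - blinfun_apply (gub y) x1"
    have "?F = (f (y + (y' - y)) - f y - blinfun_apply (Df y) (y' - y)) + blinfun_apply (Df y) (y' - y - f y *v x1)"
      by (simp add: gub_def blinfun.diff_right)
    then have "norm ?F \<le> norm (f (y + (y' - y)) - f y - blinfun_apply (Df y) (y' - y)) + norm (blinfun_apply (Df y) (y' - y - f y *v x1))"
      by (metis norm_triangle_ineq)
    also have "\<dots> \<le> K * ?d * ?d + K * ?r"
    proof (rule add_mono)
      show "norm (f (y + (y' - y)) - f y - blinfun_apply (Df y) (y' - y)) \<le> K * ?d * ?d"
        by (rule taylor_bound[OF Df_derivative C11_bD(2)[OF K(3)]]) (use K in simp)
      have "norm (blinfun_apply (Df y) (y' - y - f y *v x1)) \<le> norm (Df y) * ?r" by (rule norm_blinfun)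
      also have "\<dots> \<le> K * ?r" by (intro mult_right_mono C11_bD(1)[OF K(3)]) simp
      finally show "norm (blinfun_apply (Df y) (y' - y - f y *v x1)) \<le> K * ?r" .
    qed
    finally have F: "norm ?F \<le> K * (?r + ?d * ?d)" by (simp add: algebra_simps)
    have "norm (?F *v x2 + blinfun_matrix_act (gub y' - gub y) M2) \<le> norm ?F * norm x2 * C + norm (gub y' - gub y) * norm M2 * C"
      using norm_triangle_ineq[of "?F *v x2" "blinfun_matrix_act (gub y' - gub y) M2"] C(2)[of ?F x2] C(3)[of "gub y' - gub y" M2]
      by linarith
    also have "\<dots> \<le> (K * (?r + ?d * ?d)) * norm x2 * C + (K * ?d) * norm M2 * C"
      using C F C11_bD(2)[OF K(4)] by (intro add_mono mult_right_mono) auto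
    also have "\<dots> = (K * C) * ((?r + ?d * ?d) * norm x2 + ?d * norm M2)" by (simp add: algebra_simps)
    also have "\<dots> \<le> (K * C + K) * ((?r + ?d * ?d) * norm x2 + ?d * norm M2)"
      using K by (intro mult_right_mono add_nonneg_nonneg mult_nonneg_nonneg) auto
    finally have 1: "norm (?F *v x2 + blinfun_matrix_act (gub y' - gub y) M2) \<le> (K * C + K) * ((?r + ?d * ?d) * norm x2 + ?d * norm M2)" .
    have "K * (?r + ?d * ?d) \<le> (K * C + K) * (?r + ?d * ?d)"
      using K C by (intro mult_right_mono) auto
    with F 1 show "norm (?F *v x2 + blinfun_matrix_act (gub y' - gub y) M2) \<le> (K * C + K) * ((?r + ?d * ?d) * norm x2 + ?d * norm M2) \<and>
      norm ?F \<le> (K * C + K) * (?r + ?d * ?d)" by linarith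
  qed (use K C in \<open>simp add: add_pos_pos\<close>)
qed

text \<open>The contribution of \<open>outer_product x1 x2\<close> is gub y x1 applied to x2, which
  is exactly what completes f y' - f y to a controlled remainder.\<close>

lemma incr_delta:
  assumes "M = M1 + M2 + outer_product x1 x2"
  shows "(z - y - incr (x1 + x2) M y) - (y' - y - incr x1 M1 y) - (z - y' - incr x2 M2 y') =
    (f y' - f y - blinfun_apply (gub y) x1) *v x2 + blinfun_matrix_act (gub y' - gub y) M2"
  unfolding incr_def assms
  by (simp add: bounded_bilinear.diff_left[OF bounded_bilinear_matrix_vector]
      bounded_bilinear.diff_left[OF bounded_bilinear_blinfun_matrix_act]
      bounded_bilinear.add_right[OF bounded_bilinear_matrix_vector]
      bounded_bilinear.add_right[OF bounded_bilinear_blinfun_matrix_act] blinfun_matrix_act_outer_product)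

end

section \<open>Solutions as Davie solutions\<close>

lemma continuous_on_lipschitz_compose:
  assumes "0 \<le> B" "\<And>x y. norm (\<phi> x - \<phi> y) \<le> B * norm (x - y)" "continuous_on S g"
  shows "continuous_on S (\<lambda>t. \<phi> (g t))"
proof (rule continuous_on_compose2[OF _ assms(3) subset_UNIV])
  show "continuous_on UNIV \<phi>"
    by (rule lipschitz_on_continuous_on[of B]) (use assms in \<open>auto simp: lipschitz_on_def dist_norm\<close>)
qed

locale rde_problem = besov_orlicz T \<alpha> \<beta> q + rde_field f
  for T \<alpha> \<beta> :: real and q :: ennreal and f :: "real ^ 'm \<Rightarrow> real ^ 'n ^ 'm" +
  fixes X :: "real \<Rightarrow> real ^ 'n" and XX :: "real \<Rightarrow> real \<Rightarrow> real ^ 'n ^ 'n"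
  assumes alpha3: "1 / 3 < \<alpha>" and alpha2: "\<alpha> \<le> 1 / 2"
    and rough: "(X, XX) \<in> rough_paths \<alpha> \<beta> q T"
begin

text \<open>The midpoint of 1/3 and \<alpha>: it keeps 3a above one, and close enough to \<alpha>
  that 2a exceeds \<alpha> and 3a exceeds 2\<alpha>.\<close>

definition a :: real where "a = (1 / 3 + \<alpha>) / 2"

lemma a: "0 < a" "1 < 3 * a" "a < \<alpha>" "\<alpha> < 2 * a" "2 * \<alpha> < 3 * a"
  using alpha3 alpha2 by (auto simp: a_def)

lemma X: "X \<in> besov_space \<alpha> \<beta> q T"
  and XX: "XX \<in> besov2_space (2 * \<alpha>) (\<beta> / 2) (q / 2) T"
  and XX_cont: "continuous_on (triangle2 T) (\<lambda>(s, t). XX s t)"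
  and chen: "0 \<le> s \<Longrightarrow> s \<le> u \<Longrightarrow> u \<le> t \<Longrightarrow> t \<le> T \<Longrightarrow>
    XX s t - XX s u - XX u t = outer_product (X u - X s) (X t - X u)"
  using rough by (auto simp: rough_paths_def)

lemmas X_cont = besov_spaceD(1)[OF X]
lemmas BO_X = besov_spaceD(2)[OF X]

lemma BO_XX: "BO 2 (\<lambda>s t. norm (XX s t))"
  by (rule BO_if_besov2_norm[OF zero_less_numeral ennreal_divide_numeral_facts(1) ennreal_divide_numeral_facts(2) XX_cont])
     (use XX in \<open>simp add: besov2_space_def\<close>)

lemma XX_diag:
  assumes "0 \<le> s" "s \<le> T" shows "XX s s = 0"
proof -
  have "outer_product (0 :: real ^ 'n) (0 :: real ^ 'n) = 0" by (simp add: outer_product_def vec_eq_iff)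
  then show ?thesis using chen[of s s s] assms by simp
qed

lemma hoelder_if_besov:
  fixes g :: "real \<Rightarrow> 'v::euclidean_space"
  assumes "g \<in> besov_space \<alpha> \<beta> q T"
  obtains C where "0 < C" "\<And>s t. 0 \<le> s \<Longrightarrow> s \<le> t \<Longrightarrow> t \<le> T \<Longrightarrow> norm (g t - g s) \<le> C * (t - s) powr a"
proof -
  note g = besov_spaceD[OF assms]
  show ?thesis
    \<comment> \<open>Increments are additive, so the defect is zero and C = 0 will do.\<close>
    by (rule BO_pointwise[OF _ g(2) increment_continuous[OF g(1)], where g = a and C = 0])
       (use a in \<open>auto intro: that\<close>)
qed

text \<open>X comes first, because the defect of XX is by Chen's relation a product of two
  increments of X.\<close>

lemma rough_hoelder:
  obtains H where "0 < H" "\<And>s t. 0 \<le> s \<Longrightarrow> s \<le> t \<Longrightarrow> t \<le> T \<Longrightarrow> norm (X t - X s) \<le> H * (t - s) powr a"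
    "\<And>s t. 0 \<le> s \<Longrightarrow> s \<le> t \<Longrightarrow> t \<le> T \<Longrightarrow> norm (XX s t) \<le> H * (t - s) powr (2 * a)"
proof -
  obtain H1 where H1: "0 < H1" "\<And>s t. 0 \<le> s \<Longrightarrow> s \<le> t \<Longrightarrow> t \<le> T \<Longrightarrow> norm (X t - X s) \<le> H1 * (t - s) powr a"
    using hoelder_if_besov[OF X] by blast
  have delta: "norm (XX s t - XX s u - XX u t) \<le> real CARD('n) * (H1 * H1) * (t - s) powr (2 * a)"
    if st: "0 \<le> s" "s \<le> u" "u \<le> t" "t \<le> T" for s u t
  proof -
    have mono: "norm (X v - X r) \<le> H1 * (t - s) powr a" if "s \<le> r" "r \<le> v" "v \<le> t" for r v
    proof -
      have "norm (X v - X r) \<le> H1 * (v - r) powr a" using st that by (intro H1) auto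
      also have "\<dots> \<le> H1 * (t - s) powr a" using that H1(1) a by (intro mult_left_mono powr_mono2) auto
      finally show ?thesis .
    qed
    have "norm (XX s t - XX s u - XX u t) \<le> real CARD('n) * (norm (X u - X s) * norm (X t - X u))"
      unfolding chen[OF st] by (rule outer_product_bound)
    also have "\<dots> \<le> real CARD('n) * ((H1 * (t - s) powr a) * (H1 * (t - s) powr a))"
      using st H1(1) by (intro mult_left_mono mult_mono mono) auto
    also have "\<dots> = real CARD('n) * (H1 * H1) * (t - s) powr (2 * a)"
      by (simp add: powr_add[symmetric])
    finally show ?thesis .
  qed
  obtain H2 where H2: "0 < H2" "\<And>s t. 0 \<le> s \<Longrightarrow> s \<le> t \<Longrightarrow> t \<le> T \<Longrightarrow> norm (XX s t) \<le> H2 * (t - s) powr (2 * a)"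
    by (rule BO_pointwise[OF _ BO_XX XX_cont _ _ XX_diag _ delta]) (use a H1 in \<open>auto intro: that\<close>)
  show ?thesis
  proof (rule that[of "H1 + H2"])
    fix s t assume st: "0 \<le> s" "s \<le> t" "t \<le> T"
    have "0 \<le> H2 * (t - s) powr a" "0 \<le> H1 * (t - s) powr (2 * a)" using H1 H2 by auto
    then show "norm (X t - X s) \<le> (H1 + H2) * (t - s) powr a" "norm (XX s t) \<le> (H1 + H2) * (t - s) powr (2 * a)"
      using H1(2)[OF st] H2(2)[OF st] by (simp_all add: distrib_right)
  qed (use H1 H2 in simp)
qed

definition remainder :: "(real \<Rightarrow> real ^ 'm) \<Rightarrow> real \<Rightarrow> real \<Rightarrow> real ^ 'm" where
  "remainder Y s t = Y t - Y s - incr (X t - X s) (XX s t) (Y s)"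

lemma remainder_delta:
  obtains D where "0 < D" "\<And>(Y :: real \<Rightarrow> real ^ 'm) s u t. 0 \<le> s \<Longrightarrow> s \<le> u \<Longrightarrow> u \<le> t \<Longrightarrow> t \<le> T \<Longrightarrow>
    norm (remainder Y s t - remainder Y s u - remainder Y u t) \<le>
    D * (norm (Y u - Y s - f (Y s) *v (X u - X s)) + norm (Y u - Y s) * norm (Y u - Y s)) * norm (X t - X u) +
      D * norm (Y u - Y s) * norm (XX u t)"
proof -
  obtain D where D: "0 < D" "\<And>y y' x1 x2 M2.
    norm ((f y' - f y - blinfun_apply (gub y) x1) *v x2 + blinfun_matrix_act (gub y' - gub y) M2) \<le>
      D * ((norm (y' - y - f y *v x1) + norm (y' - y) * norm (y' - y)) * norm x2 + norm (y' - y) * norm M2) \<and>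
    norm (f y' - f y - blinfun_apply (gub y) x1) \<le> D * (norm (y' - y - f y *v x1) + norm (y' - y) * norm (y' - y))"
    by (rule euler_remainder_delta, rule that)
  show ?thesis
  proof (rule that[OF D(1)])
    fix Y :: "real \<Rightarrow> real ^ 'm" and s u t assume st: "0 \<le> s" "s \<le> u" "u \<le> t" "t \<le> T"
    have M: "XX s t = XX s u + XX u t + outer_product (X u - X s) (X t - X u)"
      using chen[OF st] by (simp add: algebra_simps)
    have e: "X t - X s = (X u - X s) + (X t - X u)" by simp
    show "norm (remainder Y s t - remainder Y s u - remainder Y u t) \<le>
      D * (norm (Y u - Y s - f (Y s) *v (X u - X s)) + norm (Y u - Y s) * norm (Y u - Y s)) * norm (X t - X u) +
        D * norm (Y u - Y s) * norm (XX u t)"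
      unfolding remainder_def e incr_delta[OF M]
      using conjunct1[OF D(2)[of "Y u" "Y s" "X u - X s" "X t - X u" "XX u t"]]
      by (simp only: distrib_left[of D "_ * _" "_ * _"] mult.assoc)
  qed
qed

text \<open>\<open>BO_pointwise\<close> is applied on three levels: to Y, to its remainder
  \<open>R\<close>, and to the remainder \<open>E\<close> of the integral. The defect on each level
  is a sum of products of quantities bounded on the levels before, together with X and XX.\<close>

lemma solution_imp_davie:
  assumes sol: "rde_solution \<alpha> \<beta> q T X XX f y Y Y'"
  obtains C where "0 < C" "\<And>s t. 0 \<le> s \<Longrightarrow> s \<le> t \<Longrightarrow> t \<le> T \<Longrightarrow>
    norm (remainder Y s t) \<le> C * (t - s) powr (3 * a)"
proof -
  obtain I where Y: "Y \<in> besov_space \<alpha> \<beta> q T" "Y' \<in> besov_space \<alpha> \<beta> q T"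
      "(\<lambda>s t. Y t - Y s - blinfun_apply (Y' s) (X t - X s)) \<in> besov2_space (2 * \<alpha>) (\<beta> / 2) (q / 2) T"
    and Y': "\<And>t v. t \<in> {0..T} \<Longrightarrow> blinfun_apply (Y' t) v = f (Y t) *v v"
    and Ic: "continuous_on {0..T} I"
    and I: "(\<lambda>s t. (I t - I s) - (f (Y s) *v (X t - X s) + blinfun_matrix_act (frechet_D f (Y s) o\<^sub>L Y' s) (XX s t)))
       \<in> besov2_space (3 * \<alpha>) (\<beta> / 3) (q / 3) T"
    and YI: "\<And>t. t \<in> {0..T} \<Longrightarrow> Y t = y + I t"
    using sol unfolding rde_solution_def has_rough_integral_def controlled_paths_def by blast
  obtain K where K: "0 < K" "C11_b K f" "C11_b K Df" "C11_b K gub" using field_C11_b by blast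
  obtain C0 where C0: "0 < C0" "\<And>(M :: real ^ 'n ^ 'm) v. norm (M *v v) \<le> norm M * norm v * C0"
    using matrix_vector_bound by blast
  obtain H where H: "0 < H" "\<And>s t. 0 \<le> s \<Longrightarrow> s \<le> t \<Longrightarrow> t \<le> T \<Longrightarrow> norm (X t - X s) \<le> H * (t - s) powr a"
    "\<And>s t. 0 \<le> s \<Longrightarrow> s \<le> t \<Longrightarrow> t \<le> T \<Longrightarrow> norm (XX s t) \<le> H * (t - s) powr (2 * a)"
    using rough_hoelder by blast
  obtain B where B: "0 < B" "\<And>s t. 0 \<le> s \<Longrightarrow> s \<le> t \<Longrightarrow> t \<le> T \<Longrightarrow> norm (Y t - Y s) \<le> B * (t - s) powr a"
    using hoelder_if_besov[OF Y(1)] by blast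
  note Yc = besov_spaceD(1)[OF Y(1)] and Y'c = besov_spaceD(1)[OF Y(2)]
  have mX: "norm (X v - X r) \<le> H * (t - s) powr a" and mY: "norm (Y v - Y r) \<le> B * (t - s) powr a"
    and mXX: "norm (XX r v) \<le> H * (t - s) powr (2 * a)"
    if "0 \<le> s" "s \<le> r" "r \<le> v" "v \<le> t" "t \<le> T" for r v s t
  proof -
    have p: "(v - r) powr a \<le> (t - s) powr a" "(v - r) powr (2 * a) \<le> (t - s) powr (2 * a)"
      using that a by (auto intro!: powr_mono2)
    show "norm (X v - X r) \<le> H * (t - s) powr a" "norm (Y v - Y r) \<le> B * (t - s) powr a"
      "norm (XX r v) \<le> H * (t - s) powr (2 * a)"
      using H(2)[of r v] B(2)[of r v] H(3)[of r v] mult_left_mono[OF p(1), of H] mult_left_mono[OF p(1), of B]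
        mult_left_mono[OF p(2), of H] H(1) B(1) that by linarith+
  qed
  define R where "R s t = Y t - Y s - blinfun_apply (Y' s) (X t - X s)" for s t
  have Rf: "R s t = Y t - Y s - f (Y s) *v (X t - X s)" if "s \<in> {0..T}" for s t
    by (simp add: R_def Y'[OF that])
  have Rc: "continuous_on (triangle2 T) (\<lambda>(s, t). R s t)"
    unfolding R_def case_prod_unfold
    by (intro continuous_intros continuous_on_triangle2_fst continuous_on_triangle2_snd Yc Y'c X_cont)
  have BR: "BO 2 (\<lambda>s t. norm (R s t))"
    by (rule BO_if_besov2_norm[OF zero_less_numeral ennreal_divide_numeral_facts(1) ennreal_divide_numeral_facts(2) Rc])
       (use Y(3) in \<open>simp add: besov2_space_def R_def[abs_def]\<close>)
  have dR: "norm (R s t - R s u - R u t) \<le> (K * B * H * C0) * (t - s) powr (2 * a)"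
    if st: "0 \<le> s" "s \<le> u" "u \<le> t" "t \<le> T" for s u t
  proof -
    have "R s t - R s u - R u t = (f (Y u) - f (Y s)) *v (X t - X u)"
      using st by (simp add: Rf bounded_bilinear.diff_left[OF bounded_bilinear_matrix_vector]
          bounded_bilinear.diff_right[OF bounded_bilinear_matrix_vector])
    then have "norm (R s t - R s u - R u t) \<le> norm (f (Y u) - f (Y s)) * norm (X t - X u) * C0" by (simp add: C0(2))
    also have "\<dots> \<le> (K * (B * (t - s) powr a)) * (H * (t - s) powr a) * C0"
    proof (intro mult_right_mono mult_mono mX)
      show "norm (f (Y u) - f (Y s)) \<le> K * (B * (t - s) powr a)"
        by (rule order_trans[OF C11_bD(2)[OF K(2)] mult_left_mono[OF mY]]) (use st K in auto)
    qed (use st K B C0 in auto)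
    also have "\<dots> = (K * B * H * C0) * (t - s) powr (2 * a)" by (simp add: powr_add[symmetric])
    finally show ?thesis .
  qed
  have diagR: "R s s = 0" for s by (simp add: R_def blinfun.zero_right)
  obtain S where S: "0 < S" "\<And>s t. 0 \<le> s \<Longrightarrow> s \<le> t \<Longrightarrow> t \<le> T \<Longrightarrow> norm (R s t) \<le> S * (t - s) powr (2 * a)"
    by (rule BO_pointwise[OF _ BR Rc _ _ diagR _ dR]) (use a K B H C0 in \<open>auto intro: that\<close>)
  define E where "E s t = (I t - I s) - (f (Y s) *v (X t - X s) + blinfun_matrix_act (frechet_D f (Y s) o\<^sub>L Y' s) (XX s t))" for s t
  have E: "E s t = remainder Y s t" if "0 \<le> s" "s \<le> t" "t \<le> T" for s t
  proof -
    have "Y' s = blinfun_of_matrix_vector (f (Y s))" using that by (intro blinfun_eqI) (simp add: Y')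
    then show ?thesis using that by (simp add: E_def remainder_def incr_def gub_def Df_def YI)
  qed
  have gubc: "continuous_on {0..T} (\<lambda>s. gub (Y s))" and fYc: "continuous_on {0..T} (\<lambda>s. f (Y s))"
    by (intro continuous_on_lipschitz_compose[OF less_imp_le[OF K(1)] C11_bD(2) Yc] K)+
  have incrc: "continuous_on (triangle2 T) (\<lambda>x. incr (X (snd x) - X (fst x)) (XX (fst x) (snd x)) (Y (fst x)))"
    unfolding incr_def
    by (intro continuous_intros bounded_bilinear.continuous_on[OF bounded_bilinear_matrix_vector]
        bounded_bilinear.continuous_on[OF bounded_bilinear_blinfun_matrix_act]
        continuous_on_triangle2_fst continuous_on_triangle2_snd gubc fYc X_cont XX_cont[unfolded case_prod_unfold])
  have Ec: "continuous_on (triangle2 T) (\<lambda>(s, t). E s t)"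
  proof (rule continuous_on_eq)
    show "continuous_on (triangle2 T) (\<lambda>x. Y (snd x) - Y (fst x) - incr (X (snd x) - X (fst x)) (XX (fst x) (snd x)) (Y (fst x)))"
      by (intro continuous_intros incrc continuous_on_triangle2_fst continuous_on_triangle2_snd Yc)
  qed (auto simp: E remainder_def triangle2_def)
  have BE: "BO 3 (\<lambda>s t. norm (E s t))"
    by (rule BO_if_besov2_norm[OF zero_less_numeral ennreal_divide_numeral_facts(1) ennreal_divide_numeral_facts(2) Ec])
       (use I in \<open>simp add: besov2_space_def E_def[abs_def]\<close>)
  obtain D where D: "0 < D" "\<And>(Y :: real \<Rightarrow> real ^ 'm) s u t. 0 \<le> s \<Longrightarrow> s \<le> u \<Longrightarrow> u \<le> t \<Longrightarrow> t \<le> T \<Longrightarrow>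
    norm (remainder Y s t - remainder Y s u - remainder Y u t) \<le>
    D * (norm (Y u - Y s - f (Y s) *v (X u - X s)) + norm (Y u - Y s) * norm (Y u - Y s)) * norm (X t - X u) +
      D * norm (Y u - Y s) * norm (XX u t)"
    by (rule remainder_delta, rule that)
  have dE: "norm (E s t - E s u - E u t) \<le> (D * (S + B * B) * H + D * B * H) * (t - s) powr (3 * a)"
    if st: "0 \<le> s" "s \<le> u" "u \<le> t" "t \<le> T" for s u t
  proof -
    have "norm (E s t - E s u - E u t) \<le> D * (norm (R s u) + norm (Y u - Y s) * norm (Y u - Y s)) * norm (X t - X u) +
        D * norm (Y u - Y s) * norm (XX u t)"
      using D(2)[OF st, of Y] st by (simp add: E Rf)
    also have "\<dots> \<le> D * (S * (t - s) powr (2 * a) + (B * (t - s) powr a) * (B * (t - s) powr a)) * (H * (t - s) powr a) +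
        D * (B * (t - s) powr a) * (H * (t - s) powr (2 * a))"
    proof (intro add_mono mult_mono mult_left_mono mX mY mXX)
      have "norm (R s u) \<le> S * (u - s) powr (2 * a)" using S(2) st by simp
      also have "\<dots> \<le> S * (t - s) powr (2 * a)" using st S a by (intro mult_left_mono powr_mono2) auto
      finally show "norm (R s u) \<le> S * (t - s) powr (2 * a)" .
    qed (use st D S B H in \<open>auto intro!: add_nonneg_nonneg\<close>)
    also have "\<dots> = (D * (S + B * B) * H + D * B * H) * (t - s) powr (3 * a)"
    proof -
      have "(t - s) powr (2 * a) = (t - s) powr a * (t - s) powr a"
        "(t - s) powr (3 * a) = (t - s) powr a * (t - s) powr a * (t - s) powr a"
        by (simp_all add: powr_add[symmetric])
      then show ?thesis by (simp add: algebra_simps)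
    qed
    finally show ?thesis .
  qed
  have diagE: "E s s = 0" if "0 \<le> s" "s \<le> T" for s
    using that by (simp add: E remainder_def XX_diag incr_def bounded_bilinear.zero_right[OF bounded_bilinear_matrix_vector]
        bounded_bilinear.zero_right[OF bounded_bilinear_blinfun_matrix_act])
  obtain F where F: "0 < F" "\<And>s t. 0 \<le> s \<Longrightarrow> s \<le> t \<Longrightarrow> t \<le> T \<Longrightarrow> norm (E s t) \<le> F * (t - s) powr (3 * a)"
    by (rule BO_pointwise[OF _ BE Ec _ _ diagE _ dE]) (use a D S B H in \<open>auto intro: that\<close>)
  show ?thesis by (rule that[OF F(1)]) (use F(2) E in auto)
qed

lemma davie_imp_solution:
  assumes C: "0 < C" and E: "\<And>s t. 0 \<le> s \<Longrightarrow> s \<le> t \<Longrightarrow> t \<le> T \<Longrightarrow>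
    norm (remainder Y s t) \<le> C * (t - s) powr (3 * a)"
    and Y0: "Y 0 = y"
  shows "\<exists>Y'. rde_solution \<alpha> \<beta> q T X XX f y Y Y'"
proof -
  obtain K where K: "0 < K" "C11_b K f" "C11_b K Df" "C11_b K gub" using field_C11_b by blast
  obtain C0 where C0: "0 < C0" "\<And>(M :: real ^ 'n ^ 'm) v. norm (M *v v) \<le> norm M * norm v * C0"
    "\<And>(A :: (real ^ 'n) \<Rightarrow>\<^sub>L (real ^ 'n ^ 'm)) M. norm (blinfun_matrix_act A M) \<le> norm A * norm M * C0"
    using bilinear_constant by blast
  obtain H where H: "0 < H" "\<And>s t. 0 \<le> s \<Longrightarrow> s \<le> t \<Longrightarrow> t \<le> T \<Longrightarrow> norm (X t - X s) \<le> H * (t - s) powr a"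
    "\<And>s t. 0 \<le> s \<Longrightarrow> s \<le> t \<Longrightarrow> t \<le> T \<Longrightarrow> norm (XX s t) \<le> H * (t - s) powr (2 * a)"
    using rough_hoelder by blast
  obtain D where D: "0 < D" "\<And>y y' x1 x2 M2.
    norm ((f y' - f y - blinfun_apply (gub y) x1) *v x2 + blinfun_matrix_act (gub y' - gub y) M2) \<le>
      D * ((norm (y' - y - f y *v x1) + norm (y' - y) * norm (y' - y)) * norm x2 + norm (y' - y) * norm M2) \<and>
    norm (f y' - f y - blinfun_apply (gub y) x1) \<le> D * (norm (y' - y - f y *v x1) + norm (y' - y) * norm (y' - y))"
    by (rule euler_remainder_delta, rule that)
  obtain D' where D': "0 < D'" "\<And>(Y :: real \<Rightarrow> real ^ 'm) s u t. 0 \<le> s \<Longrightarrow> s \<le> u \<Longrightarrow> u \<le> t \<Longrightarrow> t \<le> T \<Longrightarrow>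
    norm (remainder Y s t - remainder Y s u - remainder Y u t) \<le>
    D' * (norm (Y u - Y s - f (Y s) *v (X u - X s)) + norm (Y u - Y s) * norm (Y u - Y s)) * norm (X t - X u) +
      D' * norm (Y u - Y s) * norm (XX u t)"
    by (rule remainder_delta, rule that)
  define R where "R s t = Y t - Y s - f (Y s) *v (X t - X s)" for s t
  have R_le: "norm (R s t) \<le> (K * C0) * norm (XX s t) + C * (t - s) powr (3 * a)"
    if st: "0 \<le> s" "s \<le> t" "t \<le> T" for s t
  proof -
    have "R s t = blinfun_matrix_act (gub (Y s)) (XX s t) + remainder Y s t" by (simp add: R_def remainder_def incr_def)
    then have "norm (R s t) \<le> norm (blinfun_matrix_act (gub (Y s)) (XX s t)) + norm (remainder Y s t)" by (metis norm_triangle_ineq)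
    also have "norm (blinfun_matrix_act (gub (Y s)) (XX s t)) \<le> norm (gub (Y s)) * norm (XX s t) * C0" by (rule C0(3))
    also have "\<dots> \<le> K * norm (XX s t) * C0" using C0(1) by (intro mult_right_mono C11_bD(1)[OF K(4)]) auto
    finally show ?thesis using E[OF st] by (simp add: mult_ac)
  qed
  define c where "c = K * C0 * H + C * T powr a"
  have c: "0 < c" using K C0 H C by (auto simp: c_def intro!: add_pos_nonneg)
  have R_le2: "norm (R s t) \<le> c * (t - s) powr (2 * a)" if st: "0 \<le> s" "s \<le> t" "t \<le> T" for s t
  proof -
    have "(t - s) powr (3 * a) = (t - s) powr a * (t - s) powr (2 * a)" by (simp add: powr_add[symmetric])
    also have "\<dots> \<le> T powr a * (t - s) powr (2 * a)" using st a by (intro mult_right_mono powr_mono2) auto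
    finally have "C * (t - s) powr (3 * a) \<le> C * (T powr a * (t - s) powr (2 * a))" using C by (intro mult_left_mono) auto
    moreover have "K * C0 * norm (XX s t) \<le> K * C0 * (H * (t - s) powr (2 * a))"
      using K C0 by (intro mult_left_mono H(3) st) auto
    ultimately show ?thesis using R_le[OF st] by (simp add: c_def algebra_simps)
  qed
  have Y_le: "norm (Y t - Y s) \<le> (K * C0) * norm (X t - X s) + c * (t - s) powr (2 * a)"
    if st: "0 \<le> s" "s \<le> t" "t \<le> T" for s t
  proof -
    have "Y t - Y s = f (Y s) *v (X t - X s) + R s t" by (simp add: R_def)
    then have "norm (Y t - Y s) \<le> norm (f (Y s) *v (X t - X s)) + norm (R s t)" by (metis norm_triangle_ineq)
    also have "norm (f (Y s) *v (X t - X s)) \<le> norm (f (Y s)) * norm (X t - X s) * C0" by (rule C0(2))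
    also have "\<dots> \<le> K * norm (X t - X s) * C0" using C0(1) by (intro mult_right_mono C11_bD(1)[OF K(2)]) auto
    finally show ?thesis using R_le2[OF st] by (simp add: mult_ac)
  qed
  define c' where "c' = K * C0 * H + c * T powr a"
  have Y_hoelder: "norm (Y t - Y s) \<le> c' * (t - s) powr a" if st: "0 \<le> s" "s \<le> t" "t \<le> T" for s t
  proof -
    have "(t - s) powr (2 * a) = (t - s) powr a * (t - s) powr a" by (simp add: powr_add[symmetric])
    also have "\<dots> \<le> T powr a * (t - s) powr a" using st a by (intro mult_right_mono powr_mono2) auto
    finally have "c * (t - s) powr (2 * a) \<le> c * (T powr a * (t - s) powr a)" using c by (intro mult_left_mono) auto
    moreover have "K * C0 * norm (X t - X s) \<le> K * C0 * (H * (t - s) powr a)"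
      using K C0 by (intro mult_left_mono H(2) st) auto
    ultimately show ?thesis using Y_le[OF st] by (simp add: c'_def algebra_simps)
  qed
  \<comment> \<open>The expansion comes with no continuity assumption on \<open>Y\<close>;
    continuity follows from the Hoelder bound just derived.\<close>
  have Yc: "continuous_on {0..T} Y"
    unfolding continuous_on_def
  proof (intro ballI)
    fix x assume x: "x \<in> {0..T}"
    show "(Y \<longlongrightarrow> Y x) (at x within {0..T})"
    proof (rule LIM_zero_cancel, rule Lim_null_comparison)
      have "norm (Y z - Y x) \<le> c' * \<bar>z - x\<bar> powr a" if "z \<in> {0..T}" for z
        using that x Y_hoelder[of z x] Y_hoelder[of x z]
        by (cases "z \<le> x") (auto simp: norm_minus_commute abs_minus_commute)
      then show "\<forall>\<^sub>F z in at x within {0..T}. norm (Y z - Y x) \<le> c' * \<bar>z - x\<bar> powr a"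
        by (auto simp: eventually_at_filter)
      have "((\<lambda>z. \<bar>z - x\<bar>) \<longlongrightarrow> 0) (at x within {0..T})" by (intro tendsto_eq_intros) auto
      then have "((\<lambda>z. \<bar>z - x\<bar> powr a) \<longlongrightarrow> 0) (at x within {0..T})"
        by (rule tendsto_zero_powrI[where b = a]) (use a in auto)
      then show "((\<lambda>z. c' * \<bar>z - x\<bar> powr a) \<longlongrightarrow> 0) (at x within {0..T})"
        by (rule tendsto_mult_right_zero)
    qed
  qed
  have gubc: "continuous_on {0..T} (\<lambda>s. gub (Y s))" and fYc: "continuous_on {0..T} (\<lambda>s. f (Y s))"
    by (intro continuous_on_lipschitz_compose[OF less_imp_le[OF K(1)] C11_bD(2) Yc] K)+
  note cont_intros = continuous_intros bounded_bilinear.continuous_on[OF bounded_bilinear_matrix_vector]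
        bounded_bilinear.continuous_on[OF bounded_bilinear_blinfun_matrix_act]
        continuous_on_triangle2_fst continuous_on_triangle2_snd gubc fYc Yc X_cont XX_cont[unfolded case_prod_unfold]
  have Gc: "continuous_on (triangle2 T) (\<lambda>(s, t). remainder Y s t)" and Rc: "continuous_on (triangle2 T) (\<lambda>(s, t). R s t)"
    unfolding remainder_def R_def incr_def case_prod_unfold by (intro cont_intros)+
  have normc: "continuous_on (triangle2 T) (\<lambda>(s, t). norm (\<Xi> s t))" if "continuous_on (triangle2 T) (\<lambda>(s, t). \<Xi> s t)"
    for \<Xi> :: "real \<Rightarrow> real \<Rightarrow> 'w::real_normed_vector"
    using that unfolding case_prod_unfold by (intro continuous_intros)
  have pc: "continuous_on (triangle2 T) (\<lambda>(s, t). (t - s) powr b)" if "0 < b" for b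
    unfolding case_prod_unfold using that
    by (intro continuous_on_powr' continuous_intros) (auto simp: triangle2_def)
  have kpos: "0 < K * C0" using K C0 by simp
  \<comment> \<open>The error powers lie strictly above their grades, as \<open>BO_bounded\<close>
    demands: \<alpha> < 2a here and 2\<alpha> < 3a in \<open>BR\<close>.\<close>
  have BY: "BO 1 (\<lambda>s t. norm (Y t - Y s))"
  proof (rule BO_le)
    show "BO 1 (\<lambda>s t. (K * C0) * norm (X t - X s) + c * (t - s) powr (2 * a))"
      by (intro BO_add BO_scale BO_X BO_bounded[where C = 1 and g = "2 * a"] kpos c pc) (use a in auto)
  qed (use Y_le normc[OF increment_continuous[OF Yc]] in auto)
  have BR: "BO 2 (\<lambda>s t. norm (R s t))"
  proof (rule BO_le)
    show "BO 2 (\<lambda>s t. (K * C0) * norm (XX s t) + C * (t - s) powr (3 * a))"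
      by (intro BO_add BO_scale BO_XX BO_bounded[where C = 1 and g = "3 * a"] kpos C pc) (use a in auto)
  qed (use R_le normc[OF Rc] in auto)
  have BY2: "BO 2 (\<lambda>s t. norm (Y t - Y s) * norm (Y t - Y s))"
    using BO_mult[OF zero_less_one zero_less_one BY BY] by simp
  have BRY: "BO 2 (\<lambda>s t. D * (norm (R s t) + norm (Y t - Y s) * norm (Y t - Y s)))" if "0 < D" for D
    by (intro BO_scale BO_add BR BY2 that) auto
  \<comment> \<open>3a is below 3\<alpha>, so \<open>BO_bounded\<close> is out of reach at grade 3.
    The bound \<open>E\<close> with 3a > 1 only serves as the a priori estimate for sewing.\<close>
  have BG: "BO (2 + 1) (\<lambda>s t. norm (remainder Y s t))"
  proof (rule BO_sewing_products[OF zero_less_numeral zero_less_one _ Gc a(2) C E])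
    show "1 < (2 + 1) * \<alpha>" using alpha3 by simp
    show "BO 2 (\<lambda>s t. D' * (norm (R s t) + norm (Y t - Y s) * norm (Y t - Y s)))" by (rule BRY[OF D'(1)])
    show "BO 1 (\<lambda>s t. norm (X t - X s))" by (rule BO_X)
    show "BO 1 (\<lambda>s t. D' * norm (Y t - Y s))" by (intro BO_scale BY D'(1)) auto
    show "BO 2 (\<lambda>s t. norm (XX s t))" by (rule BO_XX)
    fix s u t assume st: "0 \<le> s" "s \<le> u" "u \<le> t" "t \<le> T"
    show "norm (remainder Y s t - remainder Y s u - remainder Y u t) \<le> D' * (norm (R s u) + norm (Y u - Y s) * norm (Y u - Y s)) * norm (X t - X u) +
        D' * norm (Y u - Y s) * norm (XX u t)"
      unfolding R_def by (rule D'(2)[OF st])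
  qed
  define Y' where "Y' t = blinfun_of_matrix_vector (f (Y t))" for t
  have mv: "linear (blinfun_of_matrix_vector :: real ^ 'n ^ 'm \<Rightarrow> _)" by (rule linear_blinfun_of_matrix_vector)
  have Y_besov: "Y \<in> besov_space \<alpha> \<beta> q T" by (rule besov_spaceI[OF Yc BY])
  have lip_besov: "(\<lambda>t. \<phi> (Y t)) \<in> besov_space \<alpha> \<beta> q T"
    if "0 < B" "\<And>x y. norm (\<phi> x - \<phi> y) \<le> B * norm (x - y)" for \<phi> :: "real ^ 'm \<Rightarrow> 'w::real_normed_vector" and B
  proof (rule besov_spaceI)
    show c: "continuous_on {0..T} (\<lambda>t. \<phi> (Y t))"
      by (rule continuous_on_lipschitz_compose[OF less_imp_le[OF that(1)] that(2) Yc])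
    have "BO 1 (\<lambda>s t. B * norm (Y t - Y s))" by (intro BO_scale BY that) auto
    then show "BO 1 (\<lambda>s t. norm (\<phi> (Y t) - \<phi> (Y s)))"
      by (rule BO_le[rotated]) (use that(2) normc[OF increment_continuous[OF c]] in auto)
  qed
  have Y'_besov: "Y' \<in> besov_space \<alpha> \<beta> q T"
    unfolding Y'_def
  proof (rule lip_besov)
    show "0 < C0 * K" using C0 K by simp
    fix x z
    have "norm (blinfun_of_matrix_vector (f x) - blinfun_of_matrix_vector (f z)) \<le> C0 * norm (f x - f z)"
      unfolding linear_diff[OF mv, symmetric]
      using C0(1) by (intro norm_blinfun_bound) (simp_all add: C0(2)[THEN order_trans] mult_ac)
    also have "\<dots> \<le> C0 * (K * norm (x - z))" using C0 by (intro mult_left_mono C11_bD(2)[OF K(2)]) auto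
    finally show "norm (blinfun_of_matrix_vector (f x) - blinfun_of_matrix_vector (f z)) \<le> C0 * K * norm (x - z)" by (simp add: mult.assoc)
  qed
  have f_besov: "(\<lambda>t. f (Y t)) \<in> besov_space \<alpha> \<beta> q T" by (rule lip_besov[OF K(1) C11_bD(2)[OF K(2)]])
  have g_besov: "(\<lambda>t. gub (Y t)) \<in> besov_space \<alpha> \<beta> q T" by (rule lip_besov[OF K(1) C11_bD(2)[OF K(4)]])
  have "R \<in> besov2_space (2 * \<alpha>) (\<beta> / 2) (q / 2) T"
    by (rule besov2_space_if_BO[OF zero_less_numeral ennreal_divide_numeral_facts(1) ennreal_divide_numeral_facts(2) Rc _ BR])
       (simp add: R_def)
  then have cp1: "(Y, Y') \<in> controlled_paths \<alpha> \<beta> q T X"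
    using Y_besov Y'_besov by (simp add: controlled_paths_def R_def[abs_def] Y'_def)
  define RF where "RF s t = f (Y t) - f (Y s) - blinfun_apply (gub (Y s)) (X t - X s)" for s t
  have RFc: "continuous_on (triangle2 T) (\<lambda>(s, t). RF s t)"
    unfolding RF_def case_prod_unfold by (intro cont_intros)
  have "BO 2 (\<lambda>s t. norm (RF s t))"
    by (rule BO_le[OF _ BRY[OF D(1)] normc[OF RFc]]) (use D(2) in \<open>auto simp: RF_def R_def\<close>)
  then have "RF \<in> besov2_space (2 * \<alpha>) (\<beta> / 2) (q / 2) T"
    by (rule besov2_space_if_BO[OF zero_less_numeral ennreal_divide_numeral_facts(1) ennreal_divide_numeral_facts(2) RFc, rotated])
       (simp add: RF_def blinfun.zero_right)
  then have cp2: "(\<lambda>t. f (Y t), \<lambda>t. gub (Y t)) \<in> controlled_paths \<alpha> \<beta> q T X"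
    using f_besov g_besov by (simp add: controlled_paths_def RF_def[abs_def])
  have "remainder Y \<in> besov2_space (3 * \<alpha>) (\<beta> / 3) (q / 3) T"
    by (rule besov2_space_if_BO[OF zero_less_numeral ennreal_divide_numeral_facts(1) ennreal_divide_numeral_facts(2) Gc])
       (use BG in \<open>simp_all add: remainder_def XX_diag incr_def bounded_bilinear.zero_right[OF bounded_bilinear_matrix_vector]
          bounded_bilinear.zero_right[OF bounded_bilinear_blinfun_matrix_act]\<close>)
  moreover have "(Y t - y - (Y s - y)) - (f (Y s) *v (X t - X s) + blinfun_matrix_act (gub (Y s)) (XX s t)) = remainder Y s t" for s t
    by (simp add: remainder_def incr_def)
  \<comment> \<open>The integral is taken to be Y - y, for which the remainder demanded of the rough
    integral is Davie's remainder identically.\<close>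
  ultimately have "has_rough_integral \<alpha> \<beta> q T X XX (\<lambda>t. f (Y t)) (\<lambda>t. gub (Y t)) (\<lambda>t. Y t - y)"
    using cp2 Yc Y0 by (simp add: has_rough_integral_def continuous_intros)
  moreover have "gub (Y t) = frechet_D f (Y t) o\<^sub>L Y' t" for t by (simp add: gub_def Df_def Y'_def)
  ultimately have "rde_solution \<alpha> \<beta> q T X XX f y Y Y'"
    using cp1 by (auto simp: rde_solution_def Y'_def intro!: exI[of _ "\<lambda>t. Y t - y"])
  then show ?thesis by blast
qed

lemma rde_solution_exists_unique:
  "(\<exists>Y Y'. rde_solution \<alpha> \<beta> q T X XX f y Y Y') \<and>
    (\<forall>Y Y' V V'. rde_solution \<alpha> \<beta> q T X XX f y Y Y' \<longrightarrow> rde_solution \<alpha> \<beta> q T X XX f y V V' \<longrightarrow>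
       (\<forall>t\<in>{0..T}. Y t = V t \<and> Y' t = V' t))"
proof -
  obtain H where H: "0 < H" "\<And>s t. 0 \<le> s \<Longrightarrow> s \<le> t \<Longrightarrow> t \<le> T \<Longrightarrow> norm (X t - X s) \<le> H * (t - s) powr a"
    "\<And>s t. 0 \<le> s \<Longrightarrow> s \<le> t \<Longrightarrow> t \<le> T \<Longrightarrow> norm (XX s t) \<le> H * (t - s) powr (2 * a)"
    using rough_hoelder by blast
  obtain K where "almost_flow T a K (\<lambda>s t y. y + incr (X t - X s) (XX s t) y) (\<lambda>s t. (X t - X s, XX s t))"
    by (rule almost_flow_rde[OF T a(2) H chen X_cont XX_cont])
  then interpret af: almost_flow T a K "\<lambda>s t y. y + incr (X t - X s) (XX s t) y" "\<lambda>s t. (X t - X s, XX s t)" .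
  have davie: "\<exists>C. af.davie_solution C Y \<and> Y 0 = y" if sol: "rde_solution \<alpha> \<beta> q T X XX f y Y Y'" for Y Y'
  proof -
    obtain C where "0 < C" "\<And>s t. 0 \<le> s \<Longrightarrow> s \<le> t \<Longrightarrow> t \<le> T \<Longrightarrow>
      norm (remainder Y s t) \<le> C * (t - s) powr (3 * a)"
      using solution_imp_davie[OF sol] by blast
    then have "af.davie_solution C Y" by (simp add: af.davie_solution_def remainder_def diff_diff_eq)
    moreover have "Y 0 = y" using sol T by (auto simp: rde_solution_def has_rough_integral_def)
    ultimately show ?thesis by blast
  qed
  show ?thesis
  proof (intro conjI allI impI ballI)
    obtain Y C where Y: "Y 0 = y" "af.davie_solution C Y" using af.davie_solution_exists by blast
    \<comment> \<open>\<open>davie_imp_solution\<close> wants a positive constant, whereas existence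
      says nothing about the sign of \<open>C\<close>.\<close>
    have "norm (remainder Y s t) \<le> max C 1 * (t - s) powr (3 * a)"
      if st: "0 \<le> s" "s \<le> t" "t \<le> T" for s t
    proof -
      have "norm (remainder Y s t) \<le> C * (t - s) powr (3 * a)"
        using Y(2) st by (simp add: af.davie_solution_def remainder_def diff_diff_eq)
      also have "\<dots> \<le> max C 1 * (t - s) powr (3 * a)" by (intro mult_right_mono) auto
      finally show ?thesis .
    qed
    then show "\<exists>Y Y'. rde_solution \<alpha> \<beta> q T X XX f y Y Y'"
      using davie_imp_solution[of "max C 1" Y y] Y(1) by (meson less_max_iff_disj zero_less_one)
  next
    fix Y Y' V V' t
    assume sol: "rde_solution \<alpha> \<beta> q T X XX f y Y Y'" "rde_solution \<alpha> \<beta> q T X XX f y V V'" and t: "t \<in> {0..T}"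
    obtain C1 C2 where C: "af.davie_solution C1 Y" "Y 0 = y" "af.davie_solution C2 V" "V 0 = y"
      using davie[OF sol(1)] davie[OF sol(2)] by blast
    show "Y t = V t" using af.davie_solution_unique[OF C(1,3)] C(2,4) t by simp
    \<comment> \<open>Both derivatives are f along the same path, by the Gubinelli clause of
      \<open>rde_solution\<close>.\<close>
    then show "Y' t = V' t" using sol t by (intro blinfun_eqI) (simp add: rde_solution_def)
  qed
qed

end

theorem theorem5p2:
  fixes T \<alpha> \<beta> :: real and q :: ennreal
    and X :: "real \<Rightarrow> real ^ 'n" and XX :: "real \<Rightarrow> real \<Rightarrow> real ^ 'n ^ 'n"
    and f :: "real ^ 'm \<Rightarrow> real ^ 'n ^ 'm"
  assumes "0 < T" and "1 / 3 < \<alpha>" and "\<alpha> \<le> 1 / 2" and "0 < \<beta>" and "0 < q"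
    and "(X, XX) \<in> rough_paths \<alpha> \<beta> q T"
    and "C3_b f"
  shows "\<forall>y :: real ^ 'm.
    (\<exists>Y Y'. rde_solution \<alpha> \<beta> q T X XX f y Y Y') \<and>
    (\<forall>Y Y' V V'. rde_solution \<alpha> \<beta> q T X XX f y Y Y' \<longrightarrow> rde_solution \<alpha> \<beta> q T X XX f y V V' \<longrightarrow>
       (\<forall>t\<in>{0..T}. Y t = V t \<and> Y' t = V' t))"
proof -
  interpret rde_problem T \<alpha> \<beta> q f X XX
    by unfold_locales (use assms in auto)
  show ?thesis using rde_solution_exists_unique by blast
qed

end
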